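(* Let $\mathcal{S}_8=\{I_8,E_8\}$. Every $8$-criterion set must contain $\mathcal{S}_8$ as a subset (lattices being identified up to isometry).
   Context: A lattice means a positive-definite integral $\mathbb{Z}$-lattice: a free $\mathbb{Z}$-module $L$ of finite rank equipped with a positive-definite symmetric bilinear form $B(\cdot,\cdot)$ with $B(L,L)\subseteq\mathbb{Z}$. Equivalently, it is given by a positive-definite symmetric integer Gram matrix (a positive-definite integer-matrix quadratic form). Lattices are considered up to isometry. A lattice $L$ represents a lattice $\ell$ if there exists a $\mathbb{Z}$-linear injection $\ell\to L$ preserving the bilinear forms. A lattice is $8$-universal if it represents all lattices of rank $8$. An $8$-criterion set is a set $\mathcal{S}$ of rank-$8$ lattices having the property that, for every lattice $L$, $L$ is $8$-universal if and only if $L$ represents every lattice in $\mathcal{S}$. $I_8$ denotes the rank-$8$ lattice $\langle 1,\ldots,1\rangle$, i.e. $\mathbb{Z}^8$ with Gram matrix the identity matrix, and $E_8$ denotes the unique (up to isometry) even unimodular lattice of rank $8$. *)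

theory Defs
  imports Jordan_Normal_Form.Determinant
begin

text \<open>
  A lattice of rank \<open>n\<close> is given by its Gram matrix with respect to a basis, i.e. a symmetric
  positive-definite \<open>n \<times> n\<close> integer matrix; the underlying module is \<open>\<int>\<^sup>n\<close> (\<open>carrier_vec n\<close>).
  The rank may be any natural number, including 0.
\<close>

definition bform :: "int mat \<Rightarrow> int vec \<Rightarrow> int vec \<Rightarrow> int" where
  "bform A v w = v \<bullet> (A *\<^sub>v w)"

definition lattice_of_rank :: "nat \<Rightarrow> int mat \<Rightarrow> bool" where
  "lattice_of_rank n A \<longleftrightarrow>
     A \<in> carrier_mat n n \<and> A\<^sup>T = A \<and>
     (\<forall>v \<in> carrier_vec n. v \<noteq> 0\<^sub>v n \<longrightarrow> bform A v v > 0)"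

definition is_lattice :: "int mat \<Rightarrow> bool" where
  "is_lattice A \<longleftrightarrow> (\<exists>n. lattice_of_rank n A)"

text \<open>
  The \<open>\<int>\<close>-linear maps \<open>\<int>\<^sup>m \<rightarrow> \<int>\<^sup>n\<close> are exactly the maps \<open>v \<mapsto> T v\<close> for an \<open>n \<times> m\<close> integer matrix \<open>T\<close>.
  Such a map preserves the forms given by the Gram matrices \<open>B\<close> (source) and \<open>A\<close> (target) if:
\<close>

definition form_preserving :: "int mat \<Rightarrow> int mat \<Rightarrow> int mat \<Rightarrow> bool" where
  "form_preserving T B A \<longleftrightarrow>
     T \<in> carrier_mat (dim_row A) (dim_row B) \<and>
     (\<forall>v \<in> carrier_vec (dim_row B). \<forall>w \<in> carrier_vec (dim_row B).
        bform A (T *\<^sub>v v) (T *\<^sub>v w) = bform B v w)"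

definition represents :: "int mat \<Rightarrow> int mat \<Rightarrow> bool" where
  "represents A B \<longleftrightarrow>
     (\<exists>T. form_preserving T B A \<and> inj_on ((*\<^sub>v) T) (carrier_vec (dim_row B)))"

definition isometric :: "int mat \<Rightarrow> int mat \<Rightarrow> bool" where
  "isometric A B \<longleftrightarrow>
     (\<exists>T. form_preserving T B A \<and>
        bij_betw ((*\<^sub>v) T) (carrier_vec (dim_row B)) (carrier_vec (dim_row A)))"

definition n_universal :: "nat \<Rightarrow> int mat \<Rightarrow> bool" where
  "n_universal n L \<longleftrightarrow> (\<forall>K. lattice_of_rank n K \<longrightarrow> represents L K)"

text \<open>
  A set of lattices is a set of Gram matrices, of which any number may belong to the same isometry
  class; the set need not be closed under isometry.
\<close>

definition criterion_set :: "nat \<Rightarrow> int mat set \<Rightarrow> bool" where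
  "criterion_set n S \<longleftrightarrow>
     (\<forall>K \<in> S. lattice_of_rank n K) \<and>
     (\<forall>L. is_lattice L \<longrightarrow> (n_universal n L \<longleftrightarrow> (\<forall>K \<in> S. represents L K)))"

definition subset_upto_isometry :: "int mat set \<Rightarrow> int mat set \<Rightarrow> bool" where
  "subset_upto_isometry S S' \<longleftrightarrow> (\<forall>K \<in> S. \<exists>K' \<in> S'. isometric K K')"

definition even_lattice :: "int mat \<Rightarrow> bool" where
  "even_lattice A \<longleftrightarrow> (\<forall>v \<in> carrier_vec (dim_row A). even (bform A v v))"

text \<open>A positive-definite form has positive determinant, so \<open>det A = \<plusminus>1\<close> amounts to \<open>det A = 1\<close>.\<close>

definition unimodular :: "int mat \<Rightarrow> bool" where
  "unimodular A \<longleftrightarrow> det A = 1"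

definition I8 :: "int mat" where
  "I8 = 1\<^sub>m 8"

text \<open>
  The Cartan matrix of the root system \<open>E\<^sub>8\<close>: the Dynkin diagram is the path on the vertices 0, ..., 6
  with the vertex 7 attached to the vertex 2.  The facts \<open>E8_lattice\<close>, \<open>E8_even\<close> and
  \<open>E8_unimodular\<close> below show that it is an even unimodular lattice of rank 8, which determines it
  up to isometry.
\<close>

definition E8 :: "int mat" where
  "E8 = mat 8 8 (\<lambda>(i, j).
    [[ 2, -1,  0,  0,  0,  0,  0,  0],
     [-1,  2, -1,  0,  0,  0,  0,  0],
     [ 0, -1,  2, -1,  0,  0,  0, -1],
     [ 0,  0, -1,  2, -1,  0,  0,  0],
     [ 0,  0,  0, -1,  2, -1,  0,  0],
     [ 0,  0,  0,  0, -1,  2, -1,  0],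
     [ 0,  0,  0,  0,  0, -1,  2,  0],
     [ 0,  0, -1,  0,  0,  0,  0,  2]] ! i ! j)"

definition S8 :: "int mat set" where
  "S8 = {I8, E8}"

lemma I8_lattice: "lattice_of_rank 8 I8"
proof -
  have "bform I8 v v > 0" if v: "v \<in> carrier_vec 8" and nz: "v \<noteq> 0\<^sub>v 8" for v
  proof -
    obtain i where i: "i < 8" "v $ i \<noteq> 0"
      using v nz by (metis eq_vecI carrier_vecD index_zero_vec)
    have "0 < (\<Sum>j\<in>{0..<8}. v $ j * v $ j)"
      by (rule sum_pos2[of _ i]) (use i in \<open>auto simp: zero_less_mult_iff\<close>)
    then show ?thesis
      using v by (simp add: bform_def I8_def scalar_prod_def)
  qed
  then show ?thesis
    by (auto simp: lattice_of_rank_def I8_def)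
qed

lemma less_8_cases:
  "i < (8::nat) \<longleftrightarrow> i = 0 \<or> i = 1 \<or> i = 2 \<or> i = 3 \<or> i = 4 \<or> i = 5 \<or> i = 6 \<or> i = 7"
  by auto

lemma E8_form:
  assumes "v \<in> carrier_vec 8"
  shows "bform E8 v v =
    2 * ((v$0)^2 + (v$1)^2 + (v$2)^2 + (v$3)^2 + (v$4)^2 + (v$5)^2 + (v$6)^2 + (v$7)^2
      - v$0 * v$1 - v$1 * v$2 - v$2 * v$3 - v$3 * v$4 - v$4 * v$5 - v$5 * v$6 - v$2 * v$7)"
proof -
  have up: "{0..<8} = {0, 1, 2, 3, 4, 5, 6, 7::nat}"
    by auto
  show ?thesis
    using assms
    by (simp add: bform_def scalar_prod_def up E8_def
        algebra_simps power2_eq_square)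
qed

lemma E8_even: "even_lattice E8"
proof -
  have "dim_row E8 = 8"
    by (simp add: E8_def)
  then show ?thesis
    by (simp add: even_lattice_def E8_form)
qed

lemma sum_8_squares_le_0:
  fixes a b c d e f g h :: int
  assumes "420 * a^2 + 140 * b^2 + 70 * c^2 + 42 * d^2 + 28 * e^2 + 20 * f^2 + 15 * g^2
    + 105 * h^2 \<le> 0"
  shows "a = 0 \<and> b = 0 \<and> c = 0 \<and> d = 0 \<and> e = 0 \<and> f = 0 \<and> g = 0 \<and> h = 0"
proof -
  have "a^2 \<ge> 0" "b^2 \<ge> 0" "c^2 \<ge> 0" "d^2 \<ge> 0" "e^2 \<ge> 0" "f^2 \<ge> 0" "g^2 \<ge> 0" "h^2 \<ge> 0"
    by simp_all
  with assms have "a^2 = 0" "b^2 = 0" "c^2 = 0" "d^2 = 0" "e^2 = 0" "f^2 = 0" "g^2 = 0" "h^2 = 0"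
    by linarith+
  then show ?thesis
    by simp
qed

lemma E8_lattice: "lattice_of_rank 8 E8"
proof -
  have c: "E8 \<in> carrier_mat 8 8"
    by (simp add: E8_def)
  have s: "E8\<^sup>T = E8"
  proof (rule eq_matI)
    fix i j assume "i < dim_row E8" "j < dim_col E8"
    then have "i < 8" "j < 8"
      using c by auto
    then show "E8\<^sup>T $$ (i, j) = E8 $$ (i, j)"
      unfolding less_8_cases
      by (elim disjE) (simp_all add: E8_def)
  qed (use c in auto)
  have p: "bform E8 v v > 0" if v: "v \<in> carrier_vec 8" and nz: "v \<noteq> 0\<^sub>v 8" for v
  proof (rule ccontr)
    let ?s = "420 * (2*v$0 - v$1)^2 + 140 * (3*v$1 - 2*v$2)^2 + 70 * (4*v$2 - 3*v$3 - 3*v$7)^2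
      + 42 * (5*v$3 - 4*v$4 - 3*v$7)^2 + 28 * (6*v$4 - 5*v$5 - 3*v$7)^2
      + 20 * (7*v$5 - 6*v$6 - 3*v$7)^2 + 15 * (8*v$6 - 3*v$7)^2 + 105 * (v$7)^2"
    assume "\<not> bform E8 v v > 0"
    moreover have e: "840 * bform E8 v v = ?s"
      unfolding E8_form[OF v] by (simp add: algebra_simps power2_eq_square)
    ultimately have le: "?s \<le> 0"
      by linarith
    have "2*v$0 - v$1 = 0 \<and> 3*v$1 - 2*v$2 = 0 \<and> 4*v$2 - 3*v$3 - 3*v$7 = 0
      \<and> 5*v$3 - 4*v$4 - 3*v$7 = 0 \<and> 6*v$4 - 5*v$5 - 3*v$7 = 0 \<and> 7*v$5 - 6*v$6 - 3*v$7 = 0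
      \<and> 8*v$6 - 3*v$7 = 0 \<and> v$7 = 0"
      using le by (rule sum_8_squares_le_0)
    then have v0: "v$7 = 0" "v$6 = 0" "v$5 = 0" "v$4 = 0" "v$3 = 0" "v$2 = 0" "v$1 = 0" "v$0 = 0"
      by linarith+
    have "v = 0\<^sub>v 8"
    proof (rule eq_vecI)
      fix i assume "i < dim_vec (0\<^sub>v 8 :: int vec)"
      then have "i < 8"
        by simp
      then show "v $ i = 0\<^sub>v 8 $ i"
        unfolding less_8_cases by (elim disjE) (simp_all add: v0 v0(7)[unfolded One_nat_def])
    qed (use v in auto)
    with nz show False ..
  qed
  from c s p show ?thesis
    by (auto simp: lattice_of_rank_def)
qed

lemma E8_unimodular: "unimodular E8"
proof -
  define L :: "int mat" where "L = mat 8 8 (\<lambda>(i, j).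
    [[1, 0, 0, 0, 0, 0, 0, 0], [1, 2, 0, 0, 0, 0, 0, 0],
     [1, 2, 3, 0, 0, 0, 0, 0], [1, 2, 3, 4, 0, 0, 0, 0],
     [1, 2, 3, 4, 5, 0, 0, 0], [1, 2, 3, 4, 5, 6, 0, 0],
     [1, 2, 3, 4, 5, 6, 7, 0], [5, 10, 15, 12, 9, 6, 3, 8]] ! i ! j)"
  define U :: "int mat" where "U = mat 8 8 (\<lambda>(i, j).
    [[2, -1, 0, 0, 0, 0, 0, 0], [0, 3, -2, 0, 0, 0, 0, 0],
     [0, 0, 4, -3, 0, 0, 0, -3], [0, 0, 0, 5, -4, 0, 0, -3],
     [0, 0, 0, 0, 6, -5, 0, -3], [0, 0, 0, 0, 0, 7, -6, -3],
     [0, 0, 0, 0, 0, 0, 8, -3], [0, 0, 0, 0, 0, 0, 0, 1]] ! i ! j)"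
  have up: "{0..<8} = {0, 1, 2, 3, 4, 5, 6, 7::nat}"
    by auto
  have upl: "[0..<8] = [0, 1, 2, 3, 4, 5, 6, 7]"
    by (simp add: upt_rec)
  have cE: "E8 \<in> carrier_mat 8 8" and cL: "L \<in> carrier_mat 8 8" and cU: "U \<in> carrier_mat 8 8"
    by (simp_all add: E8_def L_def U_def)
  have "L * E8 = U"
  proof (rule eq_matI)
    fix i j assume "i < dim_row U" "j < dim_col U"
    then have "i < 8" "j < 8"
      using cU by auto
    then show "(L * E8) $$ (i, j) = U $$ (i, j)"
      unfolding less_8_cases
      by (elim disjE)
        (simp_all add: L_def E8_def U_def scalar_prod_def up)
  qed (use cE cL cU in auto)
  then have "det L * det E8 = det U"
    using det_mult[OF cL cE] by simp
  moreover have "det L = prod_list (diag_mat L)"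
  proof (rule det_lower_triangular[OF _ cL])
    fix i j :: nat assume ij: "i < j" "j < 8"
    then have "i < 8" "j < 8"
      by auto
    then show "L $$ (i, j) = 0"
      using ij(1) unfolding less_8_cases by (elim disjE) (simp_all add: L_def)
  qed
  moreover have "det U = prod_list (diag_mat U)"
  proof (rule det_upper_triangular[OF _ cU], rule upper_triangularI)
    fix i j assume ij: "j < i" "i < dim_row U"
    then have "i < 8" "j < 8"
      using cU by auto
    then show "U $$ (i, j) = 0"
      using ij(1) unfolding less_8_cases by (elim disjE) (simp_all add: U_def)
  qed
  moreover have "prod_list (diag_mat L) = 40320" "prod_list (diag_mat U) = 40320"
    by (simp_all add: diag_mat_def L_def U_def upl)
  ultimately show ?thesis
    by (simp add: unimodular_def)
qed

end

theory Submission
  imports Defs "HOL-Computational_Algebra.Primes"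
begin

text \<open>
  Let \<open>K\<close> be \<open>I8\<close> or \<open>E8\<close> and suppose that no member of a criterion set \<open>S\<close> is isometric to \<open>K\<close>.
  The proof constructs one lattice \<open>L\<close> that represents every lattice of rank 8 except those isometric
  to \<open>K\<close>, but not \<open>K\<close>. Such an \<open>L\<close> represents all of \<open>S\<close> without being 8-universal, which contradicts
  the criterion property. Since \<open>K\<close> is unimodular, a lattice of rank 8 that represents \<open>K\<close> is isometric
  to \<open>K\<close> (\<open>unimodular_represented_imp_isometric\<close>), so only lattices that do not represent \<open>K\<close> have to be
  represented by \<open>L\<close>.

  The lattice \<open>L\<close> is an orthogonal sum of finitely many lattices, and the main point is that finitely
  many suffice. Theorem \<open>finite_cover\<close> says: if the basis vectors of a form \<open>k\<close> have norm 1 or 2, then for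
  each \<open>n\<close> there are finitely many positive definite forms not representing \<open>k\<close> such that every
  positive semidefinite \<open>n\<close>-ary form \<open>a\<close> not representing \<open>k\<close> is a sum of pullbacks of them, that is,
  is represented by their orthogonal sum. This is an induction on \<open>n\<close> based on a reduced basis
  (\<open>reduction\<close>). If the first diagonal entry is 0, then \<open>a\<close> involves fewer variables.

  If the first diagonal entry of the reduced form \<open>a\<close> is positive and bounded, \<open>bounded_split\<close> writes \<open>a = X + z\<close>
  where \<open>X\<close> has bounded entries and \<open>z\<close> involves fewer variables. All values of \<open>z\<close> are 0 or at
  least 3, and \<open>X\<close> is at least 3 wherever \<open>z\<close> is nonzero. Hence the vectors with \<open>X\<close>-norm at most 2
  span a lattice on which \<open>X\<close> and \<open>a\<close> agree, so that \<open>X\<close> does not represent \<open>k\<close>. There are finitely many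
  such \<open>X\<close>, and \<open>z\<close> is covered by induction.

  If the first diagonal entry is large, \<open>large_split\<close> distributes the first row of \<open>a\<close> almost equally
  among \<open>q\<close> forms with bounded entries and minimum at least 3, where \<open>q\<close> is unbounded, and leaves a form
  \<open>z\<close> in fewer variables as before. The \<open>q\<close> forms belong to a finite set. A form \<open>g\<close> that occurs \<open>c\<close> times
  contributes \<open>c g\<close>, which is represented by four orthogonal copies of \<open>g\<close> because \<open>c\<close> is a sum
  of four squares.

  For \<open>E8\<close> the theorem is applied to \<open>k = E8\<close>. The orthogonal sum does not represent \<open>E8\<close>, because \<open>E8\<close> is
  not a sum of two nonzero positive semidefinite integral forms (\<open>even_unimodular_indecomposable\<close>).

  For \<open>I8\<close> it is applied to the unary form \<open>k = \<langle>1\<rangle>\<close>, and \<open>L\<close> is the orthogonal sum of \<open>I\<^sub>7\<close> and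
  the resulting lattices. Vectors of norm 1 in \<open>L\<close> lie in \<open>I\<^sub>7\<close>, so \<open>L\<close> does not contain eight orthonormal
  vectors. A lattice of rank 8 not representing \<open>I8\<close> has a maximal orthonormal system of at most 7 vectors;
  splitting it off leaves a form without values 1 (\<open>orthonormal_complement\<close>).
\<close>

section \<open>Sums of four squares\<close>

definition sum_of_four_squares :: "int \<Rightarrow> bool" where
  "sum_of_four_squares n \<longleftrightarrow> (\<exists>a b c d. n = a^2 + b^2 + c^2 + d^2)"

lemma sum_of_four_squares_mult:
  assumes "sum_of_four_squares m" "sum_of_four_squares n"
  shows "sum_of_four_squares (m * n)"
proof -
  obtain a b c d x y z w where "m = a^2 + b^2 + c^2 + d^2" "n = x^2 + y^2 + z^2 + w^2"
    using assms unfolding sum_of_four_squares_def by blast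
  then have "m * n = (a*x + b*y + c*z + d*w)^2 + (a*y - b*x + c*w - d*z)^2
      + (a*z - b*w - c*x + d*y)^2 + (a*w + b*z - c*y - d*x)^2"
    by (simp add: power2_eq_square algebra_simps)
  then show ?thesis
    unfolding sum_of_four_squares_def by blast
qed

text \<open>
  The residue of least absolute value serves twice: in the descent for four squares and for making
  the first row of a Gram matrix small.
\<close>

lemma absolutely_least_residue:
  fixes a m :: int
  assumes "m > 0"
  obtains y k where "a = y + m * k" "4 * y^2 \<le> m^2"
proof -
  define y where "y = (if 2 * (a mod m) \<le> m then a mod m else a mod m - m)"
  have "0 \<le> a mod m" "a mod m < m"
    using assms by simp_all
  then have "\<bar>2 * y\<bar> \<le> \<bar>m\<bar>"
    unfolding y_def by auto
  then have "4 * y^2 \<le> m^2"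
    using abs_le_square_iff[of "2 * y" m] by (simp add: power_mult_distrib)
  moreover have "a = y + m * (a div m + (if 2 * (a mod m) \<le> m then 0 else 1))"
    unfolding y_def by (simp add: algebra_simps)
  ultimately show thesis
    using that by blast
qed

text \<open>
  Replacing the four roots by their absolutely least residues modulo \<open>m\<close> gives a sum of four squares
  \<open>m * r\<close> with \<open>r \<le> m\<close>. In the product of \<open>m * p\<close> and \<open>m * r\<close>, written by Euler's identity, all four
  roots are divisible by \<open>m\<close>. The extreme values \<open>r = 0\<close> and \<open>r = m\<close> would make \<open>m\<close> a divisor of \<open>p\<close>.
\<close>

lemma four_squares_descent:
  fixes p m :: int
  assumes p: "prime p" and m: "1 < m" "m < p" and s: "sum_of_four_squares (m * p)"
  shows "\<exists>r. 0 < r \<and> r < m \<and> sum_of_four_squares (r * p)"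
proof -
  have ndvd: "\<not> m dvd p"
    using p m unfolding prime_int_iff by (auto dest!: conjunct2 spec[of _ m])
  obtain a b c d where abcd: "m * p = a^2 + b^2 + c^2 + d^2"
    using s unfolding sum_of_four_squares_def by blast
  obtain x i where x: "a = x + m * i" "4 * x^2 \<le> m^2"
    using absolutely_least_residue[of m a] m by auto
  obtain y j where y: "b = y + m * j" "4 * y^2 \<le> m^2"
    using absolutely_least_residue[of m b] m by auto
  obtain z k where z: "c = z + m * k" "4 * z^2 \<le> m^2"
    using absolutely_least_residue[of m c] m by auto
  obtain w l where w: "d = w + m * l" "4 * w^2 \<le> m^2"
    using absolutely_least_residue[of m d] m by auto
  define r where "r = p - (2*x*i + 2*y*j + 2*z*k + 2*w*l) - m * (i^2 + j^2 + k^2 + l^2)"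
  have mr: "x^2 + y^2 + z^2 + w^2 = m * r"
    using abcd unfolding x(1) y(1) z(1) w(1) r_def by (simp add: power2_eq_square algebra_simps)
  have "m * r \<ge> 0"
    unfolding mr[symmetric] by simp
  then have "r \<ge> 0"
    using m by (simp add: zero_le_mult_iff)
  have "4 * (m * r) \<le> 4 * (m * m)"
    unfolding mr[symmetric] using x(2) y(2) z(2) w(2) by (simp add: power2_eq_square)
  then have "r \<le> m"
    using m by simp
  have "r \<noteq> 0"
  proof
    assume "r = 0"
    then have "x^2 + y^2 + z^2 + w^2 = 0"
      using mr by simp
    then have "x^2 = 0" "y^2 = 0" "z^2 = 0" "w^2 = 0"
      using zero_le_power2[of x] zero_le_power2[of y] zero_le_power2[of z] zero_le_power2[of w]
      by linarith+
    then have "x = 0 \<and> y = 0 \<and> z = 0 \<and> w = 0"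
      by simp
    then have "m * p = m * (m * (i^2 + j^2 + k^2 + l^2))"
      using abcd x(1) y(1) z(1) w(1) by (simp add: power2_eq_square algebra_simps)
    then show False
      using m ndvd by simp
  qed
  have "r \<noteq> m"
  proof
    assume "r = m"
    then have e: "x^2 + y^2 + z^2 + w^2 = m^2"
      using mr by (simp add: power2_eq_square)
    have "4 * x^2 = m^2" "4 * y^2 = m^2" "4 * z^2 = m^2" "4 * w^2 = m^2"
      using e x(2) y(2) z(2) w(2) by linarith+
    then have "(2*x)^2 = m^2" "(2*y)^2 = m^2" "(2*z)^2 = m^2" "(2*w)^2 = m^2"
      by (simp_all add: power_mult_distrib)
    then have "2*x = m \<or> 2*x = -m" "2*y = m \<or> 2*y = -m" "2*z = m \<or> 2*z = -m" "2*w = m \<or> 2*w = -m"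
      unfolding power2_eq_iff .
    then have dv: "m dvd 2*x" "m dvd 2*y" "m dvd 2*z" "m dvd 2*w"
      by (metis dvd_minus_iff dvd_refl minus_minus)+
    have "p = r + (2*x*i + 2*y*j + 2*z*k + 2*w*l) + m * (i^2 + j^2 + k^2 + l^2)"
      unfolding r_def by simp
    then have "m dvd p"
      using dv \<open>r = m\<close> by (simp add: dvd_add)
    then show False
      using ndvd by simp
  qed
  define A where "A = r + x*i + y*j + z*k + w*l"
  define B where "B = i*y - j*x + k*w - l*z"
  define C where "C = i*z - j*w - k*x + l*y"
  define D where "D = i*w + j*z - k*y - l*x"
  have "a*x + b*y + c*z + d*w = m * A"
    using mr unfolding x(1) y(1) z(1) w(1) A_def by (simp add: power2_eq_square algebra_simps)
  moreover have "a*y - b*x + c*w - d*z = m * B"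
    unfolding x(1) y(1) z(1) w(1) B_def by (simp add: algebra_simps)
  moreover have "a*z - b*w - c*x + d*y = m * C"
    unfolding x(1) y(1) z(1) w(1) C_def by (simp add: algebra_simps)
  moreover have "a*w + b*z - c*y - d*x = m * D"
    unfolding x(1) y(1) z(1) w(1) D_def by (simp add: algebra_simps)
  moreover have "(m * p) * (m * r) = (a*x + b*y + c*z + d*w)^2 + (a*y - b*x + c*w - d*z)^2
      + (a*z - b*w - c*x + d*y)^2 + (a*w + b*z - c*y - d*x)^2"
    unfolding abcd mr[symmetric] by (simp add: power2_eq_square algebra_simps)
  ultimately have "m^2 * (r * p) = m^2 * (A^2 + B^2 + C^2 + D^2)"
    by (simp add: power2_eq_square algebra_simps)
  then have "r * p = A^2 + B^2 + C^2 + D^2"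
    using m by simp
  then show ?thesis
    using \<open>r \<ge> 0\<close> \<open>r \<le> m\<close> \<open>r \<noteq> 0\<close> \<open>r \<noteq> m\<close> unfolding sum_of_four_squares_def
    by (intro exI[of _ r]) auto
qed

text \<open>
  The \<open>h + 1\<close> residues \<open>a\<^sup>2\<close> and the \<open>h + 1\<close> residues \<open>- 1 - b\<^sup>2\<close> cannot be disjoint
  among \<open>p = 2 * h + 1\<close> residues.
\<close>

lemma odd_prime_dvd_two_squares_plus_one:
  fixes p h :: int
  assumes p: "prime p" and h: "p = 2 * h + 1"
  obtains a b where "0 \<le> a" "a \<le> h" "0 \<le> b" "b \<le> h" "p dvd a^2 + b^2 + 1"
proof -
  have h0: "h \<ge> 0"
    using prime_gt_0_int[OF p] h by simp
  have eq: "s = t" if "s \<in> {0..h}" "t \<in> {0..h}" "p dvd s^2 - t^2" for s t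
  proof -
    have "p dvd (s - t) * (s + t)"
      using that(3) by (simp add: power2_eq_square algebra_simps)
    then have "p dvd s - t \<or> p dvd s + t"
      using p prime_dvd_mult_iff by blast
    moreover have "\<bar>s - t\<bar> < p" "0 \<le> s + t" "s + t < p"
      using that h by auto
    ultimately have "s - t = 0 \<or> s + t = 0"
      using dvd_imp_le_int[of "s - t" p] dvd_imp_le_int[of "s + t" p] by linarith
    then show ?thesis
      using that(1,2) by auto
  qed
  let ?f = "\<lambda>t. t^2 mod p" and ?g = "\<lambda>t. (- 1 - t^2) mod p"
  have "inj_on ?f {0..h}"
    by (rule inj_onI) (auto intro!: eq simp: mod_eq_dvd_iff)
  then have cf: "card (?f ` {0..h}) = nat (h + 1)"
    by (simp add: card_image)
  have "inj_on ?g {0..h}"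
  proof (rule inj_onI)
    fix s t assume "s \<in> {0..h}" "t \<in> {0..h}" "?g s = ?g t"
    then show "s = t"
      using eq[of t s] by (auto simp: mod_eq_dvd_iff)
  qed
  then have cg: "card (?g ` {0..h}) = nat (h + 1)"
    by (simp add: card_image)
  have sub: "?f ` {0..h} \<union> ?g ` {0..h} \<subseteq> {0..<p}"
    using prime_gt_0_int[OF p] by auto
  have "?f ` {0..h} \<inter> ?g ` {0..h} \<noteq> {}"
  proof
    assume "?f ` {0..h} \<inter> ?g ` {0..h} = {}"
    then have "card (?f ` {0..h} \<union> ?g ` {0..h}) = nat (h + 1) + nat (h + 1)"
      using cf cg by (simp add: card_Un_disjoint)
    moreover have "card (?f ` {0..h} \<union> ?g ` {0..h}) \<le> nat p"
      using card_mono[OF _ sub] by simp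
    ultimately show False
      using h h0 by simp
  qed
  then obtain a b where ab: "a \<in> {0..h}" "b \<in> {0..h}" "?f a = ?g b"
    by blast
  then have "p dvd a^2 - (- 1 - b^2)"
    by (simp add: mod_eq_dvd_iff)
  then show thesis
    using ab that[of a b] by (simp add: algebra_simps)
qed

lemma prime_sum_of_four_squares:
  fixes p :: int
  assumes p: "prime p"
  shows "sum_of_four_squares p"
proof (cases "p = 2")
  case True
  have "(2::int) = 1^2 + 1^2 + 0^2 + 0^2"
    by simp
  then show ?thesis
    unfolding True sum_of_four_squares_def by blast
next
  case False
  then have "odd p"
    using p using prime_odd_int[of p] prime_ge_2_int[of p] by simp
  then obtain h where h: "p = 2 * h + 1"
    by (elim oddE)
  obtain a b where ab: "0 \<le> a" "a \<le> h" "0 \<le> b" "b \<le> h" "p dvd a^2 + b^2 + 1"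
    using odd_prime_dvd_two_squares_plus_one[OF p h] by blast
  then obtain k where k: "a^2 + b^2 + 1 = k * p"
    by (metis dvd_def mult.commute)
  have "0 < k * p"
    unfolding k[symmetric] by (simp add: add_nonneg_pos)
  then have k0: "k > 0"
    using prime_gt_0_int[OF p] by (simp add: zero_less_mult_iff)
  have "a^2 \<le> h^2" "b^2 \<le> h^2"
    using ab by (simp_all add: power_mono)
  then have "k * p \<le> 2 * h^2 + 1"
    using k by linarith
  also have "\<dots> < p * p"
  proof -
    have "p * p = 4 * h^2 + 4 * h + 1" "0 \<le> h^2" "0 < h"
      using prime_gt_1_int[OF p] unfolding h by (auto simp: power2_eq_square algebra_simps)
    then show ?thesis
      by linarith
  qed
  finally have kp: "k < p"
    using prime_gt_0_int[OF p] by simp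
  have "sum_of_four_squares (k * p)"
    unfolding sum_of_four_squares_def k[symmetric]
    by (intro exI[of _ a] exI[of _ b] exI[of _ 1] exI[of _ 0]) simp
  with k0 kp show ?thesis
  proof (induction "nat k" arbitrary: k rule: less_induct)
    case less
    show ?case
    proof (cases "k = 1")
      case True
      then show ?thesis
        using less by simp
    next
      case False
      then have "1 < k"
        using less.prems by simp
      then obtain r where "0 < r" "r < k" "sum_of_four_squares (r * p)"
        using four_squares_descent[OF p] less.prems by blast
      then show ?thesis
        using less.hyps[of r] less.prems by simp
    qed
  qed
qed

theorem four_squares:
  "\<exists>a b c d :: int. int n = a^2 + b^2 + c^2 + d^2"
proof -
  have "sum_of_four_squares (int n)"
  proof (induction n rule: prime_divisors_induct)
    case zero
    show ?case
      unfolding sum_of_four_squares_def by (intro exI[of _ 0]) simp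
  next
    case (unit n)
    then show ?case
      unfolding sum_of_four_squares_def by (intro exI[of _ 1] exI[of _ 0]) simp
  next
    case (factor p n)
    then show ?case
      using sum_of_four_squares_mult[OF prime_sum_of_four_squares[of "int p"]] by simp
  qed
  then show ?thesis
    unfolding sum_of_four_squares_def .
qed

section \<open>Integral and real quadratic forms\<close>

text \<open>
  An \<open>n\<close>-ary form is a function of two indices of which only the values below \<open>n\<close> matter; vectors are
  functions in the same way. This lets the number of variables change within a statement.
\<close>

definition bilin :: "nat \<Rightarrow> (nat \<Rightarrow> nat \<Rightarrow> 'a::comm_ring_1) \<Rightarrow> (nat \<Rightarrow> 'a) \<Rightarrow> (nat \<Rightarrow> 'a) \<Rightarrow> 'a" where
  "bilin n a x y = (\<Sum>i<n. \<Sum>j<n. a i j * x i * y j)"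

abbreviation quad :: "nat \<Rightarrow> (nat \<Rightarrow> nat \<Rightarrow> 'a::comm_ring_1) \<Rightarrow> (nat \<Rightarrow> 'a) \<Rightarrow> 'a" where
  "quad n a x \<equiv> bilin n a x x"

text \<open>
  The column \<open>i\<close> of \<open>u\<close> is the image of the \<open>i\<close>-th basis vector: this is \<open>u\<^sup>T a u\<close>.
\<close>

definition pullback :: "nat \<Rightarrow> (nat \<Rightarrow> nat \<Rightarrow> 'a::comm_ring_1) \<Rightarrow> (nat \<Rightarrow> nat \<Rightarrow> 'a) \<Rightarrow> nat \<Rightarrow> nat \<Rightarrow> 'a" where
  "pullback n u a i j = bilin n a (\<lambda>r. u r i) (\<lambda>r. u r j)"

definition mat_prod :: "nat \<Rightarrow> (nat \<Rightarrow> nat \<Rightarrow> 'a::comm_ring_1) \<Rightarrow> (nat \<Rightarrow> nat \<Rightarrow> 'a) \<Rightarrow> nat \<Rightarrow> nat \<Rightarrow> 'a" where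
  "mat_prod n u v i j = (\<Sum>r<n. u i r * v r j)"

definition symmetric_form :: "nat \<Rightarrow> (nat \<Rightarrow> nat \<Rightarrow> 'a) \<Rightarrow> bool" where
  "symmetric_form n a \<longleftrightarrow> (\<forall>i<n. \<forall>j<n. a i j = a j i)"

lemma bilin_cong:
  assumes "\<And>i j. i < n \<Longrightarrow> j < n \<Longrightarrow> a i j = b i j"
    and "\<And>i. i < n \<Longrightarrow> x i = x' i" "\<And>i. i < n \<Longrightarrow> y i = y' i"
  shows "bilin n a x y = bilin n b x' y'"
  unfolding bilin_def using assms by (intro sum.cong refl) auto

lemma bilin_add: "bilin n (\<lambda>i j. a i j + b i j) x y = bilin n a x y + bilin n b x y"
  unfolding bilin_def by (simp add: sum.distrib algebra_simps)

lemma bilin_diff: "bilin n (\<lambda>i j. a i j - b i j) x y = bilin n a x y - bilin n b x y"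
  unfolding bilin_def by (simp add: sum_subtractf algebra_simps)

lemma bilin_scale: "bilin n (\<lambda>i j. c * a i j) x y = c * bilin n a x y"
  unfolding bilin_def by (simp add: sum_distrib_left mult.assoc)

lemma bilin_sum: "bilin n (\<lambda>i j. \<Sum>t\<in>T. a t i j) x y = (\<Sum>t\<in>T. bilin n (a t) x y)"
  unfolding bilin_def
  by (simp add: sum_distrib_right sum.swap[of _ T])

lemma bilin_rank_one: "bilin n (\<lambda>i j. b i * c j) x y = (\<Sum>i<n. b i * x i) * (\<Sum>j<n. c j * y j)"
  unfolding bilin_def by (simp add: sum_product mult_ac)

lemma bilin_commute: "symmetric_form n a \<Longrightarrow> bilin n a x y = bilin n a y x"
  unfolding bilin_def symmetric_form_def
  by (subst sum.swap) (auto intro!: sum.cong)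

lemma bilin_add_left: "bilin n a (\<lambda>r. x r + y r) z = bilin n a x z + bilin n a y z"
  unfolding bilin_def by (simp add: sum.distrib algebra_simps)

lemma bilin_add_right: "bilin n a z (\<lambda>r. x r + y r) = bilin n a z x + bilin n a z y"
  unfolding bilin_def by (simp add: sum.distrib algebra_simps)

lemma bilin_scale_left: "bilin n a (\<lambda>r. c * x r) y = c * bilin n a x y"
  unfolding bilin_def by (simp add: sum_distrib_left mult_ac)

lemma bilin_scale_right: "bilin n a x (\<lambda>r. c * y r) = c * bilin n a x y"
  unfolding bilin_def by (simp add: sum_distrib_left mult_ac)

lemma bilin_sum_left: "bilin n a (\<lambda>r. \<Sum>j\<in>S. c j * u r j) y = (\<Sum>j\<in>S. c j * bilin n a (\<lambda>r. u r j) y)"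
proof -
  have "bilin n a (\<lambda>r. \<Sum>j\<in>S. c j * u r j) y = (\<Sum>i<n. \<Sum>k<n. \<Sum>j\<in>S. c j * (a i k * u i j * y k))"
    unfolding bilin_def by (simp add: sum_distrib_left sum_distrib_right mult_ac)
  also have "\<dots> = (\<Sum>i<n. \<Sum>j\<in>S. \<Sum>k<n. c j * (a i k * u i j * y k))"
    by (subst sum.swap) simp
  also have "\<dots> = (\<Sum>j\<in>S. \<Sum>i<n. \<Sum>k<n. c j * (a i k * u i j * y k))"
    by (rule sum.swap)
  finally show ?thesis
    unfolding bilin_def by (simp add: sum_distrib_left)
qed

lemma bilin_sum_right: "bilin n a y (\<lambda>r. \<Sum>j\<in>S. c j * u r j) = (\<Sum>j\<in>S. c j * bilin n a y (\<lambda>r. u r j))"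
proof -
  have flip: "bilin n a v w = bilin n (\<lambda>i j. a j i) w v" for v w
    unfolding bilin_def by (subst sum.swap) (simp add: mult_ac)
  show ?thesis
    unfolding flip[of y] bilin_sum_left ..
qed

lemma bilin_pullback: "bilin m (pullback n u a) x y = bilin n a (\<lambda>r. \<Sum>j<m. x j * u r j) (\<lambda>r. \<Sum>j<m. y j * u r j)"
proof -
  have "bilin n a (\<lambda>r. \<Sum>j<m. x j * u r j) (\<lambda>r. \<Sum>j<m. y j * u r j)
      = (\<Sum>i<m. \<Sum>j<m. x i * (y j * bilin n a (\<lambda>r. u r i) (\<lambda>r. u r j)))"
    by (simp only: bilin_sum_left bilin_sum_right sum_distrib_left)
  then show ?thesis
    unfolding bilin_def[of m] pullback_def by (simp add: mult_ac)
qed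

lemma pullback_pullback: "pullback m v (pullback n u a) i j = pullback n (mat_prod m u v) a i j"
proof -
  have e: "(\<lambda>r. \<Sum>k<m. v k j * u r k) = (\<lambda>r. mat_prod m u v r j)" for j
    by (simp add: mat_prod_def mult.commute)
  show ?thesis
    unfolding pullback_def[of m] bilin_pullback pullback_def[of n "mat_prod m u v"] e ..
qed

lemma bilin_unit:
  assumes "i < n" "j < n"
  shows "bilin n a (\<lambda>r. if r = i then 1 else 0) (\<lambda>r. if r = j then 1 else 0) = a i j"
proof -
  have "bilin n a (\<lambda>r. if r = i then 1 else 0) (\<lambda>r. if r = j then 1 else 0)
      = (\<Sum>k<n. \<Sum>l<n. if k = i then if l = j then a k l else 0 else 0)"
    unfolding bilin_def by (intro sum.cong refl) auto
  also have "\<dots> = (\<Sum>k<n. if k = i then a k j else 0)"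
    using assms by (intro sum.cong refl) (auto simp: sum.delta)
  also have "\<dots> = a i j"
    using assms by (simp add: sum.delta)
  finally show ?thesis .
qed

lemma pullback_cong:
  assumes "\<And>i j. i < n \<Longrightarrow> j < n \<Longrightarrow> a i j = b i j"
    and "\<And>r. r < n \<Longrightarrow> u r i = v r i" "\<And>r. r < n \<Longrightarrow> u r j = v r j"
  shows "pullback n u a i j = pullback n v b i j"
  unfolding pullback_def using assms by (intro bilin_cong) auto

lemma pullback_id:
  assumes "\<And>r k. r < n \<Longrightarrow> k < n \<Longrightarrow> u r k = (if r = k then 1 else 0)" "i < n" "j < n"
  shows "pullback n u a i j = a i j"
proof -
  have "pullback n u a i j = bilin n a (\<lambda>r. if r = i then 1 else 0) (\<lambda>r. if r = j then 1 else 0)"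
    unfolding pullback_def using assms by (intro bilin_cong) auto
  then show ?thesis
    using assms bilin_unit by metis
qed

lemma bilin_Suc:
  "bilin (Suc n) a x y = a 0 0 * x 0 * y 0 + x 0 * (\<Sum>j<n. a 0 (Suc j) * y (Suc j))
     + y 0 * (\<Sum>i<n. a (Suc i) 0 * x (Suc i))
     + bilin n (\<lambda>i j. a (Suc i) (Suc j)) (\<lambda>i. x (Suc i)) (\<lambda>i. y (Suc i))"
  unfolding bilin_def sum.lessThan_Suc_shift
  by (simp add: sum.distrib sum_distrib_left sum_distrib_right mult_ac add_ac)

text \<open>
  The Gram matrix of the projection orthogonal to the first basis vector.
\<close>

definition schur :: "(nat \<Rightarrow> nat \<Rightarrow> real) \<Rightarrow> nat \<Rightarrow> nat \<Rightarrow> real" where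
  "schur a i j = a (Suc i) (Suc j) - a 0 (Suc i) * a 0 (Suc j) / a 0 0"

lemma sym_schur: "symmetric_form (Suc n) a \<Longrightarrow> symmetric_form n (schur a)"
  unfolding symmetric_form_def schur_def by (simp add: mult.commute)

lemma quad_complete_square:
  assumes "symmetric_form (Suc n) a" "a 0 0 \<noteq> 0"
  shows "quad (Suc n) a x = a 0 0 * (x 0 + (\<Sum>j<n. a 0 (Suc j) / a 0 0 * x (Suc j)))^2
      + quad n (schur a) (\<lambda>i. x (Suc i))"
proof -
  let ?s = "\<Sum>j<n. a 0 (Suc j) * x (Suc j)"
  have e1: "(\<Sum>i<n. a (Suc i) 0 * x (Suc i)) = ?s"
    using assms(1) unfolding symmetric_form_def by (intro sum.cong refl) auto
  have e2: "(\<Sum>j<n. a 0 (Suc j) / a 0 0 * x (Suc j)) = ?s / a 0 0"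
    by (simp add: sum_divide_distrib)
  have "quad n (schur a) (\<lambda>i. x (Suc i)) = quad n (\<lambda>i j. a (Suc i) (Suc j)) (\<lambda>i. x (Suc i))
      - quad n (\<lambda>i j. (1 / a 0 0) * (a 0 (Suc i) * a 0 (Suc j))) (\<lambda>i. x (Suc i))"
    unfolding schur_def bilin_diff[symmetric] by simp
  then have e3: "quad n (schur a) (\<lambda>i. x (Suc i))
      = quad n (\<lambda>i j. a (Suc i) (Suc j)) (\<lambda>i. x (Suc i)) - ?s * ?s / a 0 0"
    unfolding bilin_scale bilin_rank_one by simp
  show ?thesis
    unfolding bilin_Suc e1 e2 e3 using assms(2)
    by (simp add: field_simps power2_eq_square)
qed

text \<open>
  By the inequality \<open>2 * \<bar>x * y\<bar> \<le> x\<^sup>2 + y\<^sup>2\<close>.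
\<close>

lemma abs_quad_le:
  fixes f :: "nat \<Rightarrow> nat \<Rightarrow> real"
  assumes "\<And>i j. i < n \<Longrightarrow> j < n \<Longrightarrow> \<bar>f i j\<bar> \<le> B"
  shows "\<bar>quad n f x\<bar> \<le> B * real n * (\<Sum>i<n. (x i)^2)"
proof -
  have t: "\<bar>f i j * x i * x j\<bar> \<le> B * (((x i)^2 + (x j)^2) / 2)" if "i < n" "j < n" for i j
  proof -
    have "0 \<le> (\<bar>x i\<bar> - \<bar>x j\<bar>)^2"
      by simp
    then have "\<bar>x i * x j\<bar> \<le> ((x i)^2 + (x j)^2) / 2"
      by (simp add: power2_diff abs_mult)
    then have "\<bar>f i j\<bar> * \<bar>x i * x j\<bar> \<le> B * (((x i)^2 + (x j)^2) / 2)"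
      using assms[OF that] by (intro mult_mono) auto
    then show ?thesis
      by (simp add: abs_mult mult.assoc)
  qed
  have "\<bar>quad n f x\<bar> \<le> (\<Sum>i<n. \<bar>\<Sum>j<n. f i j * x i * x j\<bar>)"
    unfolding bilin_def by (rule sum_abs)
  also have "\<dots> \<le> (\<Sum>i<n. \<Sum>j<n. \<bar>f i j * x i * x j\<bar>)"
    by (intro sum_mono sum_abs)
  also have "\<dots> \<le> (\<Sum>i<n. \<Sum>j<n. B * (((x i)^2 + (x j)^2) / 2))"
    using t by (intro sum_mono) auto
  also have "\<dots> = B * real n * (\<Sum>i<n. (x i)^2)"
    by (simp add: sum_distrib_left[symmetric] sum_divide_distrib[symmetric] sum.distrib algebra_simps)
  finally show ?thesis .
qed

text \<open>
  The square is the value of the rank one form with entries \<open>c i * c j\<close>.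
\<close>

lemma square_sum_le:
  fixes c x :: "nat \<Rightarrow> real"
  assumes "\<And>j. j < n \<Longrightarrow> \<bar>c j\<bar> \<le> B"
  shows "(\<Sum>j<n. c j * x j)^2 \<le> B^2 * real n * (\<Sum>i<n. (x i)^2)"
proof -
  have "\<bar>c i * c j\<bar> \<le> B^2" if "i < n" "j < n" for i j
    unfolding abs_mult power2_eq_square using assms[OF that(1)] assms[OF that(2)]
    by (intro mult_mono) auto
  then have "\<bar>quad n (\<lambda>i j. c i * c j) x\<bar> \<le> B^2 * real n * (\<Sum>i<n. (x i)^2)"
    by (rule abs_quad_le)
  then show ?thesis
    unfolding bilin_rank_one by (simp add: power2_eq_square)
qed

section \<open>Reduction\<close>

text \<open>
  The first row is size-reduced and the squared Gram-Schmidt lengths decrease by at most the factor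
  \<open>1/2\<close> at each step, as for bases reduced in the sense of Lenstra, Lenstra and Lovasz.
\<close>

fun reduced :: "nat \<Rightarrow> (nat \<Rightarrow> nat \<Rightarrow> real) \<Rightarrow> bool" where
  "reduced 0 a \<longleftrightarrow> True"
| "reduced (Suc n) a \<longleftrightarrow> a 0 0 > 0 \<and> (\<forall>j<n. \<bar>a 0 (Suc j)\<bar> \<le> a 0 0 / 2)
     \<and> (n > 0 \<longrightarrow> a 0 0 / 2 \<le> schur a 0 0) \<and> reduced n (schur a)"

lemma reduced_cong:
  assumes "\<And>i j. i < n \<Longrightarrow> j < n \<Longrightarrow> a i j = b i j"
  shows "reduced n a \<longleftrightarrow> reduced n b"
  using assms
proof (induction n arbitrary: a b)
  case (Suc n)
  have "schur a i j = schur b i j" if "i < n" "j < n" for i j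
    unfolding schur_def using that Suc.prems by simp
  moreover from this have "reduced n (schur a) \<longleftrightarrow> reduced n (schur b)"
    by (rule Suc.IH)
  ultimately show ?case
    using Suc.prems by (cases "n = 0") auto
qed simp

lemma reduced_scale:
  assumes "c > 0"
  shows "reduced n (\<lambda>i j. c * a i j) \<longleftrightarrow> reduced n a"
proof (induction n arbitrary: a)
  case (Suc n)
  have "schur (\<lambda>i j. c * a i j) = (\<lambda>i j. c * schur a i j)"
    unfolding schur_def using assms by (intro ext) (simp add: field_simps)
  then show ?case
    using Suc.IH[of "schur a"] assms by (simp add: zero_less_mult_iff abs_mult)
qed simp

text \<open>
  Completing the square reduces this to the Schur complement, whose first entry is at least \<open>a 0 0 / 2\<close>.
  The linear form \<open>l\<close> added to \<open>x 0\<close> has coefficients at most \<open>1/2\<close>, so \<open>(x 0)\<^sup>2\<close> is controlled by \<open>(x 0 + l)\<^sup>2\<close>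
  and the remaining coordinates.
\<close>

lemma reduced_lower_bound:
  "\<exists>\<kappa>>0. \<forall>a. symmetric_form n a \<and> reduced n a \<longrightarrow> (\<forall>x. \<kappa> * a 0 0 * (\<Sum>i<n. (x i)^2) \<le> quad n a x)"
proof (induction n)
  case 0
  show ?case
    by (intro exI[of _ 1]) (simp add: bilin_def)
next
  case (Suc n)
  then obtain k where k: "k > 0"
    "\<And>a x. symmetric_form n a \<Longrightarrow> reduced n a \<Longrightarrow> k * a 0 0 * (\<Sum>i<n. (x i)^2) \<le> quad n a x"
    by blast
  define \<kappa> where "\<kappa> = min (1/2) (k / (real n + 2))"
  have \<kappa>: "\<kappa> > 0" "2 * \<kappa> \<le> 1" "\<kappa> * (real n / 2 + 1) \<le> k / 2"
  proof -
    show "\<kappa> > 0" "2 * \<kappa> \<le> 1"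
      using k(1) unfolding \<kappa>_def by auto
    have "\<kappa> * (real n / 2 + 1) \<le> k / (real n + 2) * (real n / 2 + 1)"
      unfolding \<kappa>_def by (intro mult_right_mono) auto
    also have "\<dots> = k / 2"
      by (simp add: field_simps)
    finally show "\<kappa> * (real n / 2 + 1) \<le> k / 2" .
  qed
  show ?case
  proof (intro exI[of _ \<kappa>] conjI allI impI \<kappa>(1))
    fix a :: "nat \<Rightarrow> nat \<Rightarrow> real" and x :: "nat \<Rightarrow> real"
    assume asm: "symmetric_form (Suc n) a \<and> reduced (Suc n) a"
    then have a0: "a 0 0 > 0"
      by simp
    define l where "l = (\<Sum>j<n. a 0 (Suc j) / a 0 0 * x (Suc j))"
    define Y where "Y = (\<Sum>i<n. (x (Suc i))^2)"
    have "Y \<ge> 0"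
      unfolding Y_def by (simp add: sum_nonneg)
    have "\<bar>a 0 (Suc j) / a 0 0\<bar> \<le> 1/2" if "j < n" for j
      using asm that a0 by (simp add: field_simps)
    then have l: "l^2 \<le> real n / 4 * Y"
      unfolding l_def Y_def using square_sum_le[of n "\<lambda>j. a 0 (Suc j) / a 0 0" "1/2" "\<lambda>j. x (Suc j)"]
      by (simp add: power_divide)
    have "k * (a 0 0 / 2) * Y \<le> quad n (schur a) (\<lambda>i. x (Suc i))"
    proof (cases "n = 0")
      case True
      then show ?thesis
        by (simp add: Y_def bilin_def)
    next
      case False
      then have "k * (a 0 0 / 2) * Y \<le> k * schur a 0 0 * Y"
        using asm k(1) \<open>Y \<ge> 0\<close> by (intro mult_right_mono mult_left_mono) auto
      also have "\<dots> \<le> quad n (schur a) (\<lambda>i. x (Suc i))"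
        using k(2)[of "schur a" "\<lambda>i. x (Suc i)"] asm sym_schur unfolding Y_def by auto
      finally show ?thesis .
    qed
    moreover have "quad (Suc n) a x = a 0 0 * (x 0 + l)^2 + quad n (schur a) (\<lambda>i. x (Suc i))"
      unfolding l_def using quad_complete_square asm a0 by simp
    ultimately have q: "a 0 0 * ((x 0 + l)^2 + k / 2 * Y) \<le> quad (Suc n) a x"
      by (simp add: algebra_simps)
    have "0 \<le> (x 0 + 2 * l)^2"
      by simp
    then have "(x 0)^2 \<le> 2 * (x 0 + l)^2 + 2 * l^2"
      by (simp add: power2_eq_square algebra_simps)
    then have "(x 0)^2 + Y \<le> 2 * (x 0 + l)^2 + (real n / 2 + 1) * Y"
      using l by (simp add: algebra_simps)
    then have "\<kappa> * ((x 0)^2 + Y) \<le> \<kappa> * (2 * (x 0 + l)^2 + (real n / 2 + 1) * Y)"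
      using \<kappa>(1) by simp
    also have "\<dots> = (2 * \<kappa>) * (x 0 + l)^2 + (\<kappa> * (real n / 2 + 1)) * Y"
      by (simp add: algebra_simps)
    also have "\<dots> \<le> 1 * (x 0 + l)^2 + k / 2 * Y"
      using \<kappa> \<open>Y \<ge> 0\<close> by (intro add_mono mult_right_mono) auto
    finally have "a 0 0 * (\<kappa> * ((x 0)^2 + Y)) \<le> a 0 0 * ((x 0 + l)^2 + k / 2 * Y)"
      using a0 by simp
    then show "\<kappa> * a 0 0 * (\<Sum>i<Suc n. (x i)^2) \<le> quad (Suc n) a x"
      using q unfolding sum.lessThan_Suc_shift Y_def by (simp add: mult_ac)
  qed
qed

definition pos_semidef :: "nat \<Rightarrow> (nat \<Rightarrow> nat \<Rightarrow> int) \<Rightarrow> bool" where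
  "pos_semidef n a \<longleftrightarrow> symmetric_form n a \<and> (\<forall>x. 0 \<le> quad n a x)"

definition represents_form :: "nat \<Rightarrow> (nat \<Rightarrow> nat \<Rightarrow> int) \<Rightarrow> nat \<Rightarrow> (nat \<Rightarrow> nat \<Rightarrow> int) \<Rightarrow> bool" where
  "represents_form n a m b \<longleftrightarrow> (\<exists>u. \<forall>i<m. \<forall>j<m. b i j = pullback n u a i j)"

definition inverse_mats :: "nat \<Rightarrow> (nat \<Rightarrow> nat \<Rightarrow> int) \<Rightarrow> (nat \<Rightarrow> nat \<Rightarrow> int) \<Rightarrow> bool" where
  "inverse_mats n u v \<longleftrightarrow> (\<forall>i<n. \<forall>j<n. mat_prod n u v i j = (if i = j then 1 else 0))"

text \<open>
  A change of basis: for square integer matrices, \<open>u v = 1\<close> makes \<open>u\<close> invertible.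
\<close>

definition equivalent :: "nat \<Rightarrow> (nat \<Rightarrow> nat \<Rightarrow> int) \<Rightarrow> (nat \<Rightarrow> nat \<Rightarrow> int) \<Rightarrow> bool" where
  "equivalent n a b \<longleftrightarrow> (\<exists>u v. inverse_mats n u v \<and> (\<forall>i<n. \<forall>j<n. b i j = pullback n u a i j))"

lemma mat_prod_assoc: "mat_prod n (mat_prod n u v) w i j = mat_prod n u (mat_prod n v w) i j"
proof -
  have "mat_prod n (mat_prod n u v) w i j = (\<Sum>r<n. \<Sum>k<n. u i k * v k r * w r j)"
    unfolding mat_prod_def by (simp add: sum_distrib_right)
  also have "\<dots> = (\<Sum>k<n. \<Sum>r<n. u i k * v k r * w r j)"
    by (rule sum.swap)
  finally show ?thesis
    unfolding mat_prod_def by (simp add: sum_distrib_left mult.assoc)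
qed

lemma mat_prod_id_right:
  assumes "\<And>r. r < n \<Longrightarrow> v r j = (if r = j then 1 else 0)" "j < n"
  shows "mat_prod n u v i j = u i j"
proof -
  have "mat_prod n u v i j = (\<Sum>r<n. if r = j then u i r else 0)"
    unfolding mat_prod_def using assms by (intro sum.cong refl) auto
  then show ?thesis
    using assms by (simp add: sum.delta)
qed

lemma inverse_mats_mult:
  assumes "inverse_mats n u v" "inverse_mats n u' v'"
  shows "inverse_mats n (mat_prod n u u') (mat_prod n v' v)"
  unfolding inverse_mats_def
proof (intro allI impI)
  fix i j assume ij: "i < n" "j < n"
  have "mat_prod n u' (mat_prod n v' v) r j = v r j" if "r < n" for r
  proof -
    have "mat_prod n u' (mat_prod n v' v) r j = mat_prod n (mat_prod n u' v') v r j"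
      by (simp add: mat_prod_assoc)
    also have "\<dots> = (\<Sum>k<n. if k = r then v k j else 0)"
      using assms(2) that unfolding mat_prod_def[of n "mat_prod n u' v'"] inverse_mats_def
      by (intro sum.cong refl) auto
    finally show ?thesis
      using that by (simp add: sum.delta)
  qed
  then have "mat_prod n (mat_prod n u u') (mat_prod n v' v) i j = mat_prod n u v i j"
    unfolding mat_prod_assoc unfolding mat_prod_def[of n u] by (intro sum.cong refl) auto
  then show "mat_prod n (mat_prod n u u') (mat_prod n v' v) i j = (if i = j then 1 else 0)"
    using assms(1) ij unfolding inverse_mats_def by simp
qed

lemma equivalent_refl: "equivalent n a a"
proof -
  let ?e = "\<lambda>i j :: nat. if i = j then 1 else 0 :: int"
  have "inverse_mats n ?e ?e"
    unfolding inverse_mats_def using mat_prod_id_right[of n ?e _ ?e] by simp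
  then show ?thesis
    unfolding equivalent_def using pullback_id[of n ?e _ _ a] by (intro exI[of _ ?e]) auto
qed

lemma equivalent_trans:
  assumes "equivalent n a b" "equivalent n b c"
  shows "equivalent n a c"
proof -
  obtain u v where uv: "inverse_mats n u v" "\<And>i j. i < n \<Longrightarrow> j < n \<Longrightarrow> b i j = pullback n u a i j"
    using assms(1) unfolding equivalent_def by blast
  obtain u' v' where uv': "inverse_mats n u' v'" "\<And>i j. i < n \<Longrightarrow> j < n \<Longrightarrow> c i j = pullback n u' b i j"
    using assms(2) unfolding equivalent_def by blast
  have "c i j = pullback n (mat_prod n u u') a i j" if "i < n" "j < n" for i j
    unfolding pullback_pullback[symmetric] uv'(2)[OF that] by (rule pullback_cong) (use uv(2) in auto)
  then show ?thesis
    unfolding equivalent_def using inverse_mats_mult[OF uv(1) uv'(1)] by blast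
qed

lemma equivalent_imp_represents_form: "equivalent n a b \<Longrightarrow> represents_form n a n b"
  unfolding equivalent_def represents_form_def by blast

lemma equivalent_imp_represents_form_back:
  assumes "equivalent n a b"
  shows "represents_form n b n a"
proof -
  obtain u v where uv: "inverse_mats n u v" "\<And>i j. i < n \<Longrightarrow> j < n \<Longrightarrow> b i j = pullback n u a i j"
    using assms unfolding equivalent_def by blast
  have "a i j = pullback n v b i j" if "i < n" "j < n" for i j
  proof -
    have "pullback n v b i j = pullback n v (pullback n u a) i j"
      by (rule pullback_cong) (use uv(2) in auto)
    also have "\<dots> = a i j"
      unfolding pullback_pullback using uv(1) that unfolding inverse_mats_def by (intro pullback_id) auto
    finally show ?thesis ..
  qed
  then show ?thesis
    unfolding represents_form_def by blast
qed

lemma represents_form_trans: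
  assumes "represents_form n a m b" "represents_form m b k c"
  shows "represents_form n a k c"
proof -
  obtain u where u: "\<And>i j. i < m \<Longrightarrow> j < m \<Longrightarrow> b i j = pullback n u a i j"
    using assms(1) unfolding represents_form_def by blast
  obtain v where v: "\<And>i j. i < k \<Longrightarrow> j < k \<Longrightarrow> c i j = pullback m v b i j"
    using assms(2) unfolding represents_form_def by blast
  have "c i j = pullback n (mat_prod m u v) a i j" if "i < k" "j < k" for i j
    unfolding v[OF that] pullback_pullback[symmetric] by (rule pullback_cong) (use u in auto)
  then show ?thesis
    unfolding represents_form_def by blast
qed

lemma represents_form_value:
  assumes "represents_form n a m b"
  obtains z where "quad m b x = quad n a z"
proof -
  obtain u where u: "\<And>i j. i < m \<Longrightarrow> j < m \<Longrightarrow> b i j = pullback n u a i j"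
    using assms unfolding represents_form_def by blast
  have "quad m b x = quad m (pullback n u a) x"
    by (rule bilin_cong) (use u in auto)
  then show thesis
    unfolding bilin_pullback using that by blast
qed

lemma pos_semidef_represents_form:
  assumes "pos_semidef n a" "represents_form n a m b"
  shows "pos_semidef m b"
proof -
  have "symmetric_form m b"
    using assms bilin_commute[of n a] unfolding pos_semidef_def represents_form_def pullback_def symmetric_form_def[of m] by metis
  moreover have "0 \<le> quad m b x" for x
    using assms(1) represents_form_value[OF assms(2), of x] unfolding pos_semidef_def by metis
  ultimately show ?thesis
    unfolding pos_semidef_def by blast
qed

text \<open>
  Multiplying the Schur complement by \<open>a 0 0\<close> keeps it integral, so that the induction for the
  reduction theorem stays within integral forms.
\<close>

definition scaled_schur :: "(nat \<Rightarrow> nat \<Rightarrow> int) \<Rightarrow> nat \<Rightarrow> nat \<Rightarrow> int" where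
  "scaled_schur a i j = a 0 0 * a (Suc i) (Suc j) - a 0 (Suc i) * a 0 (Suc j)"

text \<open>
  Let \<open>s\<close> be the product of the first row with \<open>y\<close>. At the vector with first coordinate \<open>- s\<close> and remaining
  coordinates \<open>a 0 0 * y\<close>, which is orthogonal to the first basis vector, the value of \<open>a\<close> is \<open>a 0 0\<close> times
  the value of the scaled Schur complement at \<open>y\<close>. If \<open>a 0 0 = 0\<close>, semidefiniteness forces \<open>s = 0\<close>.
\<close>

lemma pos_semidef_scaled_schur:
  assumes "pos_semidef (Suc n) a"
  shows "pos_semidef n (scaled_schur a)"
proof -
  have sym: "symmetric_form (Suc n) a"
    using assms unfolding pos_semidef_def by blast
  have "0 \<le> quad n (scaled_schur a) y" for y
  proof -
    define s where "s = (\<Sum>j<n. a 0 (Suc j) * y j)"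
    define T where "T = quad n (\<lambda>i j. a (Suc i) (Suc j)) y"
    have S: "quad n (scaled_schur a) y = a 0 0 * T - s * s"
      unfolding scaled_schur_def bilin_diff bilin_scale bilin_rank_one s_def T_def ..
    have q: "0 \<le> a 0 0 * t * t + 2 * t * (c * s) + c * (c * T)" for t c
    proof -
      define x where "x = case_nat t (\<lambda>i. c * y i)"
      have "(\<Sum>i<n. a (Suc i) 0 * x (Suc i)) = c * s"
        unfolding s_def sum_distrib_left x_def using sym unfolding symmetric_form_def
        by (intro sum.cong refl) auto
      moreover have "(\<Sum>j<n. a 0 (Suc j) * x (Suc j)) = c * s"
        unfolding s_def sum_distrib_left x_def by (intro sum.cong refl) auto
      moreover have "quad n (\<lambda>i j. a (Suc i) (Suc j)) (\<lambda>i. x (Suc i)) = c * (c * T)"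
        unfolding T_def x_def by (simp add: bilin_scale_left bilin_scale_right)
      moreover have "0 \<le> quad (Suc n) a x"
        using assms unfolding pos_semidef_def by blast
      moreover have "x 0 = t"
        unfolding x_def by simp
      ultimately show ?thesis
        unfolding bilin_Suc by (simp add: algebra_simps)
    qed
    have a0: "a 0 0 \<ge> 0"
      using q[of 1 0] by simp
    show ?thesis
    proof (cases "a 0 0 = 0")
      case True
      have "s = 0"
      proof (rule ccontr)
        assume "s \<noteq> 0"
        then have "s * s \<ge> 1"
          by (metis int_one_le_iff_zero_less mult_eq_0_iff zero_le_square order_le_less)
        moreover have "0 \<le> T"
          using q[of 0 1] by simp
        then have "(T + 1) * 1 \<le> (T + 1) * (s * s)"
          using \<open>s * s \<ge> 1\<close> by (intro mult_left_mono) auto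
        ultimately show False
          using q[of "- (T + 1) * s" 1] True \<open>0 \<le> T\<close> by (simp add: algebra_simps)
      qed
      then show ?thesis
        unfolding S using True by simp
    next
      case False
      have "0 \<le> a 0 0 * (a 0 0 * T - s * s)"
        using q[of "- s" "a 0 0"] by (simp add: algebra_simps)
      then show ?thesis
        unfolding S using a0 False by (simp add: zero_le_mult_iff)
    qed
  qed
  moreover have "symmetric_form n (scaled_schur a)"
    using sym unfolding symmetric_form_def scaled_schur_def by (simp add: mult.commute)
  ultimately show ?thesis
    unfolding pos_semidef_def by blast
qed

lemma schur_of_int:
  "a 0 0 \<noteq> 0 \<Longrightarrow> schur (\<lambda>i j. real_of_int (a i j))
     = (\<lambda>i j. 1 / real_of_int (a 0 0) * real_of_int (scaled_schur a i j))"
  unfolding schur_def scaled_schur_def by (intro ext) (simp add: field_simps)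

text \<open>
  A change of basis of the projected lattice lifts to one of the lattice that keeps the first basis
  vector. The lift of each other basis vector is free up to an integer multiple \<open>c j\<close> of the first
  basis vector, which is what size reduction uses.
\<close>

lemma equivalent_change_of_basis:
  fixes c :: "nat \<Rightarrow> int"
  assumes sym: "symmetric_form (Suc n) a" and e: "equivalent n (scaled_schur a) s"
  obtains b g where "\<And>c. equivalent (Suc n) a (b c)" "\<And>c. b c 0 0 = a 0 0"
    "\<And>c j. j < n \<Longrightarrow> b c 0 (Suc j) = g j + a 0 0 * c j"
    "\<And>c i j. i < n \<Longrightarrow> j < n \<Longrightarrow> scaled_schur (b c) i j = s i j"
proof -
  obtain u v where uv: "inverse_mats n u v" "\<And>i j. i < n \<Longrightarrow> j < n \<Longrightarrow> s i j = pullback n u (scaled_schur a) i j"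
    using e unfolding equivalent_def by blast
  define w where "w c = case_nat (case_nat 1 c) (\<lambda>i. case_nat 0 (u i))" for c :: "nat \<Rightarrow> int"
  \<comment> \<open>This is the inverse of \<open>w c\<close>: its first row compensates the multiples \<open>c\<close> of the first vector.\<close>
  define w' where "w' c = case_nat (case_nat 1 (\<lambda>j. - (\<Sum>k<n. c k * v k j))) (\<lambda>i. case_nat 0 (v i))"
    for c :: "nat \<Rightarrow> int"
  define b where "b c = pullback (Suc n) (w c) a" for c
  define g where "g j = (\<Sum>r<n. a 0 (Suc r) * u r j)" for j
  have g': "(\<Sum>r<n. a (Suc r) 0 * u r j) = g j" for j
    unfolding g_def using sym unfolding symmetric_form_def by (intro sum.cong refl) auto
  have inv: "inverse_mats (Suc n) (w c) (w' c)" for c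
    unfolding inverse_mats_def
  proof (intro allI impI)
    fix i j assume "i < Suc n" "j < Suc n"
    then show "mat_prod (Suc n) (w c) (w' c) i j = (if i = j then 1 else 0)"
      using uv(1) unfolding inverse_mats_def mat_prod_def sum.lessThan_Suc_shift w_def w'_def
      by (cases i; cases j) (auto simp: mult.commute)
  qed
  have b00: "b c 0 0 = a 0 0" for c
    unfolding b_def pullback_def bilin_Suc w_def by (simp add: bilin_def)
  have b0: "b c 0 (Suc j) = g j + a 0 0 * c j" for c j
    unfolding b_def pullback_def bilin_Suc w_def g_def by (simp add: bilin_def)
  have bS: "b c (Suc i) (Suc j) = a 0 0 * c i * c j + c i * g j + c j * g i
      + pullback n u (\<lambda>i j. a (Suc i) (Suc j)) i j" for c i j
    unfolding b_def pullback_def bilin_Suc w_def by (simp add: g' g_def[symmetric])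
  have "scaled_schur (b c) i j = s i j" if ij: "i < n" "j < n" for c i j
  proof -
    have "scaled_schur (b c) i j = a 0 0 * pullback n u (\<lambda>i j. a (Suc i) (Suc j)) i j - g i * g j"
      unfolding scaled_schur_def b00 b0 bS by (simp add: algebra_simps)
    also have "\<dots> = pullback n u (scaled_schur a) i j"
      unfolding pullback_def scaled_schur_def bilin_diff bilin_scale bilin_rank_one g_def ..
    finally show ?thesis
      using uv(2)[OF ij] by simp
  qed
  moreover have "equivalent (Suc n) a (b c)" for c
    unfolding equivalent_def b_def using inv by blast
  ultimately show thesis
    using that[of b g] b00 b0 by blast
qed

lemma equivalent_swap:
  assumes "n > 0"
  obtains b where "equivalent (Suc n) a b" "b 0 0 = a 1 1"
proof -
  define w :: "nat \<Rightarrow> nat \<Rightarrow> int" where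
    "w i j = (if i = (if j = 0 then 1 else if j = 1 then 0 else j) then 1 else 0)" for i j
  have "inverse_mats (Suc n) w w"
    unfolding inverse_mats_def
  proof (intro allI impI)
    fix i j assume ij: "i < Suc n" "j < Suc n"
    let ?j = "if j = 0 then 1 else if j = 1 then 0 else j"
    have "mat_prod (Suc n) w w i j = (\<Sum>r<Suc n. if r = ?j then w i r else 0)"
      unfolding mat_prod_def w_def by (intro sum.cong refl) auto
    also have "\<dots> = w i ?j"
      using ij assms by (simp add: sum.delta)
    finally show "mat_prod (Suc n) w w i j = (if i = j then 1 else 0)"
      unfolding w_def by auto
  qed
  moreover have "pullback (Suc n) w a 0 0 = a 1 1"
    using bilin_unit[of 1 "Suc n" 1 a] assms unfolding pullback_def w_def by simp
  ultimately show thesis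
    using that[of "pullback (Suc n) w a"] unfolding equivalent_def by blast
qed

text \<open>
  Among all equivalent forms choose one with the least first diagonal entry \<open>m\<close>. If \<open>m > 0\<close>, reduce the
  Schur complement by induction, lift and size-reduce. Swapping the first two basis vectors cannot
  produce an entry below \<open>m\<close>, so the second diagonal entry is at least \<open>m\<close>, and the Schur complement
  starts with at least \<open>m - m / 4\<close>. In particular it does not start with 0, so its reduction yields a
  reduced form.
\<close>

theorem reduction:
  assumes "pos_semidef n a"
  shows "\<exists>b. equivalent n a b \<and> (n > 0 \<and> b 0 0 = 0 \<or> reduced n (\<lambda>i j. real_of_int (b i j)))"
  using assms
proof (induction n arbitrary: a)
  case 0
  then show ?case
    using equivalent_refl by auto
next
  case (Suc n)
  have pos_semidef: "pos_semidef (Suc n) b" if "equivalent (Suc n) a b" for b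
    using pos_semidef_represents_form[OF Suc.prems equivalent_imp_represents_form[OF that]] .
  have nonneg: "0 \<le> b 0 0" if "equivalent (Suc n) a b" for b
    using pos_semidef[OF that] bilin_unit[of 0 "Suc n" 0 b] unfolding pos_semidef_def by (metis zero_less_Suc)
  obtain a' where a': "equivalent (Suc n) a a'" "\<And>b. equivalent (Suc n) a b \<Longrightarrow> nat (a' 0 0) \<le> nat (b 0 0)"
    using ex_has_least_nat[of "equivalent (Suc n) a" a "\<lambda>b. nat (b 0 0)"] equivalent_refl by blast
  have min: "a' 0 0 \<le> b 0 0" if "equivalent (Suc n) a b" for b
    using a'(2)[OF that] nonneg[OF that] by simp
  show ?case
  proof (cases "a' 0 0 = 0")
    case True
    then show ?thesis
      using a'(1) by blast
  next
    case False
    define m where "m = a' 0 0"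
    have m: "m > 0"
      using False nonneg[OF a'(1)] unfolding m_def by simp
    have "symmetric_form (Suc n) a'"
      using pos_semidef[OF a'(1)] unfolding pos_semidef_def by blast
    obtain s where s: "equivalent n (scaled_schur a') s"
      "n > 0 \<and> s 0 0 = 0 \<or> reduced n (\<lambda>i j. real_of_int (s i j))"
      using Suc.IH[OF pos_semidef_scaled_schur[OF pos_semidef[OF a'(1)]]] by blast
    obtain B g where B: "\<And>c. equivalent (Suc n) a' (B c)" "\<And>c. B c 0 0 = m"
      "\<And>c j. j < n \<Longrightarrow> B c 0 (Suc j) = g j + m * c j"
      "\<And>c i j. i < n \<Longrightarrow> j < n \<Longrightarrow> scaled_schur (B c) i j = s i j"
      unfolding m_def by (rule equivalent_change_of_basis[OF \<open>symmetric_form (Suc n) a'\<close> s(1)]) blast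
    have "\<forall>j. \<exists>k. 4 * (g j + m * k)^2 \<le> m^2"
    proof
      fix j
      obtain y k where "g j = y + m * k" "4 * y^2 \<le> m^2"
        using absolutely_least_residue[OF m] by blast
      then show "\<exists>k. 4 * (g j + m * k)^2 \<le> m^2"
        by (intro exI[of _ "- k"]) simp
    qed
    then obtain c where c: "\<And>j. 4 * (g j + m * c j)^2 \<le> m^2"
      by metis
    define b where "b = B c"
    have b: "equivalent (Suc n) a b"
      unfolding b_def using equivalent_trans[OF a'(1) B(1)] .
    have b00: "b 0 0 = m"
      unfolding b_def by (rule B(2))
    have b0: "4 * (b 0 (Suc j))^2 \<le> m^2" if "j < n" for j
      unfolding b_def B(3)[OF that] by (rule c)
    have bs: "scaled_schur b i j = s i j" if "i < n" "j < n" for i j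
      unfolding b_def by (rule B(4)[OF that])
    have lovasz: "3 * m^2 \<le> 4 * s 0 0" if n0: "n > 0"
    proof -
      obtain d where d: "equivalent (Suc n) b d" "d 0 0 = b 1 1"
        by (rule equivalent_swap[OF n0])
      have "m \<le> b 1 1"
        using min[OF equivalent_trans[OF b d(1)]] d(2) unfolding m_def by simp
      then have "m * m \<le> m * b 1 1"
        using m by simp
      moreover have "s 0 0 = m * b 1 1 - (b 0 1)^2"
        using bs[of 0 0] n0 b00 unfolding scaled_schur_def by (simp add: power2_eq_square)
      ultimately show ?thesis
        using b0[of 0] n0 by (simp add: power2_eq_square)
    qed
    have red: "reduced n (\<lambda>i j. real_of_int (s i j))"
    proof -
      have "n > 0 \<Longrightarrow> s 0 0 \<noteq> 0"
        using lovasz m by (metis mult_eq_0_iff not_less zero_less_power zero_less_mult_iff zero_less_numeral)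
      then show ?thesis
        using s(2) by blast
    qed
    let ?b = "\<lambda>i j. real_of_int (b i j)"
    have sb: "schur ?b = (\<lambda>i j. 1 / real_of_int m * real_of_int (scaled_schur b i j))"
      using schur_of_int[of b] b00 m by simp
    have "reduced n (schur ?b) \<longleftrightarrow> reduced n (\<lambda>i j. real_of_int (scaled_schur b i j))"
      unfolding sb using m by (intro reduced_scale) simp
    also have "\<dots> \<longleftrightarrow> reduced n (\<lambda>i j. real_of_int (s i j))"
      by (rule reduced_cong) (simp add: bs)
    finally have "reduced n (schur ?b)"
      using red by simp
    moreover have "\<bar>?b 0 (Suc j)\<bar> \<le> ?b 0 0 / 2" if "j < n" for j
    proof -
      have "(2 * b 0 (Suc j))^2 \<le> m^2"
        using b0[OF that] by (simp add: power_mult_distrib)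
      then have "\<bar>2 * b 0 (Suc j)\<bar> \<le> m"
        using m by (metis abs_le_square_iff abs_of_pos)
      then show ?thesis
        unfolding b00 by (simp add: abs_mult flip: of_int_abs)
    qed
    moreover have "?b 0 0 / 2 \<le> schur ?b 0 0" if "n > 0"
    proof -
      have "m * m \<le> 2 * s 0 0"
        using lovasz[OF that] zero_le_square[of m] unfolding power2_eq_square by linarith
      then have "real_of_int (m * m) \<le> real_of_int (2 * s 0 0)"
        unfolding of_int_le_iff .
      then have "real_of_int m * real_of_int m / 2 \<le> real_of_int (s 0 0)"
        by simp
      then show ?thesis
        unfolding sb b00 using bs[of 0 0] that m by (simp add: field_simps)
    qed
    ultimately have "reduced (Suc n) ?b"
      using m b00 by simp
    then show ?thesis
      using b by blast
  qed
qed

section \<open>Sums of pullbacks\<close>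

text \<open>
  The orthogonal sum of the forms in the list represents \<open>a\<close> (\<open>represents_form_orth_sum\<close>). Writing this
  as a sum of pullbacks avoids block matrices while the list is being constructed.
\<close>

fun sum_represents :: "(nat \<times> (nat \<Rightarrow> nat \<Rightarrow> int)) list \<Rightarrow> nat \<Rightarrow> (nat \<Rightarrow> nat \<Rightarrow> int) \<Rightarrow> bool" where
  "sum_represents [] m a \<longleftrightarrow> (\<forall>i<m. \<forall>j<m. a i j = 0)"
| "sum_represents (G # Gs) m a \<longleftrightarrow>
     (\<exists>u b. sum_represents Gs m b \<and> (\<forall>i<m. \<forall>j<m. a i j = pullback (fst G) u (snd G) i j + b i j))"

lemma sum_represents_cong:
  assumes "sum_represents Gs m a" "\<And>i j. i < m \<Longrightarrow> j < m \<Longrightarrow> a i j = b i j"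
  shows "sum_represents Gs m b"
  using assms by (cases Gs) auto

lemma sum_represents_Cons:
  assumes "sum_represents Gs m b" "\<And>i j. i < m \<Longrightarrow> j < m \<Longrightarrow> a i j = pullback n u g i j + b i j"
  shows "sum_represents ((n, g) # Gs) m a"
  using assms by (simp only: sum_represents.simps fst_conv snd_conv) blast

lemma sum_represents_zero: "sum_represents Gs m (\<lambda>i j. 0)"
proof (induction Gs)
  case (Cons G Gs)
  have "pullback (fst G) (\<lambda>i j. 0) (snd G) i j = 0" for i j
    unfolding pullback_def bilin_def by simp
  with Cons show ?case
    by (auto intro!: exI[of _ "\<lambda>i j. 0"])
qed simp

lemma sum_represents_append:
  assumes "sum_represents Gs m a" "sum_represents Hs m b"
  shows "sum_represents (Gs @ Hs) m (\<lambda>i j. a i j + b i j)"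
  using assms(1)
proof (induction Gs arbitrary: a)
  case Nil
  then show ?case
    using assms(2) by (auto intro: sum_represents_cong)
next
  case (Cons G Gs)
  then obtain u c where u: "sum_represents Gs m c" "\<And>i j. i < m \<Longrightarrow> j < m \<Longrightarrow> a i j = pullback (fst G) u (snd G) i j + c i j"
    by auto
  show ?case
    unfolding append_Cons
    by (subst prod.collapse[of G, symmetric], rule sum_represents_Cons[OF Cons.IH[OF u(1)], where u = u])
      (simp add: u(2))
qed

lemma sum_represents_append_left: "sum_represents Gs m a \<Longrightarrow> sum_represents (Gs @ Hs) m a"
  using sum_represents_append[OF _ sum_represents_zero] by simp

lemma sum_represents_append_right: "sum_represents Hs m a \<Longrightarrow> sum_represents (Gs @ Hs) m a"
  using sum_represents_append[OF sum_represents_zero] by simp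

lemma sum_represents_represents_form:
  assumes "sum_represents Gs n a" "represents_form n a m b"
  shows "sum_represents Gs m b"
proof -
  obtain v where v: "\<And>i j. i < m \<Longrightarrow> j < m \<Longrightarrow> b i j = pullback n v a i j"
    using assms(2) unfolding represents_form_def by blast
  have "sum_represents Gs m (pullback n v a)"
    using assms(1)
  proof (induction Gs arbitrary: a)
    case Nil
    then have "pullback n v a i j = 0" for i j
      unfolding pullback_def bilin_def by simp
    then show ?case
      by simp
  next
    case (Cons G Gs)
    then obtain u c where u: "sum_represents Gs n c" "\<And>i j. i < n \<Longrightarrow> j < n \<Longrightarrow> a i j = pullback (fst G) u (snd G) i j + c i j"
      by auto
    have "pullback n v a i j = pullback (fst G) (mat_prod n u v) (snd G) i j + pullback n v c i j" for i j
    proof -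
      have "pullback n v a i j = pullback n v (\<lambda>i j. pullback (fst G) u (snd G) i j + c i j) i j"
        by (rule pullback_cong) (use u(2) in auto)
      also have "\<dots> = pullback n v (pullback (fst G) u (snd G)) i j + pullback n v c i j"
        unfolding pullback_def[of n] bilin_add ..
      finally show ?thesis
        unfolding pullback_pullback .
    qed
    then show ?case
      using Cons.IH[OF u(1)] by auto
  qed
  then show ?thesis
    by (rule sum_represents_cong) (simp add: v)
qed

lemma sum_represents_single:
  assumes "(n, g) \<in> set Gs" "represents_form n g m a"
  shows "sum_represents Gs m a"
proof -
  obtain u where u: "\<And>i j. i < m \<Longrightarrow> j < m \<Longrightarrow> a i j = pullback n u g i j"
    using assms(2) unfolding represents_form_def by blast
  obtain As Bs where Gs: "Gs = As @ (n, g) # Bs"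
    using assms(1) by (meson split_list)
  have "sum_represents ((n, g) # Bs) m a"
    by (rule sum_represents_Cons[OF sum_represents_zero, where u = u]) (simp add: u)
  then show ?thesis
    unfolding Gs by (rule sum_represents_append_right)
qed

text \<open>
  If \<open>c = p\<^sup>2 + q\<^sup>2 + r\<^sup>2 + s\<^sup>2\<close>, map each vector \<open>x\<close> to \<open>(p x, q x, r x, s x)\<close>.
\<close>

lemma sum_represents_multiple:
  "sum_represents (replicate 4 (n, g)) n (\<lambda>i j. int c * g i j)"
proof -
  obtain p q r s where c: "int c = p^2 + q^2 + r^2 + s^2"
    using four_squares by blast
  have one: "sum_represents [(n, g)] n (\<lambda>i j. t^2 * g i j)" for t
  proof -
    let ?u = "\<lambda>i j :: nat. if i = j then t else 0"
    have "pullback n ?u g i j = t^2 * g i j" if "i < n" "j < n" for i j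
    proof -
      have "pullback n ?u g i j = bilin n g (\<lambda>r. t * (if r = i then 1 else 0)) (\<lambda>r. t * (if r = j then 1 else 0))"
        unfolding pullback_def by (rule bilin_cong) auto
      then show ?thesis
        unfolding bilin_scale_left bilin_scale_right bilin_unit[OF that] by (simp add: power2_eq_square)
    qed
    then show ?thesis
      by (intro sum_represents_Cons[OF sum_represents_zero, where u = ?u]) simp
  qed
  have "sum_represents ([(n, g)] @ [(n, g)] @ [(n, g)] @ [(n, g)]) n
      (\<lambda>i j. p^2 * g i j + (q^2 * g i j + (r^2 * g i j + s^2 * g i j)))"
    by (intro sum_represents_append one)
  moreover have "replicate 4 (n, g) = [(n, g)] @ [(n, g)] @ [(n, g)] @ [(n, g)]"
    by (simp add: eval_nat_numeral)
  ultimately show ?thesis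
    by (auto simp: c algebra_simps elim!: sum_represents_cong)
qed

lemma sum_represents_multiples:
  "sum_represents (concat (map (\<lambda>g. replicate 4 (n, g)) gs)) n (\<lambda>i j. \<Sum>g\<leftarrow>gs. int (c g) * g i j)"
proof (induction gs)
  case (Cons g gs)
  have "sum_represents (replicate 4 (n, g) @ concat (map (\<lambda>g. replicate 4 (n, g)) gs)) n
     (\<lambda>i j. int (c g) * g i j + (\<Sum>g\<leftarrow>gs. int (c g) * g i j))"
    by (intro sum_represents_append sum_represents_multiple Cons.IH)
  then show ?case
    by simp
qed simp

text \<open>
  The number \<open>q\<close> of summands is arbitrary, while the list depends only on the finite set from which
  they are taken.
\<close>

lemma sum_represents_family:
  fixes q :: nat
  assumes "set gs = S" "distinct gs" "\<And>t. t < q \<Longrightarrow> F t \<in> S"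
  shows "sum_represents (concat (map (\<lambda>g. replicate 4 (n, g)) gs)) n (\<lambda>i j. \<Sum>t<q. F t i j)"
proof -
  define c where "c g = card {t. t < q \<and> F t = g}" for g
  have "(\<Sum>t<q. F t i j) = (\<Sum>g\<leftarrow>gs. int (c g) * g i j)" for i j
  proof -
    have "(\<Sum>t<q. F t i j) = (\<Sum>g\<in>S. \<Sum>t\<in>{t \<in> {..<q}. F t = g}. F t i j)"
      using assms(1,3) by (intro sum.group[symmetric]) auto
    also have "\<dots> = (\<Sum>g\<in>S. int (c g) * g i j)"
      unfolding c_def by (intro sum.cong refl) simp
    also have "\<dots> = (\<Sum>g\<leftarrow>gs. int (c g) * g i j)"
      using assms(1,2) by (simp add: sum_list_distinct_conv_sum_set)
    finally show ?thesis .
  qed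
  then show ?thesis
    using sum_represents_multiples[of n gs c] by simp
qed

section \<open>Splitting reduced forms\<close>

text \<open>
  Rounding a real form to an integral one changes it by at most \<open>n\<close> times the sum of squares
  (\<open>quad_rounded\<close>); adding \<open>c\<close> on the diagonal gives control over the sign of the change.
\<close>

definition rounded :: "int \<Rightarrow> (nat \<Rightarrow> nat \<Rightarrow> real) \<Rightarrow> nat \<Rightarrow> nat \<Rightarrow> int" where
  "rounded c f i j = \<lfloor>f i j\<rfloor> + (if i = j then c else 0)"

lemma sym_rounded: "symmetric_form n f \<Longrightarrow> symmetric_form n (rounded c f)"
  unfolding symmetric_form_def rounded_def by simp

lemma quad_of_int:
  "real_of_int (quad n a x) = quad n (\<lambda>i j. real_of_int (a i j)) (\<lambda>i. real_of_int (x i))"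
  unfolding bilin_def by simp

lemma quad_scalar_matrix:
  fixes c :: real
  shows "quad n (\<lambda>i j. if i = j then c else 0) x = c * (\<Sum>i<n. (x i)^2)"
proof -
  have "(\<Sum>j<n. (if i = j then c else 0) * x i * x j) = c * (x i)^2" if "i < n" for i
  proof -
    have "(\<Sum>j<n. (if i = j then c else 0) * x i * x j) = (\<Sum>j<n. if j = i then c * x i * x j else 0)"
      by (intro sum.cong refl) auto
    then show ?thesis
      using that by (simp add: sum.delta power2_eq_square)
  qed
  then show ?thesis
    unfolding bilin_def sum_distrib_left by (intro sum.cong refl) auto
qed

lemma quad_rounded:
  "\<bar>quad n (\<lambda>i j. real_of_int (rounded c f i j)) x - quad n f x - real_of_int c * (\<Sum>i<n. (x i)^2)\<bar>
     \<le> real n * (\<Sum>i<n. (x i)^2)"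
proof -
  have "quad n (\<lambda>i j. real_of_int (rounded c f i j)) x - quad n f x - real_of_int c * (\<Sum>i<n. (x i)^2)
     = quad n (\<lambda>i j. real_of_int (rounded c f i j) - f i j - (if i = j then real_of_int c else 0)) x"
    unfolding bilin_diff quad_scalar_matrix ..
  moreover have "\<bar>real_of_int (rounded c f i j) - f i j - (if i = j then real_of_int c else 0)\<bar> \<le> 1" for i j
  proof -
    have "real_of_int (rounded c f i j) - f i j - (if i = j then real_of_int c else 0)
        = real_of_int \<lfloor>f i j\<rfloor> - f i j"
      unfolding rounded_def by simp
    then show ?thesis
      by linarith
  qed
  ultimately show ?thesis
    using abs_quad_le[of n _ 1 x] by simp
qed

lemma sum_int_squares:
  fixes x :: "nat \<Rightarrow> int"
  shows "(\<forall>i<n. x i = 0) \<or> 1 \<le> (\<Sum>i<n. (real_of_int (x i))^2)"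
proof (rule disjCI)
  assume "\<not> 1 \<le> (\<Sum>i<n. (real_of_int (x i))^2)"
  moreover have "(\<Sum>i<n. (real_of_int (x i))^2) = real_of_int (\<Sum>i<n. (x i)^2)"
    by simp
  ultimately have "(\<Sum>i<n. (x i)^2) \<le> 0"
    by linarith
  moreover have "0 \<le> (\<Sum>i<n. (x i)^2)"
    by (simp add: sum_nonneg)
  ultimately show "\<forall>i<n. x i = 0"
    by (simp add: sum_nonneg_eq_0_iff)
qed

lemma quad_zero_vec: "(\<And>i. i < n \<Longrightarrow> x i = 0) \<Longrightarrow> quad n a x = 0"
  unfolding bilin_def by simp

definition lift_form :: "(nat \<Rightarrow> nat \<Rightarrow> int) \<Rightarrow> nat \<Rightarrow> nat \<Rightarrow> int" where
  "lift_form z = case_nat (\<lambda>j. 0) (\<lambda>i. case_nat 0 (z i))"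

lemma lift_form_simps [simp]:
  "lift_form z 0 j = 0" "lift_form z i 0 = 0" "lift_form z (Suc i) (Suc j) = z i j"
  unfolding lift_form_def by (simp_all split: nat.split)

lemma quad_lift_form: "quad (Suc n) (lift_form z) x = quad n z (\<lambda>i. x (Suc i))"
  unfolding bilin_Suc by simp

lemma sym_lift_form: "symmetric_form n z \<Longrightarrow> symmetric_form (Suc n) (lift_form z)"
  unfolding symmetric_form_def by (auto simp: lift_form_def split: nat.split)

lemma represents_form_lift_form: "represents_form n z (Suc n) (lift_form z)"
proof -
  define u :: "nat \<Rightarrow> nat \<Rightarrow> int" where "u r i = (if i = Suc r then 1 else 0)" for r i
  have z0: "u r 0 = 0" for r
    unfolding u_def by simp
  have "lift_form z i j = pullback n u z i j" if "i < Suc n" "j < Suc n" for i j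
  proof (cases "i = 0 \<or> j = 0")
    case True
    then show ?thesis
      unfolding pullback_def bilin_def by (auto simp: z0)
  next
    case False
    then obtain i' j' where ij: "i = Suc i'" "j = Suc j'"
      by (meson not0_implies_Suc)
    have "pullback n u z i j = bilin n z (\<lambda>r. if r = i' then 1 else 0) (\<lambda>r. if r = j' then 1 else 0)"
      unfolding pullback_def u_def ij by (rule bilin_cong) auto
    then show ?thesis
      using that bilin_unit[of i' n j' z] unfolding ij by simp
  qed
  then show ?thesis
    unfolding represents_form_def by blast
qed

text \<open>
  The gap between 0 and 3 keeps \<open>z\<close> away from vectors of norm 1 and 2, and the condition on \<open>X\<close> ensures
  that adding \<open>z\<close> to \<open>X\<close> does not matter for vectors on which \<open>X\<close> is at most 2.
\<close>

definition tail_form :: "nat \<Rightarrow> (nat \<Rightarrow> nat \<Rightarrow> real) \<Rightarrow> (nat \<Rightarrow> nat \<Rightarrow> int) \<Rightarrow> bool" where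
  "tail_form n X z \<longleftrightarrow> symmetric_form n z \<and>
     (\<forall>x. quad n z x = 0 \<or> 3 \<le> quad n z x \<and> 3 \<le> quad n X (\<lambda>i. real_of_int (x i)))"

text \<open>
  Follow the successive Schur complements of \<open>a\<close> as long as their first entries stay below a threshold.
  The first one that exceeds it is so large as a form that it can be rounded to an integral form \<open>z\<close>
  with minimum at least 3 in such a way that the difference also is at least 3 and has bounded entries.
  If none exceeds it, take \<open>z = 0\<close>.
\<close>

lemma bounded_split:
  "\<exists>B. \<forall>a. symmetric_form n a \<and> reduced n a \<and> (n > 0 \<longrightarrow> a 0 0 \<le> T) \<longrightarrow>
     (\<exists>z. tail_form n (\<lambda>i j. a i j - real_of_int (z i j)) z \<and>
       (\<forall>i j. i = 0 \<or> j = 0 \<longrightarrow> z i j = 0) \<and>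
       (\<forall>i<n. \<forall>j<n. \<bar>a i j - real_of_int (z i j)\<bar> \<le> B))"
proof (induction n arbitrary: T)
  case 0
  show ?case
    by (intro exI[of _ 0] allI impI exI[of _ "\<lambda>i j. 0"]) (simp add: tail_form_def symmetric_form_def bilin_def)
next
  case (Suc n)
  obtain \<kappa> where \<kappa>: "\<kappa> > 0"
    "\<And>a x. symmetric_form n a \<Longrightarrow> reduced n a \<Longrightarrow> \<kappa> * a 0 0 * (\<Sum>i<n. (x i)^2) \<le> quad n a x"
    using reduced_lower_bound[of n] by blast
  \<comment> \<open>Below, \<open>z\<close> is smaller than the Schur complement by 3 to \<open>2 * n + 3\<close> times the sum of squares,
    which makes both the remainder and \<open>z\<close> at least 3.\<close>
  define W where "W = (2 * real n + 6) / \<kappa>"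
  obtain B0 where B0: "\<forall>a. symmetric_form n a \<and> reduced n a \<and> (n > 0 \<longrightarrow> a 0 0 \<le> W) \<longrightarrow>
     (\<exists>z. tail_form n (\<lambda>i j. a i j - real_of_int (z i j)) z \<and>
       (\<forall>i j. i = 0 \<or> j = 0 \<longrightarrow> z i j = 0) \<and>
       (\<forall>i<n. \<forall>j<n. \<bar>a i j - real_of_int (z i j)\<bar> \<le> B0))"
    using Suc.IH[of W] by (rule exE)
  define c where "c = int n + 3"
  define B where "B = \<bar>T\<bar> + \<bar>B0\<bar> + real_of_int c + 1"
  show ?case
  proof (intro exI[of _ B] allI impI)
    fix a assume a: "symmetric_form (Suc n) a \<and> reduced (Suc n) a \<and> (Suc n > 0 \<longrightarrow> a 0 0 \<le> T)"
    then have a0: "0 < a 0 0" "a 0 0 \<le> T" and row: "\<And>j. j < n \<Longrightarrow> \<bar>a 0 (Suc j)\<bar> \<le> a 0 0 / 2"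
      and s: "reduced n (schur a)"
      by auto
    have s: "symmetric_form n (schur a)" "reduced n (schur a)"
      using a s sym_schur by blast+
    have "\<exists>z. tail_form n (\<lambda>i j. schur a i j - real_of_int (z i j)) z \<and>
       (\<forall>i<n. \<forall>j<n. \<bar>schur a i j - real_of_int (z i j)\<bar> \<le> \<bar>B0\<bar> + real_of_int c + 1)"
    proof (cases "n > 0 \<longrightarrow> schur a 0 0 \<le> W")
      case True
      then obtain z where tf: "tail_form n (\<lambda>i j. schur a i j - real_of_int (z i j)) z"
        and zB: "\<forall>i<n. \<forall>j<n. \<bar>schur a i j - real_of_int (z i j)\<bar> \<le> B0"
        using B0[rule_format, of "schur a"] s by blast
      have "\<bar>schur a i j - real_of_int (z i j)\<bar> \<le> \<bar>B0\<bar> + real_of_int c + 1"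
        if "i < n" "j < n" for i j
        using zB[rule_format, OF that] unfolding c_def by simp
      then show ?thesis
        using tf by blast
    next
      case False
      define z where "z = rounded (- c) (schur a)"
      have "quad n z x = 0 \<or> 3 \<le> quad n z x \<and>
          3 \<le> quad n (\<lambda>i j. schur a i j - real_of_int (z i j)) (\<lambda>i. real_of_int (x i))" for x
      proof (cases "\<forall>i<n. x i = 0")
        case True
        then show ?thesis
          by (simp add: quad_zero_vec)
      next
        case nz: False
        define y where "y i = real_of_int (x i)" for i
        define S where "S = (\<Sum>i<n. (y i)^2)"
        have S: "S \<ge> 1"
          using nz sum_int_squares[of n x] unfolding S_def y_def by blast
        define Z where "Z = quad n (\<lambda>i j. real_of_int (z i j)) y"
        have r: "\<bar>Z - quad n (schur a) y + real_of_int c * S\<bar> \<le> real n * S"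
          using quad_rounded[of n "- c" "schur a" y] unfolding Z_def z_def S_def by simp
        have cS: "real_of_int c * S = real n * S + 3 * S"
          unfolding c_def by (simp add: algebra_simps)
        have "0 < n" "W < schur a 0 0"
          using False by auto
        have "(2 * real n + 6) * S = \<kappa> * W * S"
          unfolding W_def using \<kappa>(1) by simp
        also have "\<dots> \<le> \<kappa> * schur a 0 0 * S"
          using \<open>W < schur a 0 0\<close> \<kappa>(1) S by (intro mult_right_mono mult_left_mono) auto
        also have "\<dots> \<le> quad n (schur a) y"
          unfolding S_def by (rule \<kappa>(2)[OF s])
        finally have "2 * (real n * S) + 6 * S \<le> quad n (schur a) y"
          by (simp add: algebra_simps)
        then have "3 \<le> Z" "3 \<le> quad n (schur a) y - Z"
          using r cS S by linarith+
        moreover have "Z = real_of_int (quad n z x)"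
          unfolding Z_def y_def quad_of_int ..
        ultimately show ?thesis
          unfolding bilin_diff y_def[symmetric] Z_def[symmetric] by simp
      qed
      then have "tail_form n (\<lambda>i j. schur a i j - real_of_int (z i j)) z"
        unfolding tail_form_def using sym_rounded[OF s(1)] z_def by blast
      moreover have "\<bar>schur a i j - real_of_int (z i j)\<bar> \<le> \<bar>B0\<bar> + real_of_int c + 1" for i j
      proof -
        define d where "d = (if i = j then real_of_int c else 0)"
        have "real_of_int (z i j) = real_of_int \<lfloor>schur a i j\<rfloor> - d"
          unfolding z_def rounded_def d_def by simp
        moreover have "0 \<le> d" "d \<le> real_of_int c"
          unfolding d_def c_def by simp_all
        moreover have "0 \<le> schur a i j - real_of_int \<lfloor>schur a i j\<rfloor>"
          "schur a i j - real_of_int \<lfloor>schur a i j\<rfloor> \<le> 1" "0 \<le> real_of_int c"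
          unfolding c_def by linarith+
        ultimately show ?thesis
          by linarith
      qed
      ultimately show ?thesis
        by blast
    qed
    then obtain z where z: "tail_form n (\<lambda>i j. schur a i j - real_of_int (z i j)) z"
      "\<And>i j. i < n \<Longrightarrow> j < n \<Longrightarrow> \<bar>schur a i j - real_of_int (z i j)\<bar> \<le> \<bar>B0\<bar> + real_of_int c + 1"
      by blast
    have "quad (Suc n) (lift_form z) x = 0 \<or> 3 \<le> quad (Suc n) (lift_form z) x \<and>
        3 \<le> quad (Suc n) (\<lambda>i j. a i j - real_of_int (lift_form z i j)) (\<lambda>i. real_of_int (x i))" for x
    proof -
      let ?y = "\<lambda>i. real_of_int (x (Suc i))"
      have "quad (Suc n) (\<lambda>i j. a i j - real_of_int (lift_form z i j)) (\<lambda>i. real_of_int (x i))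
          = quad (Suc n) a (\<lambda>i. real_of_int (x i)) - quad n (\<lambda>i j. real_of_int (z i j)) ?y"
        unfolding bilin_diff quad_of_int[symmetric] quad_lift_form ..
      also have "\<dots> \<ge> quad n (schur a) ?y - quad n (\<lambda>i j. real_of_int (z i j)) ?y"
        using quad_complete_square[of n a] a a0(1) by simp
      finally have "quad n (\<lambda>i j. schur a i j - real_of_int (z i j)) ?y
          \<le> quad (Suc n) (\<lambda>i j. a i j - real_of_int (lift_form z i j)) (\<lambda>i. real_of_int (x i))"
        unfolding bilin_diff .
      moreover have "quad n z (\<lambda>i. x (Suc i)) = 0 \<or> 3 \<le> quad n z (\<lambda>i. x (Suc i)) \<and>
          3 \<le> quad n (\<lambda>i j. schur a i j - real_of_int (z i j)) ?y"
        using z(1) unfolding tail_form_def by blast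
      ultimately show ?thesis
        unfolding quad_lift_form by linarith
    qed
    then have "tail_form (Suc n) (\<lambda>i j. a i j - real_of_int (lift_form z i j)) (lift_form z)"
      using z(1) sym_lift_form unfolding tail_form_def by blast
    moreover have "\<bar>a i j - real_of_int (lift_form z i j)\<bar> \<le> B" if "i < Suc n" "j < Suc n" for i j
    proof (cases i)
      case 0
      then show ?thesis
      proof (cases j)
        case 0
        then show ?thesis
          using a0 \<open>i = 0\<close> unfolding B_def c_def by simp
      next
        case (Suc j')
        then show ?thesis
          using a0 row[of j'] \<open>i = 0\<close> that unfolding B_def c_def by simp
      qed
    next
      case (Suc i')
      show ?thesis
      proof (cases j)
        case 0
        then have "a i j = a 0 (Suc i')"
          using a that Suc unfolding symmetric_form_def by auto
        then show ?thesis
          using a0 row[of i'] that 0 Suc unfolding B_def c_def by auto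
      next
        case (Suc j')
        have ij: "i' < n" "j' < n"
          using that \<open>i = Suc i'\<close> \<open>j = Suc j'\<close> by auto
        have "\<bar>a 0 (Suc i')\<bar> * \<bar>a 0 (Suc j')\<bar> \<le> a 0 0 * a 0 0"
          using row[OF ij(1)] row[OF ij(2)] a0(1) by (intro mult_mono) auto
        then have "\<bar>a 0 (Suc i') * a 0 (Suc j') / a 0 0\<bar> \<le> a 0 0"
          using a0(1) by (simp add: abs_mult divide_le_eq)
        moreover have "a i j - real_of_int (lift_form z i j)
            = (schur a i' j' - real_of_int (z i' j')) + a 0 (Suc i') * a 0 (Suc j') / a 0 0"
          unfolding \<open>i = Suc i'\<close> \<open>j = Suc j'\<close> schur_def by simp
        ultimately show ?thesis
          using z(2)[OF ij] a0 unfolding B_def by linarith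
      qed
    qed
    ultimately show "\<exists>z. tail_form (Suc n) (\<lambda>i j. a i j - real_of_int (z i j)) z \<and>
       (\<forall>i j. i = 0 \<or> j = 0 \<longrightarrow> z i j = 0) \<and>
       (\<forall>i<Suc n. \<forall>j<Suc n. \<bar>a i j - real_of_int (z i j)\<bar> \<le> B)"
      by (intro exI[of _ "lift_form z"]) auto
  qed
qed

text \<open>
  The \<open>t\<close>-th of \<open>q\<close> integers that differ by at most 1 and add up to \<open>x\<close>.
\<close>

definition equal_part :: "nat \<Rightarrow> int \<Rightarrow> nat \<Rightarrow> int" where
  "equal_part q x t = x div int q + (if int t < x mod int q then 1 else 0)"

lemma sum_equal_part:
  assumes "q > 0"
  shows "(\<Sum>t<q. equal_part q x t) = x"
proof -
  have m: "0 \<le> x mod int q" "x mod int q < int q"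
    using assms by simp_all
  then have e: "{t. t < q \<and> int t < x mod int q} = {..<nat (x mod int q)}"
    by auto
  have "(\<Sum>t<q. if int t < x mod int q then 1 else 0 :: int) = x mod int q"
    using m(1) by (simp add: sum.If_cases Int_def e)
  then show ?thesis
    unfolding equal_part_def sum.distrib by simp
qed

lemma equal_part_approx:
  assumes "q > 0"
  shows "\<bar>real_of_int (equal_part q x t) - real_of_int x / real q\<bar> \<le> 1"
proof -
  have "x div int q = \<lfloor>real_of_int x / real q\<rfloor>"
    using floor_divide_of_int_eq[of x "int q", where 'a = real] by simp
  then show ?thesis
    unfolding equal_part_def by simp linarith
qed

text \<open>
  Let \<open>m\<close> be the first diagonal entry and \<open>b\<close> the rest of the first row of \<open>a\<close>, and let \<open>q\<close> be about \<open>m / M\<close>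
  for a constant \<open>M\<close>. The form \<open>F t\<close> has as its first row the \<open>t\<close>-th equal parts \<open>mt t\<close> and \<open>g t\<close> of \<open>m\<close> and \<open>b\<close>;
  its other entries are those of \<open>g g\<^sup>T / mt\<close>, rounded and enlarged on the diagonal to make \<open>F t\<close> positive.
  The sum of the \<open>F t\<close> then has the same first row as \<open>a\<close>, and \<open>z\<close> is the difference of the other parts.
  
  The sum of the \<open>g g\<^sup>T / mt\<close> exceeds \<open>b b\<^sup>T / m\<close> by a variance to which each \<open>t\<close> contributes a bounded amount,
  as it does through rounding. Altogether \<open>z\<close> differs from the Schur complement of \<open>a\<close> by at most \<open>O(m / M)\<close>
  times the sum of squares, while the Schur complement is at least a fixed multiple of \<open>m\<close> times the sum
  of squares.
\<close>

lemma large_split: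
  "\<exists>W B. \<forall>a. symmetric_form (Suc n) a \<and> reduced (Suc n) (\<lambda>i j. real_of_int (a i j)) \<and> W \<le> a 0 0 \<longrightarrow>
     (\<exists>(q::nat) F z.
       (\<forall>t<q. symmetric_form (Suc n) (F t) \<and> (\<forall>i<Suc n. \<forall>j<Suc n. \<bar>F t i j\<bar> \<le> B) \<and>
          (\<forall>x. (\<exists>i<Suc n. x i \<noteq> 0) \<longrightarrow> 3 \<le> quad (Suc n) (F t) x)) \<and>
       symmetric_form n z \<and> (\<forall>x. quad n z x = 0 \<or> 3 \<le> quad n z x) \<and>
       (\<forall>i<Suc n. \<forall>j<Suc n. a i j = (\<Sum>t<q. F t i j) + lift_form z i j))"
proof -
  obtain \<kappa> where \<kappa>: "\<kappa> > 0"
    "\<And>a x. symmetric_form n a \<Longrightarrow> reduced n a \<Longrightarrow> \<kappa> * a 0 0 * (\<Sum>i<n. (x i)^2) \<le> quad n a x"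
    using reduced_lower_bound[of n] by blast
  define c where "c = int n + 3"
  \<comment> \<open>The loss per piece is at most \<open>5 * n + 3\<close>: \<open>3 * n\<close> for the variance and \<open>2 * n + 3\<close> for rounding.\<close>
  define M where "M = max 3 \<lceil>4 * (5 * real n + 3) / \<kappa>\<rceil>"
  define W where "W = max M \<lceil>12 / \<kappa>\<rceil>"
  define B where "B = (M + 1)^2 + 2 * M + 2 + c"
  have M: "3 \<le> M" "4 * (5 * real n + 3) \<le> \<kappa> * real_of_int M"
  proof -
    have "4 * (5 * real n + 3) / \<kappa> \<le> real_of_int M"
      unfolding M_def by linarith
    then show "3 \<le> M" "4 * (5 * real n + 3) \<le> \<kappa> * real_of_int M"
      using \<kappa>(1) unfolding M_def by (simp_all add: divide_le_eq mult.commute)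
  qed
  show ?thesis
  proof (rule exI[of _ W], rule exI[of _ B], intro allI impI)
    fix a
    assume asm: "symmetric_form (Suc n) a \<and> reduced (Suc n) (\<lambda>i j. real_of_int (a i j)) \<and> W \<le> a 0 0"
    define m where "m = a 0 0"
    define b where "b j = a 0 (Suc j)" for j
    define A where "A i j = real_of_int (a i j)" for i j
    have symA: "symmetric_form (Suc n) A"
      using asm unfolding A_def symmetric_form_def by simp
    have redA: "reduced (Suc n) A"
      using asm unfolding A_def by simp
    have m: "M \<le> m" "12 \<le> \<kappa> * real_of_int m" "0 < m"
    proof -
      have "W \<le> m"
        using asm unfolding m_def by simp
      then have "12 / \<kappa> \<le> real_of_int m"
        unfolding W_def by linarith
      then show "12 \<le> \<kappa> * real_of_int m"
        using \<kappa>(1) by (simp add: divide_le_eq mult.commute)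
      show "M \<le> m"
        using \<open>W \<le> m\<close> unfolding W_def by simp
      then show "0 < m"
        using M(1) by simp
    qed
    have b: "\<bar>real_of_int (b j)\<bar> \<le> real_of_int m / 2" if "j < n" for j
      using redA that unfolding A_def b_def m_def by simp
    define q where "q = nat (m div M)"
    have "1 \<le> m div M"
      using zdiv_mono1[OF m(1), of M] M(1) by simp
    then have q: "q > 0" "int q = m div M"
      unfolding q_def by simp_all
    have qM: "int q * M \<le> m" "m \<le> 2 * (int q * M)"
    proof -
      have "m = int q * M + m mod M" "0 \<le> m mod M" "m mod M < M"
        unfolding q(2) using M(1) by simp_all
      moreover have "1 * M \<le> int q * M"
        using q(1) M(1) by (intro mult_right_mono) auto
      ultimately show "int q * M \<le> m" "m \<le> 2 * (int q * M)"
        by linarith+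
    qed
    define mt where "mt t = equal_part q m t" for t
    define g where "g t j = equal_part q (b j) t" for t j
    define f where "f t = rounded c (\<lambda>i j. real_of_int (g t i) * real_of_int (g t j) / real_of_int (mt t))" for t
    define F where "F t = case_nat (case_nat (mt t) (g t)) (\<lambda>i. case_nat (g t i) (f t i))" for t
    define z where "z i j = a (Suc i) (Suc j) - (\<Sum>t<q. f t i j)" for i j
    have F: "F t 0 0 = mt t" "F t 0 (Suc j) = g t j" "F t (Suc i) 0 = g t i" "F t (Suc i) (Suc j) = f t i j"
      for t i j
      unfolding F_def by simp_all
    have mq: "real_of_int M \<le> real_of_int m / real q" "real_of_int m / real q \<le> 2 * real_of_int M"
    proof -
      have "real_of_int (int q * M) \<le> real_of_int m" "real_of_int m \<le> real_of_int (2 * (int q * M))"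
        using qM unfolding of_int_le_iff by auto
      then show "real_of_int M \<le> real_of_int m / real q" "real_of_int m / real q \<le> 2 * real_of_int M"
        using q(1) by (simp_all add: field_simps)
    qed
    have mt_approx: "\<bar>real_of_int (mt t) - real_of_int m / real q\<bar> \<le> 1" for t
      unfolding mt_def using equal_part_approx[OF q(1)] .
    have g_approx: "\<bar>real_of_int (g t j) - real_of_int (b j) / real q\<bar> \<le> 1" for t j
      unfolding g_def using equal_part_approx[OF q(1)] .
    have mt: "M \<le> mt t" "mt t \<le> 2 * M + 1" for t
    proof -
      have "M \<le> m div int q"
        using zdiv_mono1[OF qM(1), of "int q"] q(1) by simp
      then show "M \<le> mt t"
        unfolding mt_def equal_part_def by simp
      have "real_of_int (mt t) \<le> 2 * real_of_int M + 1"
        using mt_approx[of t] mq(2) by linarith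
      then show "mt t \<le> 2 * M + 1"
        by linarith
    qed
    have g: "\<bar>g t j\<bar> \<le> M + 1" if "j < n" for t j
    proof -
      have "\<bar>real_of_int (b j) / real q\<bar> \<le> (real_of_int m / 2) / real q"
        unfolding abs_divide abs_of_nat using b[OF that] by (rule divide_right_mono) simp
      then have "\<bar>real_of_int (b j) / real q\<bar> \<le> real_of_int M"
        using mq(2) by simp
      then have "\<bar>real_of_int (g t j)\<bar> \<le> real_of_int M + 1"
        using g_approx[of t j] by linarith
      then show ?thesis
        by linarith
    qed
    have symf: "symmetric_form n (f t)" for t
      unfolding f_def by (rule sym_rounded) (simp add: symmetric_form_def mult.commute)
    have symF: "symmetric_form (Suc n) (F t)" for t
      using symf[of t] unfolding symmetric_form_def by (auto simp: F less_Suc_eq_0_disj)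
    have f_bound: "\<bar>f t i j\<bar> \<le> (M + 1)^2 + 1 + c" if "i < n" "j < n" for t i j
    proof -
      define v where "v = real_of_int (g t i) * real_of_int (g t j) / real_of_int (mt t)"
      have "\<bar>g t i\<bar> * \<bar>g t j\<bar> \<le> (M + 1)^2"
        unfolding power2_eq_square using g[OF that(1)] g[OF that(2)] M(1) by (intro mult_mono) auto
      then have "real_of_int (\<bar>g t i\<bar> * \<bar>g t j\<bar>) \<le> real_of_int ((M + 1)^2)"
        unfolding of_int_le_iff .
      moreover have "\<bar>v\<bar> \<le> real_of_int (\<bar>g t i\<bar> * \<bar>g t j\<bar>)"
        unfolding v_def abs_divide abs_mult using mt(1)[of t] M(1)
        by (simp add: divide_le_eq mult_le_cancel_left1 flip: abs_mult of_int_mult of_int_abs) 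
      ultimately have "\<bar>\<lfloor>v\<rfloor>\<bar> \<le> (M + 1)^2 + 1"
        by linarith
      moreover have "\<bar>f t i j\<bar> \<le> \<bar>\<lfloor>v\<rfloor>\<bar> + c"
        unfolding f_def rounded_def v_def[symmetric] c_def by simp arith
      ultimately show ?thesis
        by simp
    qed
    have F_bound: "\<bar>F t i j\<bar> \<le> B" if "i < Suc n" "j < Suc n" for t i j
    proof -
      have p: "0 \<le> (M + 1)^2" "0 \<le> c"
        unfolding c_def by simp_all
      have "\<bar>mt t\<bar> \<le> B"
        using p M(1) mt[of t] unfolding B_def by linarith
      moreover have "\<bar>g t k\<bar> \<le> B" if "k < n" for k
        using p M(1) g[OF that, of t] unfolding B_def by linarith
      moreover have "\<bar>f t k l\<bar> \<le> B" if "k < n" "l < n" for k l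
        using p M(1) f_bound[OF that, of t] unfolding B_def by linarith
      ultimately show ?thesis
        using that by (cases i; cases j) (simp_all add: F)
    qed
    have f_value: "\<bar>quad n (\<lambda>i j. real_of_int (f t i j)) y - (\<Sum>j<n. real_of_int (g t j) * y j)^2 / real_of_int (mt t)
        - (real n + 3) * (\<Sum>i<n. (y i)^2)\<bar> \<le> real n * (\<Sum>i<n. (y i)^2)" for t y
    proof -
      have "quad n (\<lambda>i j. real_of_int (g t i) * real_of_int (g t j) / real_of_int (mt t)) y
         = quad n (\<lambda>i j. (1 / real_of_int (mt t)) * (real_of_int (g t i) * real_of_int (g t j))) y"
        by simp
      also have "\<dots> = (\<Sum>j<n. real_of_int (g t j) * y j)^2 / real_of_int (mt t)"
        unfolding bilin_scale bilin_rank_one by (simp add: power2_eq_square)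
      finally show ?thesis
        using quad_rounded[of n c "\<lambda>i j. real_of_int (g t i) * real_of_int (g t j) / real_of_int (mt t)" y]
        unfolding f_def c_def by simp
    qed
    have F_pos: "3 \<le> quad (Suc n) (F t) x" if x: "\<exists>i<Suc n. x i \<noteq> 0" for t x
    proof (cases "\<forall>i<n. x (Suc i) = 0")
      case True
      then have "x 0 \<noteq> 0"
        using x by (auto simp: less_Suc_eq_0_disj)
      then have "1 \<le> x 0 * x 0"
        by (metis int_one_le_iff_zero_less mult_eq_0_iff zero_le_square order_le_less)
      then have "mt t * 1 \<le> mt t * (x 0 * x 0)"
        using mt(1)[of t] M(1) by (intro mult_left_mono) auto
      moreover have "quad (Suc n) (F t) x = mt t * (x 0 * x 0)"
        unfolding bilin_Suc F using True by (simp add: bilin_def)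
      ultimately show ?thesis
        using mt(1)[of t] M(1) by linarith
    next
      case False
      define y where "y i = real_of_int (x i)" for i
      define S where "S = (\<Sum>i<n. (y (Suc i))^2)"
      define h where "h = (\<Sum>j<n. real_of_int (g t j) * y (Suc j))"
      have S: "S \<ge> 1"
        using False sum_int_squares[of n "\<lambda>i. x (Suc i)"] unfolding S_def y_def by blast
      have m0: "real_of_int (mt t) > 0"
        using mt(1)[of t] M(1) by simp
      have "real_of_int (quad (Suc n) (F t) x) = real_of_int (mt t) * y 0 * y 0 + 2 * y 0 * h
          + quad n (\<lambda>i j. real_of_int (f t i j)) (\<lambda>i. y (Suc i))"
        unfolding bilin_Suc F h_def y_def by (simp add: quad_of_int)
      moreover have "h^2 / real_of_int (mt t) + (real n + 3) * S - real n * S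
          \<le> quad n (\<lambda>i j. real_of_int (f t i j)) (\<lambda>i. y (Suc i))"
        using f_value[of t "\<lambda>i. y (Suc i)"] unfolding S_def h_def by linarith
      moreover have "real_of_int (mt t) * y 0 * y 0 + 2 * y 0 * h + h^2 / real_of_int (mt t)
          = real_of_int (mt t) * (y 0 + h / real_of_int (mt t))^2"
        using m0 by (simp add: power2_eq_square field_simps)
      moreover have "0 \<le> real_of_int (mt t) * (y 0 + h / real_of_int (mt t))^2"
        using m0 by simp
      ultimately have "3 * S \<le> real_of_int (quad (Suc n) (F t) x)"
        by (simp add: algebra_simps)
      then have "real_of_int 3 \<le> real_of_int (quad (Suc n) (F t) x)"
        using S by simp
      then show ?thesis
        unfolding of_int_le_iff .
    qed
    have z_pos: "quad n z x = 0 \<or> 3 \<le> quad n z x" for x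
    proof (cases "\<forall>i<n. x i = 0")
      case True
      then show ?thesis
        by (simp add: quad_zero_vec)
    next
      case False
      then have "n > 0"
        by auto
      define y where "y i = real_of_int (x i)" for i
      define S where "S = (\<Sum>i<n. (y i)^2)"
      have S: "S \<ge> 1"
        using False sum_int_squares[of n x] unfolding S_def y_def by blast
      define h where "h t = (\<Sum>j<n. real_of_int (g t j) * y j)" for t
      define H where "H = (\<Sum>j<n. real_of_int (b j) * y j)"
      define \<mu> where "\<mu> = real_of_int m"
      define \<nu> where "\<nu> t = real_of_int (mt t)" for t
      have \<mu>: "\<mu> > 0"
        unfolding \<mu>_def using m by simp
      have \<nu>: "\<nu> t \<ge> 1" for t
        unfolding \<nu>_def using mt(1)[of t] M(1) by simp
      have sum_h: "(\<Sum>t<q. h t) = H"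
      proof -
        have "(\<Sum>t<q. h t) = (\<Sum>j<n. (\<Sum>t<q. real_of_int (g t j)) * y j)"
          unfolding h_def sum_distrib_right by (rule sum.swap)
        also have "\<dots> = H"
          unfolding H_def g_def of_int_sum[symmetric] sum_equal_part[OF q(1)] ..
        finally show ?thesis .
      qed
      have sum_\<nu>: "(\<Sum>t<q. \<nu> t) = \<mu>"
        unfolding \<nu>_def \<mu>_def mt_def of_int_sum[symmetric] sum_equal_part[OF q(1)] ..
      \<comment> \<open>The coefficients of \<open>h t\<close> and the number \<open>\<nu> t\<close> deviate by at most 1 from those of \<open>H / q\<close> and from \<open>\<mu> / q\<close>.\<close>
      have dev: "\<nu> t * (h t / \<nu> t - H / \<mu>)^2 \<le> 3 * real n * S" for t
      proof -
        have "\<bar>real_of_int (g t j) - \<nu> t * real_of_int (b j) / \<mu>\<bar> \<le> 3/2" if "j < n" for j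
        proof -
          have "real_of_int (g t j) - \<nu> t * real_of_int (b j) / \<mu>
              = (real_of_int (g t j) - real_of_int (b j) / real q)
                - (real_of_int (b j) / \<mu>) * (\<nu> t - \<mu> / real q)"
            using \<mu> by (simp add: field_simps)
          moreover have "\<bar>(real_of_int (b j) / \<mu>) * (\<nu> t - \<mu> / real q)\<bar> \<le> 1/2 * 1"
            unfolding abs_mult using mt_approx[of t] b[OF that] \<mu>
            by (intro mult_mono) (auto simp: \<nu>_def \<mu>_def abs_divide divide_le_eq)
          ultimately show ?thesis
            using g_approx[of t j] by linarith
        qed
        then have "(\<Sum>j<n. (real_of_int (g t j) - \<nu> t * real_of_int (b j) / \<mu>) * y j)^2
            \<le> (3/2)^2 * real n * S"
          unfolding S_def by (rule square_sum_le)
        moreover have "(\<Sum>j<n. (real_of_int (g t j) - \<nu> t * real_of_int (b j) / \<mu>) * y j)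
            = h t - \<nu> t * H / \<mu>"
          unfolding h_def H_def
          by (simp add: left_diff_distrib sum_subtractf sum_distrib_left sum_divide_distrib mult.assoc)
        ultimately have "(h t - \<nu> t * H / \<mu>)^2 \<le> 9/4 * (real n * S)"
          by (simp add: power2_eq_square)
        moreover have "\<nu> t * (h t / \<nu> t - H / \<mu>)^2 = (h t - \<nu> t * H / \<mu>)^2 / \<nu> t"
          using \<nu>[of t] \<mu> by (simp add: power2_eq_square field_simps)
        moreover have "(h t - \<nu> t * H / \<mu>)^2 / \<nu> t \<le> (h t - \<nu> t * H / \<mu>)^2 / 1"
          using \<nu>[of t] by (intro divide_left_mono) auto
        moreover have "0 \<le> real n * S"
          using S by simp
        ultimately show ?thesis
          by simp
      qed
      have "(\<Sum>t<q. (h t)^2 / \<nu> t) = (\<Sum>t<q. \<nu> t * (h t / \<nu> t - H / \<mu>)^2 + 2 * H / \<mu> * h t - (H / \<mu>)^2 * \<nu> t)"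
      proof (intro sum.cong refl)
        fix t
        have "\<nu> t \<noteq> 0"
          using \<nu>[of t] by simp
        then show "(h t)^2 / \<nu> t = \<nu> t * (h t / \<nu> t - H / \<mu>)^2 + 2 * H / \<mu> * h t - (H / \<mu>)^2 * \<nu> t"
          using \<mu> by (simp add: power2_eq_square field_simps)
      qed
      also have "\<dots> = (\<Sum>t<q. \<nu> t * (h t / \<nu> t - H / \<mu>)^2) + 2 * H / \<mu> * H - (H / \<mu>)^2 * \<mu>"
        unfolding sum_subtractf sum.distrib sum_distrib_left[symmetric] sum_h sum_\<nu> ..
      also have "\<dots> = (\<Sum>t<q. \<nu> t * (h t / \<nu> t - H / \<mu>)^2) + H^2 / \<mu>"
        using \<mu> by (simp add: power2_eq_square field_simps)
      also have "\<dots> \<le> (\<Sum>t<q. 3 * real n * S) + H^2 / \<mu>"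
        using dev by (intro add_mono sum_mono) auto
      finally have sq: "(\<Sum>t<q. (h t)^2 / \<nu> t) \<le> real q * (3 * real n * S) + H^2 / \<mu>"
        by simp
      have "(\<Sum>t<q. quad n (\<lambda>i j. real_of_int (f t i j)) y) \<le> (\<Sum>t<q. (h t)^2 / \<nu> t + (2 * real n + 3) * S)"
      proof (rule sum_mono)
        fix t
        show "quad n (\<lambda>i j. real_of_int (f t i j)) y \<le> (h t)^2 / \<nu> t + (2 * real n + 3) * S"
          using f_value[of t y] unfolding h_def \<nu>_def S_def by (simp add: algebra_simps)
      qed
      then have fs: "(\<Sum>t<q. quad n (\<lambda>i j. real_of_int (f t i j)) y)
          \<le> real q * ((5 * real n + 3) * S) + H^2 / \<mu>"
        using sq by (simp add: sum.distrib algebra_simps)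
      have "real_of_int (quad n z x) = quad n (\<lambda>i j. A (Suc i) (Suc j)) y
          - (\<Sum>t<q. quad n (\<lambda>i j. real_of_int (f t i j)) y)"
        unfolding quad_of_int z_def of_int_diff of_int_sum bilin_diff bilin_sum A_def y_def ..
      moreover have "quad n (\<lambda>i j. A (Suc i) (Suc j)) y = quad n (schur A) y + H^2 / \<mu>"
      proof -
        have "quad n (schur A) y = quad n (\<lambda>i j. A (Suc i) (Suc j)
            - (1 / \<mu>) * (real_of_int (b i) * real_of_int (b j))) y"
          unfolding schur_def A_def b_def \<mu>_def m_def by simp
        then show ?thesis
          unfolding bilin_diff bilin_scale bilin_rank_one H_def by (simp add: power2_eq_square)
      qed
      moreover have "\<kappa> * (\<mu> / 2) * S \<le> quad n (schur A) y"
      proof -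
        have "\<mu> / 2 \<le> schur A 0 0"
          using redA \<open>n > 0\<close> unfolding \<mu>_def m_def A_def by simp
        then have "\<kappa> * (\<mu> / 2) * S \<le> \<kappa> * schur A 0 0 * S"
          using \<kappa>(1) S by (intro mult_right_mono mult_left_mono) auto
        also have "\<dots> \<le> quad n (schur A) y"
          unfolding S_def using \<kappa>(2)[OF sym_schur[OF symA]] redA by simp
        finally show ?thesis .
      qed
      moreover have "real q * ((5 * real n + 3) * S) \<le> \<kappa> * \<mu> / 4 * S"
      proof -
        have "real q * (4 * (5 * real n + 3)) \<le> real q * (\<kappa> * real_of_int M)"
          using M(2) by (intro mult_left_mono) auto
        also have "\<dots> = \<kappa> * (real q * real_of_int M)"
          by simp
        also have "\<dots> \<le> \<kappa> * \<mu>"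
          using mq(1) q(1) \<kappa>(1) unfolding \<mu>_def by (intro mult_left_mono) (auto simp: field_simps)
        finally have "real q * (5 * real n + 3) \<le> \<kappa> * \<mu> / 4"
          by (simp add: algebra_simps)
        then have "real q * (5 * real n + 3) * S \<le> \<kappa> * \<mu> / 4 * S"
          using S by (intro mult_right_mono) auto
        then show ?thesis
          by (simp add: mult.assoc)
      qed
      ultimately have "\<kappa> * \<mu> / 4 * S \<le> real_of_int (quad n z x)"
        using fs by (simp add: field_simps)
      moreover have "3 * 1 \<le> \<kappa> * \<mu> / 4 * S"
        using m(2) S unfolding \<mu>_def by (intro mult_mono) auto
      ultimately have "real_of_int 3 \<le> real_of_int (quad n z x)"
        by simp
      then show ?thesis
        unfolding of_int_le_iff ..
    qed
    have symz: "symmetric_form n z"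
      using symf asm unfolding symmetric_form_def z_def by (auto intro!: sum.cong)
    have sum_F: "a i j = (\<Sum>t<q. F t i j) + lift_form z i j" if "i < Suc n" "j < Suc n" for i j
    proof (cases i)
      case 0
      show ?thesis
        unfolding 0 by (cases j) (simp_all add: F mt_def g_def sum_equal_part[OF q(1)] m_def b_def)
    next
      case (Suc i')
      show ?thesis
      proof (cases j)
        case 0
        have "a (Suc i') 0 = a 0 (Suc i')"
          using asm that unfolding Suc symmetric_form_def by auto
        then show ?thesis
          unfolding Suc 0 by (simp add: F g_def sum_equal_part[OF q(1)] b_def)
      next
        case (Suc j')
        then show ?thesis
          unfolding \<open>i = Suc i'\<close> by (simp add: F z_def)
      qed
    qed
    show "\<exists>(q::nat) F z.
       (\<forall>t<q. symmetric_form (Suc n) (F t) \<and> (\<forall>i<Suc n. \<forall>j<Suc n. \<bar>F t i j\<bar> \<le> B) \<and>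
          (\<forall>x. (\<exists>i<Suc n. x i \<noteq> 0) \<longrightarrow> 3 \<le> quad (Suc n) (F t) x)) \<and>
       symmetric_form n z \<and> (\<forall>x. quad n z x = 0 \<or> 3 \<le> quad n z x) \<and>
       (\<forall>i<Suc n. \<forall>j<Suc n. a i j = (\<Sum>t<q. F t i j) + lift_form z i j)"
    proof (rule exI[of _ q], rule exI[of _ F], rule exI[of _ z], intro conjI)
      show "\<forall>t<q. symmetric_form (Suc n) (F t) \<and> (\<forall>i<Suc n. \<forall>j<Suc n. \<bar>F t i j\<bar> \<le> B) \<and>
          (\<forall>x. (\<exists>i<Suc n. x i \<noteq> 0) \<longrightarrow> 3 \<le> quad (Suc n) (F t) x)"
        using symF F_bound F_pos by blast
    qed (use symz z_pos sum_F in blast)+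
  qed
qed

section \<open>Finitely many forms cover those that avoid a short target\<close>

definition pos_def :: "nat \<Rightarrow> (nat \<Rightarrow> nat \<Rightarrow> int) \<Rightarrow> bool" where
  "pos_def n a \<longleftrightarrow> symmetric_form n a \<and> (\<forall>x. (\<exists>i<n. x i \<noteq> 0) \<longrightarrow> 0 < quad n a x)"

lemma pos_def_imp_pos_semidef:
  assumes "pos_def n a"
  shows "pos_semidef n a"
proof -
  have "0 \<le> quad n a x" for x
    using assms quad_zero_vec[of n x a] unfolding pos_def_def by (cases "\<exists>i<n. x i \<noteq> 0") auto
  then show ?thesis
    using assms unfolding pos_semidef_def pos_def_def by blast
qed

text \<open>
  The value at \<open>t x + y\<close> is linear in \<open>t\<close> with leading coefficient \<open>2 * bilin n z x y\<close>, so a nonzero coefficient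
  would make it negative for a suitable \<open>t\<close>.
\<close>

lemma pos_semidef_null:
  assumes "pos_semidef n z" "quad n z x = 0"
  shows "bilin n z x y = 0"
proof (rule ccontr)
  define s where "s = bilin n z x y"
  define T where "T = quad n z y"
  define P where "P = (T + 1) * (s * s)"
  define w where "w i = (- (T + 1) * s) * x i + y i" for i
  assume "bilin n z x y \<noteq> 0"
  then have "s \<noteq> 0"
    unfolding s_def .
  then have "1 \<le> s * s"
    by (metis int_one_le_iff_zero_less mult_eq_0_iff zero_le_square order_le_less)
  have "0 \<le> T"
    using assms(1) unfolding pos_semidef_def T_def by blast
  then have "(T + 1) * 1 \<le> P"
    unfolding P_def using \<open>1 \<le> s * s\<close> by (intro mult_left_mono) auto
  moreover have "bilin n z y x = s"
    using assms(1) bilin_commute unfolding pos_semidef_def s_def by blast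
  then have "quad n z w = T - 2 * P"
    unfolding P_def w_def bilin_add_left bilin_add_right bilin_scale_left bilin_scale_right assms(2) s_def[symmetric] T_def[symmetric]
    by (simp add: algebra_simps)
  moreover have "0 \<le> quad n z w"
    using assms(1) unfolding pos_semidef_def by blast
  ultimately have "0 \<le> T - 2 * P" "T + 1 \<le> P"
    by simp_all
  then show False
    using \<open>0 \<le> T\<close> by linarith
qed

lemma reduced_imp_pos_def:
  assumes "symmetric_form n a" "reduced n (\<lambda>i j. real_of_int (a i j))"
  shows "pos_def n a"
proof -
  let ?a = "\<lambda>i j. real_of_int (a i j)"
  have "symmetric_form n ?a"
    using assms(1) unfolding symmetric_form_def by simp
  then obtain \<kappa> where \<kappa>: "\<kappa> > 0" "\<And>x. \<kappa> * ?a 0 0 * (\<Sum>i<n. (x i)^2) \<le> quad n ?a x"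
    using reduced_lower_bound[of n] assms(2) by blast
  have "0 < quad n a x" if x: "\<exists>i<n. x i \<noteq> 0" for x
  proof -
    have "n > 0"
      using x by auto
    then have "0 < ?a 0 0"
      using assms(2) by (cases n) auto
    moreover have "1 \<le> (\<Sum>i<n. (real_of_int (x i))^2)"
      using sum_int_squares[of n x] x by blast
    ultimately have "0 < \<kappa> * ?a 0 0 * (\<Sum>i<n. (real_of_int (x i))^2)"
      using \<kappa>(1) by simp
    also have "\<dots> \<le> real_of_int (quad n a x)"
      unfolding quad_of_int by (rule \<kappa>(2))
    finally show ?thesis
      by simp
  qed
  then show ?thesis
    using assms(1) unfolding pos_def_def by blast
qed

lemma represents_form_drop_first: "represents_form (Suc n) a n (\<lambda>i j. a (Suc i) (Suc j))"
proof -
  have "a (Suc i) (Suc j) = pullback (Suc n) (\<lambda>r k. if r = Suc k then 1 else 0) a i j" if "i < n" "j < n" for i j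
    unfolding pullback_def using that bilin_unit[of "Suc i" "Suc n" "Suc j" a] by simp
  then show ?thesis
    unfolding represents_form_def by (intro exI[of _ "\<lambda>r k. if r = Suc k then 1 else 0"]) blast
qed

definition bounded_forms :: "nat \<Rightarrow> int \<Rightarrow> (nat \<Rightarrow> nat \<Rightarrow> int) set" where
  "bounded_forms n B = {X. \<forall>i j. if i < n \<and> j < n then \<bar>X i j\<bar> \<le> B else X i j = 0}"

lemma finite_bounded_forms: "finite (bounded_forms n B)"
proof -
  let ?D = "{..<n} \<times> {..<n}"
  have "bounded_forms n B \<subseteq> curry ` {f. \<forall>p. (p \<in> ?D \<longrightarrow> f p \<in> {-B..B}) \<and> (p \<notin> ?D \<longrightarrow> f p = 0)}"
  proof
    fix X assume X: "X \<in> bounded_forms n B"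
    have "case_prod X \<in> {f. \<forall>p. (p \<in> ?D \<longrightarrow> f p \<in> {-B..B}) \<and> (p \<notin> ?D \<longrightarrow> f p = 0)}"
    proof (intro CollectI allI)
      fix p :: "nat \<times> nat"
      obtain i j where p: "p = (i, j)"
        by (cases p)
      have "if i < n \<and> j < n then \<bar>X i j\<bar> \<le> B else X i j = 0"
        using X unfolding bounded_forms_def by blast
      then show "(p \<in> ?D \<longrightarrow> case_prod X p \<in> {-B..B}) \<and> (p \<notin> ?D \<longrightarrow> case_prod X p = 0)"
        unfolding p by (cases "i < n \<and> j < n") auto
    qed
    then show "X \<in> curry ` {f. \<forall>p. (p \<in> ?D \<longrightarrow> f p \<in> {-B..B}) \<and> (p \<notin> ?D \<longrightarrow> f p = 0)}"
      by (rule rev_image_eqI) simp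
  qed
  moreover have "finite {f. \<forall>p. (p \<in> ?D \<longrightarrow> f p \<in> {-B..B}) \<and> (p \<notin> ?D \<longrightarrow> f p = (0::int))}"
    by (rule finite_set_of_finite_funs) auto
  ultimately show ?thesis
    using finite_surj by blast
qed

definition truncated :: "nat \<Rightarrow> (nat \<Rightarrow> nat \<Rightarrow> int) \<Rightarrow> nat \<Rightarrow> nat \<Rightarrow> int" where
  "truncated n X i j = (if i < n \<and> j < n then X i j else 0)"

lemma bilin_truncated [simp]: "bilin n (truncated n X) x y = bilin n X x y"
  unfolding truncated_def by (rule bilin_cong) auto

lemma symmetric_form_truncated [simp]: "symmetric_form n (truncated n X) \<longleftrightarrow> symmetric_form n X"
  unfolding truncated_def symmetric_form_def by auto

text \<open>
  The two targets of interest are \<open>\<langle>1\<rangle>\<close> and \<open>E8\<close> in a basis of roots. What matters about them is that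
  their basis vectors have norm less than 3.
\<close>

locale short_target =
  fixes r :: nat and k :: "nat \<Rightarrow> nat \<Rightarrow> int"
  assumes rank_pos: "0 < r" and short: "\<And>i. i < r \<Longrightarrow> 0 < k i i \<and> k i i \<le> 2"
begin

lemma not_represents_form_if_min_3:
  assumes "\<And>x. quad n z x = 0 \<or> 3 \<le> quad n z x"
  shows "\<not> represents_form n z r k"
proof
  assume "represents_form n z r k"
  then obtain u where "k 0 0 = pullback n u z 0 0"
    unfolding represents_form_def using rank_pos by blast
  then have "k 0 0 = 0 \<or> 3 \<le> k 0 0"
    unfolding pullback_def using assms by simp
  then show False
    using short[OF rank_pos] by linarith
qed

text \<open>
  The basis vectors of \<open>k\<close> go to vectors on which \<open>X\<close> is at most 2, hence \<open>z\<close> vanishes; these vectors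
  are in the radical of \<open>z\<close>, so \<open>X\<close> and \<open>X + z\<close> have the same inner products on them.
\<close>

lemma represents_form_add_long_form:
  assumes "represents_form n X r k" "pos_semidef n z" "\<And>x. quad n z x = 0 \<or> 3 \<le> quad n X x"
    and "\<And>i j. i < n \<Longrightarrow> j < n \<Longrightarrow> a i j = X i j + z i j"
  shows "represents_form n a r k"
proof -
  obtain u where u: "\<And>i j. i < r \<Longrightarrow> j < r \<Longrightarrow> k i j = pullback n u X i j"
    using assms(1) unfolding represents_form_def by blast
  have "k i j = pullback n u a i j" if ij: "i < r" "j < r" for i j
  proof -
    have "quad n X (\<lambda>s. u s i) = k i i"
      using u[OF ij(1) ij(1)] unfolding pullback_def by simp
    then have "quad n z (\<lambda>s. u s i) = 0"
      using assms(3)[of "\<lambda>s. u s i"] short[OF ij(1)] by linarith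
    then have "pullback n u z i j = 0"
      unfolding pullback_def by (rule pos_semidef_null[OF assms(2)])
    moreover have "pullback n u a i j = pullback n u X i j + pullback n u z i j"
      unfolding pullback_def bilin_add[symmetric] by (rule bilin_cong) (use assms(4) in auto)
    ultimately show ?thesis
      using u[OF ij] by simp
  qed
  then show ?thesis
    unfolding represents_form_def by blast
qed

text \<open>
  The list for \<open>n + 1\<close> consists of the list for \<open>n\<close>, the finitely many possible bounded remainders that do
  not represent \<open>k\<close>, and four copies of each possible piece of a form with large first entry.
\<close>

theorem finite_cover:
  "\<exists>Gs. (\<forall>(d, g) \<in> set Gs. pos_def d g \<and> \<not> represents_form d g r k) \<and>
     (\<forall>a. pos_semidef n a \<and> \<not> represents_form n a r k \<longrightarrow> sum_represents Gs n a)"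
proof (induction n)
  case 0
  show ?case
    by (intro exI[of _ "[]"]) simp
next
  case (Suc n)
  obtain Gs0 where Gs0: "\<forall>(d, g) \<in> set Gs0. pos_def d g \<and> \<not> represents_form d g r k"
    "\<And>a. pos_semidef n a \<Longrightarrow> \<not> represents_form n a r k \<Longrightarrow> sum_represents Gs0 n a"
    using Suc.IH by blast
  obtain W B1 where large: "\<forall>a. symmetric_form (Suc n) a \<and> reduced (Suc n) (\<lambda>i j. real_of_int (a i j)) \<and> W \<le> a 0 0 \<longrightarrow>
     (\<exists>(q::nat) F z.
       (\<forall>t<q. symmetric_form (Suc n) (F t) \<and> (\<forall>i<Suc n. \<forall>j<Suc n. \<bar>F t i j\<bar> \<le> B1) \<and>
          (\<forall>x. (\<exists>i<Suc n. x i \<noteq> 0) \<longrightarrow> 3 \<le> quad (Suc n) (F t) x)) \<and>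
       symmetric_form n z \<and> (\<forall>x. quad n z x = 0 \<or> 3 \<le> quad n z x) \<and>
       (\<forall>i<Suc n. \<forall>j<Suc n. a i j = (\<Sum>t<q. F t i j) + lift_form z i j))"
    using large_split[of n] by (elim exE)
  obtain B2 where bounded: "\<forall>a. symmetric_form (Suc n) a \<and> reduced (Suc n) a \<and> (Suc n > 0 \<longrightarrow> a 0 0 \<le> real_of_int W) \<longrightarrow>
     (\<exists>z. tail_form (Suc n) (\<lambda>i j. a i j - real_of_int (z i j)) z \<and>
       (\<forall>i j. i = 0 \<or> j = 0 \<longrightarrow> z i j = 0) \<and>
       (\<forall>i<Suc n. \<forall>j<Suc n. \<bar>a i j - real_of_int (z i j)\<bar> \<le> B2))"
    using bounded_split[of "Suc n" "real_of_int W"] by (elim exE)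
  define remainders where "remainders = {X \<in> bounded_forms (Suc n) \<lfloor>B2\<rfloor>. pos_def (Suc n) X \<and> \<not> represents_form (Suc n) X r k}"
  define pieces where "pieces = {F \<in> bounded_forms (Suc n) B1. symmetric_form (Suc n) F \<and>
     (\<forall>x. (\<exists>i<Suc n. x i \<noteq> 0) \<longrightarrow> 3 \<le> quad (Suc n) F x)}"
  have "finite remainders" "finite pieces"
    unfolding remainders_def pieces_def using finite_bounded_forms by simp_all
  then obtain xs fs where xs: "set xs = remainders" and fs: "set fs = pieces" "distinct fs"
    by (meson finite_distinct_list)
  define Gx where "Gx = map (Pair (Suc n)) xs"
  define Gf where "Gf = concat (map (\<lambda>g. replicate 4 (Suc n, g)) fs)"
  have pieces_good: "pos_def (Suc n) F \<and> \<not> represents_form (Suc n) F r k" if "F \<in> pieces" for F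
  proof
    have F: "symmetric_form (Suc n) F" "\<And>x. \<exists>i<Suc n. x i \<noteq> 0 \<Longrightarrow> 3 \<le> quad (Suc n) F x"
      using that unfolding pieces_def by auto
    show "pos_def (Suc n) F"
      unfolding pos_def_def using F by fastforce
    show "\<not> represents_form (Suc n) F r k"
      by (rule not_represents_form_if_min_3) (metis F(2) quad_zero_vec)
  qed
  have good: "\<forall>(d, g) \<in> set (Gs0 @ Gx @ Gf). pos_def d g \<and> \<not> represents_form d g r k"
    using Gs0(1) pieces_good unfolding Gx_def Gf_def by (auto simp: xs fs(1) remainders_def)
  have "sum_represents (Gs0 @ Gx @ Gf) (Suc n) a" if a: "pos_semidef (Suc n) a" "\<not> represents_form (Suc n) a r k" for a
  proof -
    obtain b where b: "equivalent (Suc n) a b" "b 0 0 = 0 \<or> reduced (Suc n) (\<lambda>i j. real_of_int (b i j))"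
      using reduction[OF a(1)] by blast
    have pos_semidef_b: "pos_semidef (Suc n) b"
      using pos_semidef_represents_form[OF a(1) equivalent_imp_represents_form[OF b(1)]] .
    then have sym_b: "symmetric_form (Suc n) b"
      unfolding pos_semidef_def by blast
    have nrep_b: "\<not> represents_form (Suc n) b r k"
      using represents_form_trans[OF equivalent_imp_represents_form[OF b(1)]] a(2) by blast
    have tail: "sum_represents Gs0 (Suc n) (lift_form z)" if "pos_semidef n z" "\<not> represents_form n z r k" for z
      using sum_represents_represents_form[OF Gs0(2)[OF that] represents_form_lift_form] .
    have tail_min: "sum_represents Gs0 (Suc n) (lift_form z)"
      if "symmetric_form n z" "\<And>x. quad n z x = 0 \<or> 3 \<le> quad n z x" for z
    proof (rule tail)
      show "pos_semidef n z"
        unfolding pos_semidef_def using that by (metis le_numeral_extra(3) order_trans zero_le_numeral)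
      show "\<not> represents_form n z r k"
        using not_represents_form_if_min_3 that(2) .
    qed
    have "sum_represents (Gs0 @ Gx @ Gf) (Suc n) b"
    proof (cases "b 0 0 = 0")
      case True
      have row: "b 0 j = 0" if "j < Suc n" for j
        using pos_semidef_null[OF pos_semidef_b, of "\<lambda>r. if r = 0 then 1 else 0" "\<lambda>r. if r = j then 1 else 0"]
          bilin_unit[of 0 "Suc n" _ b] that True by simp
      then have col: "b j 0 = 0" if "j < Suc n" for j
        using sym_b that unfolding symmetric_form_def by (metis zero_less_Suc)
      let ?z = "\<lambda>i j. b (Suc i) (Suc j)"
      have "pos_semidef n ?z" "\<not> represents_form n ?z r k"
        using pos_semidef_represents_form[OF pos_semidef_b represents_form_drop_first] represents_form_trans[OF represents_form_drop_first] nrep_b by blast+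
      then have "sum_represents (Gs0 @ Gx @ Gf) (Suc n) (lift_form ?z)"
        by (intro sum_represents_append_left tail)
      then show ?thesis
      proof (rule sum_represents_cong)
        fix i j assume "i < Suc n" "j < Suc n"
        then show "lift_form ?z i j = b i j"
          using row col by (cases i; cases j) auto
      qed
    next
      case False
      then have red: "reduced (Suc n) (\<lambda>i j. real_of_int (b i j))"
        using b(2) by blast
      then have pos_def_b: "pos_def (Suc n) b"
        by (rule reduced_imp_pos_def[OF sym_b])
      show ?thesis
      proof (cases "W \<le> b 0 0")
        case True
        then obtain q :: nat and F z where
          F: "\<forall>t<q. symmetric_form (Suc n) (F t) \<and> (\<forall>i<Suc n. \<forall>j<Suc n. \<bar>F t i j\<bar> \<le> B1) \<and>
            (\<forall>x. (\<exists>i<Suc n. x i \<noteq> 0) \<longrightarrow> 3 \<le> quad (Suc n) (F t) x)"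
          and z: "symmetric_form n z" "\<forall>x. quad n z x = 0 \<or> 3 \<le> quad n z x"
          and bF: "\<forall>i<Suc n. \<forall>j<Suc n. b i j = (\<Sum>t<q. F t i j) + lift_form z i j"
          using large[rule_format, of b] sym_b red by blast
        have "truncated (Suc n) (F t) \<in> pieces" if "t < q" for t
          using F that unfolding pieces_def bounded_forms_def by (auto simp: truncated_def[of _ _ _])
        then have "sum_represents Gf (Suc n) (\<lambda>i j. \<Sum>t<q. truncated (Suc n) (F t) i j)"
          unfolding Gf_def by (rule sum_represents_family[OF fs])
        moreover have "sum_represents Gs0 (Suc n) (lift_form z)"
          using tail_min z by blast
        ultimately have "sum_represents (Gs0 @ Gx @ Gf) (Suc n)
            (\<lambda>i j. lift_form z i j + (\<Sum>t<q. truncated (Suc n) (F t) i j))"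
          by (intro sum_represents_append sum_represents_append_right)
        then show ?thesis
          by (rule sum_represents_cong) (simp add: bF truncated_def)
      next
        case False
        let ?b = "\<lambda>i j. real_of_int (b i j)"
        have "symmetric_form (Suc n) ?b"
          using sym_b unfolding symmetric_form_def by simp
        then obtain z where z: "tail_form (Suc n) (\<lambda>i j. ?b i j - real_of_int (z i j)) z"
          "\<forall>i j. i = 0 \<or> j = 0 \<longrightarrow> z i j = 0"
          "\<forall>i<Suc n. \<forall>j<Suc n. \<bar>?b i j - real_of_int (z i j)\<bar> \<le> B2"
          using bounded[rule_format, of ?b] red False by auto
        define X where "X = truncated (Suc n) (\<lambda>i j. b i j - z i j)"
        have sym_z: "symmetric_form (Suc n) z"
          using z(1) unfolding tail_form_def by blast
        have z_min: "quad (Suc n) z x = 0 \<or> 3 \<le> quad (Suc n) z x \<and> 3 \<le> quad (Suc n) X x" for x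
        proof -
          have "real_of_int (quad (Suc n) X x)
              = quad (Suc n) (\<lambda>i j. ?b i j - real_of_int (z i j)) (\<lambda>i. real_of_int (x i))"
            unfolding X_def bilin_truncated quad_of_int of_int_diff ..
          then have "3 \<le> quad (Suc n) (\<lambda>i j. ?b i j - real_of_int (z i j)) (\<lambda>i. real_of_int (x i))
              \<longleftrightarrow> 3 \<le> quad (Suc n) X x"
            by linarith
          then show ?thesis
            using z(1) unfolding tail_form_def by blast
        qed
        have pos_semidef_z: "pos_semidef (Suc n) z"
          unfolding pos_semidef_def
        proof (intro conjI allI sym_z)
          fix x show "0 \<le> quad (Suc n) z x"
            using z_min[of x] by linarith
        qed
        have lift: "lift_form (\<lambda>i j. z (Suc i) (Suc j)) i j = z i j" for i j
          using z(2) by (cases i; cases j) auto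
        have X_value: "quad (Suc n) X x = quad (Suc n) b x - quad (Suc n) z x" for x
          unfolding X_def bilin_truncated bilin_diff ..
        have "pos_def (Suc n) X"
          unfolding pos_def_def
        proof (intro conjI allI impI)
          show "symmetric_form (Suc n) X"
            using sym_b sym_z unfolding X_def symmetric_form_truncated unfolding symmetric_form_def by simp
          fix x :: "nat \<Rightarrow> int" assume "\<exists>i<Suc n. x i \<noteq> 0"
          then have "0 < quad (Suc n) b x"
            using pos_def_b unfolding pos_def_def by blast
          then show "0 < quad (Suc n) X x"
            using X_value[of x] z_min[of x] by linarith
        qed
        moreover have "\<not> represents_form (Suc n) X r k"
        proof
          assume "represents_form (Suc n) X r k"
          then have "represents_form (Suc n) b r k"
            using pos_semidef_z by (rule represents_form_add_long_form) (use z_min in \<open>auto simp: X_def truncated_def\<close>)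
          then show False
            using nrep_b by blast
        qed
        moreover have "X \<in> bounded_forms (Suc n) \<lfloor>B2\<rfloor>"
          unfolding bounded_forms_def
        proof (intro CollectI allI)
          fix i j
          have "\<bar>b i j - z i j\<bar> \<le> \<lfloor>B2\<rfloor>" if "i < Suc n" "j < Suc n"
            using z(3)[rule_format, OF that] by (simp add: le_floor_iff)
          then show "if i < Suc n \<and> j < Suc n then \<bar>X i j\<bar> \<le> \<lfloor>B2\<rfloor> else X i j = 0"
            unfolding X_def truncated_def by simp
        qed
        ultimately have "(Suc n, X) \<in> set Gx"
          unfolding Gx_def remainders_def[symmetric] using xs remainders_def by auto
        then have "sum_represents Gx (Suc n) X"
          by (rule sum_represents_single) (rule equivalent_imp_represents_form[OF equivalent_refl])
        moreover have "sum_represents Gs0 (Suc n) z"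
        proof -
          have "sum_represents Gs0 (Suc n) (lift_form (\<lambda>i j. z (Suc i) (Suc j)))"
          proof (rule tail_min)
            show "symmetric_form n (\<lambda>i j. z (Suc i) (Suc j))"
              using sym_z unfolding symmetric_form_def by simp
            fix x
            obtain y where y: "quad n (\<lambda>i j. z (Suc i) (Suc j)) x = quad (Suc n) z y"
              by (rule represents_form_value[OF represents_form_drop_first])
            then show "quad n (\<lambda>i j. z (Suc i) (Suc j)) x = 0 \<or> 3 \<le> quad n (\<lambda>i j. z (Suc i) (Suc j)) x"
              unfolding y using z_min[of y] by blast
          qed
          then show ?thesis
            by (rule sum_represents_cong) (simp add: lift)
        qed
        ultimately have "sum_represents (Gs0 @ Gx @ Gf) (Suc n) (\<lambda>i j. z i j + X i j)"
          by (intro sum_represents_append sum_represents_append_left)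
        then show ?thesis
          by (rule sum_represents_cong) (simp add: X_def truncated_def)
      qed
    qed
    then show ?thesis
      using equivalent_imp_represents_form_back[OF b(1)] by (rule sum_represents_represents_form)
  qed
  then show ?case
    using good by (intro exI[of _ "Gs0 @ Gx @ Gf"]) blast
qed

end

section \<open>Orthogonal sums and indecomposable forms\<close>

definition block_form :: "nat \<Rightarrow> (nat \<Rightarrow> nat \<Rightarrow> int) \<Rightarrow> (nat \<Rightarrow> nat \<Rightarrow> int) \<Rightarrow> nat \<Rightarrow> nat \<Rightarrow> int" where
  "block_form d g h i j = (if i < d \<and> j < d then g i j else if d \<le> i \<and> d \<le> j then h (i - d) (j - d) else 0)"

lemma sum_lessThan_add:
  fixes f :: "nat \<Rightarrow> 'a::comm_monoid_add"
  shows "(\<Sum>i<d + m. f i) = (\<Sum>i<d. f i) + (\<Sum>i<m. f (d + i))"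
  by (induction m) (simp_all add: add.assoc)

lemma bilin_block_form:
  "bilin (d + m) (block_form d g h) x y = bilin d g x y + bilin m h (\<lambda>i. x (d + i)) (\<lambda>i. y (d + i))"
proof -
  have "bilin (d + m) (block_form d g h) x y
      = (\<Sum>i<d. \<Sum>j<d. block_form d g h i j * x i * y j) + (\<Sum>i<d. \<Sum>j<m. block_form d g h i (d + j) * x i * y (d + j))
      + ((\<Sum>i<m. \<Sum>j<d. block_form d g h (d + i) j * x (d + i) * y j)
      + (\<Sum>i<m. \<Sum>j<m. block_form d g h (d + i) (d + j) * x (d + i) * y (d + j)))"
    by (simp only: bilin_def sum_lessThan_add sum.distrib add_ac)
  then show ?thesis
    by (simp add: bilin_def block_form_def)
qed

lemma pos_def_block_form:
  assumes "pos_def d g" "pos_def m h"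
  shows "pos_def (d + m) (block_form d g h)"
  unfolding pos_def_def
proof (intro conjI allI impI)
  show "symmetric_form (d + m) (block_form d g h)"
    using assms unfolding pos_def_def symmetric_form_def block_form_def by auto
  fix x :: "nat \<Rightarrow> int"
  assume "\<exists>i<d + m. x i \<noteq> 0"
  then obtain i where i: "i < d + m" "x i \<noteq> 0"
    by blast
  have "0 \<le> quad d g x" "0 \<le> quad m h (\<lambda>i. x (d + i))"
    using pos_def_imp_pos_semidef[OF assms(1)] pos_def_imp_pos_semidef[OF assms(2)] unfolding pos_semidef_def by blast+
  moreover have "0 < quad d g x \<or> 0 < quad m h (\<lambda>i. x (d + i))"
  proof (cases "i < d")
    case True
    then show ?thesis
      using assms(1) i(2) unfolding pos_def_def by blast
  next
    case False
    then have "i - d < m" "x (d + (i - d)) \<noteq> 0"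
      using i by auto
    then have "\<exists>s<m. x (d + s) \<noteq> 0"
      by blast
    then have "0 < quad m h (\<lambda>i. x (d + i))"
      using assms(2) unfolding pos_def_def by simp
    then show ?thesis ..
  qed
  ultimately show "0 < quad (d + m) (block_form d g h) x"
    unfolding bilin_block_form by linarith
qed

fun orth_sum :: "(nat \<times> (nat \<Rightarrow> nat \<Rightarrow> int)) list \<Rightarrow> nat \<times> (nat \<Rightarrow> nat \<Rightarrow> int)" where
  "orth_sum [] = (0, \<lambda>i j. 0)"
| "orth_sum ((d, g) # Gs) = (case orth_sum Gs of (m, h) \<Rightarrow> (d + m, block_form d g h))"

lemma pos_def_orth_sum:
  assumes "\<forall>(d, g) \<in> set Gs. pos_def d g" "orth_sum Gs = (N, a)"
  shows "pos_def N a"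
  using assms
proof (induction Gs arbitrary: N a)
  case Nil
  then show ?case
    by (simp add: pos_def_def symmetric_form_def)
next
  case (Cons G Gs)
  obtain d g m h where "G = (d, g)" "orth_sum Gs = (m, h)"
    by (metis surj_pair)
  then show ?case
    using Cons pos_def_block_form[of d g m h] by auto
qed

lemma represents_form_orth_sum:
  assumes "sum_represents Gs n b" "orth_sum Gs = (N, a)"
  shows "represents_form N a n b"
  using assms
proof (induction Gs arbitrary: N a b)
  case Nil
  then show ?case
    by (simp add: represents_form_def pullback_def bilin_def)
next
  case (Cons G Gs)
  obtain d g m h where G: "G = (d, g)" "orth_sum Gs = (m, h)"
    by (metis surj_pair)
  obtain u c where u: "sum_represents Gs n c" "\<And>i j. i < n \<Longrightarrow> j < n \<Longrightarrow> b i j = pullback d u g i j + c i j"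
    using Cons.prems(1) unfolding G(1) by auto
  obtain v where v: "\<And>i j. i < n \<Longrightarrow> j < n \<Longrightarrow> c i j = pullback m v h i j"
    using Cons.IH[OF u(1) G(2)] unfolding represents_form_def by blast
  define w where "w r i = (if r < d then u r i else v (r - d) i)" for r i
  have "b i j = pullback (d + m) w (block_form d g h) i j" if "i < n" "j < n" for i j
  proof -
    have "bilin d g (\<lambda>r. w r i) (\<lambda>r. w r j) = pullback d u g i j"
      unfolding pullback_def w_def by (rule bilin_cong) auto
    moreover have "bilin m h (\<lambda>r. w (d + r) i) (\<lambda>r. w (d + r) j) = pullback m v h i j"
      unfolding pullback_def w_def by (rule bilin_cong) auto
    ultimately show ?thesis
      unfolding pullback_def[of "d + m"] bilin_block_form using u(2)[OF that] v[OF that] by simp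
  qed
  then show ?case
    using Cons.prems(2) G unfolding represents_form_def by auto
qed

text \<open>
  Decompositions are additive here: a representation by an orthogonal sum writes \<open>k\<close> as a sum of two
  positive semidefinite forms, one for each component.
\<close>

definition indecomposable :: "nat \<Rightarrow> (nat \<Rightarrow> nat \<Rightarrow> int) \<Rightarrow> bool" where
  "indecomposable r k \<longleftrightarrow> (\<forall>g h. pos_semidef r g \<and> pos_semidef r h \<and> (\<forall>i<r. \<forall>j<r. k i j = g i j + h i j) \<longrightarrow>
     (\<forall>i<r. \<forall>j<r. k i j = g i j) \<or> (\<forall>i<r. \<forall>j<r. k i j = h i j))"

lemma represents_form_block_form_cases:
  assumes "represents_form (d + m) (block_form d g h) r k" "pos_semidef d g" "pos_semidef m h"
  obtains g' h' where "represents_form d g r g'" "represents_form m h r h'" "pos_semidef r g'" "pos_semidef r h'"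
    "\<And>i j. i < r \<Longrightarrow> j < r \<Longrightarrow> k i j = g' i j + h' i j"
proof -
  obtain u where u: "\<And>i j. i < r \<Longrightarrow> j < r \<Longrightarrow> k i j = pullback (d + m) u (block_form d g h) i j"
    using assms(1) unfolding represents_form_def by blast
  have represents_forms: "represents_form d g r (pullback d u g)" "represents_form m h r (pullback m (\<lambda>s. u (d + s)) h)"
    unfolding represents_form_def by blast+
  then show thesis
    using pos_semidef_represents_form[OF assms(2)] pos_semidef_represents_form[OF assms(3)] u
    by (intro that[of "pullback d u g" "pullback m (\<lambda>s. u (d + s)) h"])
      (auto simp: pullback_def bilin_block_form)
qed

lemma indecomposable_not_represents_form_orth_sum:
  assumes "indecomposable r k" "0 < r" "k 0 0 \<noteq> 0"
    and "\<forall>(d, g) \<in> set Gs. pos_def d g \<and> \<not> represents_form d g r k" "orth_sum Gs = (N, a)"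
  shows "\<not> represents_form N a r k"
  using assms(4,5)
proof (induction Gs arbitrary: N a)
  case Nil
  then show ?case
    using assms(2,3) by (auto simp: represents_form_def pullback_def bilin_def)
next
  case (Cons G Gs)
  obtain d g m h where G: "G = (d, g)" "orth_sum Gs = (m, h)"
    by (metis surj_pair)
  have "pos_def m h"
    by (rule pos_def_orth_sum[OF _ G(2)]) (use Cons.prems(1) in auto)
  have "pos_def d g" "\<not> represents_form d g r k"
    using Cons.prems(1) G(1) by auto
  have "\<not> represents_form m h r k"
    using Cons.IH[OF _ G(2)] Cons.prems(1) by auto
  show ?case
  proof
    assume "represents_form N a r k"
    then have "represents_form (d + m) (block_form d g h) r k"
      using Cons.prems(2) G by simp
    then obtain g' h' where *: "represents_form d g r g'" "represents_form m h r h'" "pos_semidef r g'" "pos_semidef r h'"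
      "\<And>i j. i < r \<Longrightarrow> j < r \<Longrightarrow> k i j = g' i j + h' i j"
      by (rule represents_form_block_form_cases[OF _ pos_def_imp_pos_semidef[OF \<open>pos_def d g\<close>] pos_def_imp_pos_semidef[OF \<open>pos_def m h\<close>]]) blast
    then have "(\<forall>i<r. \<forall>j<r. k i j = g' i j) \<or> (\<forall>i<r. \<forall>j<r. k i j = h' i j)"
      using assms(1) unfolding indecomposable_def by blast
    then have "represents_form d g r k \<or> represents_form m h r k"
      using *(1,2) unfolding represents_form_def by auto
    then show False
      using \<open>\<not> represents_form d g r k\<close> \<open>\<not> represents_form m h r k\<close> by blast
  qed
qed

lemma pos_semidef_unit:
  assumes "pos_semidef n a" "i < n"
  shows "0 \<le> a i i"
  using assms bilin_unit[of i n i a] unfolding pos_semidef_def by metis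

lemma pos_semidef_zero_row:
  assumes "pos_semidef n a" "i < n" "j < n" "a i i = 0"
  shows "a i j = 0"
  using pos_semidef_null[OF assms(1), of "\<lambda>r. if r = i then 1 else 0" "\<lambda>r. if r = j then 1 else 0"]
    bilin_unit[of i n _ a] assms by simp

lemma indecomposable_one: "indecomposable 1 (\<lambda>i j. 1)"
  unfolding indecomposable_def
proof (intro allI impI)
  fix g h assume *: "pos_semidef 1 g \<and> pos_semidef 1 h \<and> (\<forall>i<1. \<forall>j<1. (1::int) = g i j + h i j)"
  then have "0 \<le> g 0 0" "0 \<le> h 0 0"
    using pos_semidef_unit by auto
  then show "(\<forall>i<1. \<forall>j<1. 1 = g i j) \<or> (\<forall>i<1. \<forall>j<1. 1 = h i j)"
    using * by auto
qed

text \<open>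
  Suppose that a root splits as \<open>1 + 1\<close>. By unimodularity the functional \<open>g i\<close> is given by a vector \<open>p\<close>
  of the lattice. The component of the root in \<open>g\<close> has norm 1, and subtracting the image of \<open>p\<close> leaves
  norm \<open>1 - quad r k p \<ge> 0\<close>. As \<open>k\<close> is even, \<open>p = 0\<close>, which contradicts \<open>g i i = 1\<close>.
\<close>

lemma even_unimodular_root_splits_trivially:
  assumes "pos_def r k" "\<And>x. even (quad r k x)" "inverse_mats r k e"
    and "pos_semidef r g" "pos_semidef r h" "\<And>i j. i < r \<Longrightarrow> j < r \<Longrightarrow> k i j = g i j + h i j"
    and "i < r"
  shows "g i i \<noteq> 1"
proof
  assume g1: "g i i = 1"
  define p where "p l = (\<Sum>j<r. e l j * g i j)" for l
  let ?u = "\<lambda>s. if s = i then 1 else 0 :: int"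
  have k_sum: "bilin r k x y = bilin r g x y + bilin r h x y" for x y
    unfolding bilin_add[symmetric] by (rule bilin_cong) (use assms(6) in auto)
  have kp: "(\<Sum>l<r. k j l * p l) = g i j" if "j < r" for j
  proof -
    have "(\<Sum>l<r. k j l * p l) = (\<Sum>l<r. \<Sum>s<r. k j l * e l s * g i s)"
      unfolding p_def by (simp add: sum_distrib_left mult.assoc)
    also have "\<dots> = (\<Sum>s<r. mat_prod r k e j s * g i s)"
      unfolding mat_prod_def sum_distrib_right by (rule sum.swap)
    also have "\<dots> = (\<Sum>s<r. if s = j then g i s else 0)"
      using assms(3) that unfolding inverse_mats_def by (intro sum.cong refl) auto
    also have "\<dots> = g i j"
      using that by (simp add: sum.delta)
    finally show ?thesis .
  qed
  have gi: "bilin r g ?u y = (\<Sum>j<r. g i j * y j)" for y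
  proof -
    have "bilin r g ?u y = (\<Sum>s<r. if s = i then \<Sum>j<r. g s j * y j else 0)"
      unfolding bilin_def by (intro sum.cong refl) auto
    then show ?thesis
      using assms(7) by (simp add: sum.delta)
  qed
  have k_p: "bilin r k y p = bilin r g ?u y" for y
  proof -
    have "bilin r k y p = (\<Sum>j<r. y j * (\<Sum>l<r. k j l * p l))"
      unfolding bilin_def by (simp add: sum_distrib_left mult_ac)
    also have "\<dots> = (\<Sum>j<r. g i j * y j)"
      using kp by (intro sum.cong refl) auto
    finally show ?thesis
      unfolding gi .
  qed
  have "symmetric_form r g"
    using assms(4) unfolding pos_semidef_def by blast
  have "quad r g (\<lambda>s. ?u s + (- 1) * p s) = quad r g ?u - bilin r g ?u p - bilin r g p ?u + quad r g p"
    unfolding bilin_add_left bilin_add_right bilin_scale_left bilin_scale_right by simp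
  also have "\<dots> = 1 - 2 * quad r k p + quad r g p"
    using bilin_commute[OF \<open>symmetric_form r g\<close>, of p ?u] k_p[of p] bilin_unit[of i r i g] assms(7) g1 by simp
  finally have "0 \<le> 1 - 2 * quad r k p + quad r g p"
    using assms(4) unfolding pos_semidef_def by (metis (no_types, lifting))
  moreover have "0 \<le> quad r h p"
    using assms(5) unfolding pos_semidef_def by blast
  ultimately have "quad r k p \<le> 1"
    using k_sum[of p p] by linarith
  moreover have "0 \<le> quad r k p"
    using pos_def_imp_pos_semidef[OF assms(1)] unfolding pos_semidef_def by blast
  ultimately have "quad r k p = 0"
    using assms(2)[of p] by presburger
  then have "\<And>j. j < r \<Longrightarrow> p j = 0"
    using assms(1) unfolding pos_def_def by (metis less_irrefl)
  then have "bilin r k ?u p = 0"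
    unfolding bilin_def by simp
  then show False
    using k_p[of ?u] bilin_unit[of i r i g] assms(7) g1 by simp
qed

text \<open>
  Connectedness of the Dynkin diagram, phrased through sets of vertices closed under adjacency.
\<close>

definition roots_connected :: "nat \<Rightarrow> (nat \<Rightarrow> nat \<Rightarrow> int) \<Rightarrow> bool" where
  "roots_connected r k \<longleftrightarrow>
     (\<forall>P. (\<forall>i<r. \<forall>j<r. k i j \<noteq> 0 \<longrightarrow> P i \<longrightarrow> P j) \<longrightarrow> (\<exists>i<r. P i) \<longrightarrow> (\<forall>i<r. P i))"

text \<open>
  Each root lies entirely in one of the two summands, and non-orthogonal roots lie in the same one.
\<close>

lemma even_unimodular_indecomposable:
  assumes "pos_def r k" "\<And>x. even (quad r k x)" "inverse_mats r k e"
    and "\<And>i. i < r \<Longrightarrow> k i i = 2" "roots_connected r k"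
  shows "indecomposable r k"
  unfolding indecomposable_def
proof (intro allI impI)
  fix g h
  assume gh: "pos_semidef r g \<and> pos_semidef r h \<and> (\<forall>i<r. \<forall>j<r. k i j = g i j + h i j)"
  have diag: "g i i = 0 \<or> h i i = 0" if "i < r" for i
  proof -
    have "g i i \<noteq> 1"
      using even_unimodular_root_splits_trivially[OF assms(1-3) _ _ _ that, of g h] gh by blast
    moreover have "0 \<le> g i i" "0 \<le> h i i" "g i i + h i i = 2"
      using pos_semidef_unit that gh assms(4)[OF that] by auto
    ultimately show ?thesis
      by linarith
  qed
  have step: "g j j = 0" if ij: "i < r" "j < r" "k i j \<noteq> 0" "g i i = 0" for i j
  proof (rule ccontr)
    assume "g j j \<noteq> 0"
    then have "h j j = 0"
      using diag ij(2) by blast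
    then have "h j i = 0"
      using pos_semidef_zero_row gh ij by blast
    moreover have "h i j = h j i"
      using gh ij unfolding pos_semidef_def symmetric_form_def by blast
    moreover have "g i j = 0"
      using pos_semidef_zero_row gh ij by blast
    ultimately show False
      using gh ij by auto
  qed
  show "(\<forall>i<r. \<forall>j<r. k i j = g i j) \<or> (\<forall>i<r. \<forall>j<r. k i j = h i j)"
  proof (cases "\<exists>i<r. g i i = 0")
    case True
    then have "\<forall>i<r. g i i = 0"
      using assms(5) step unfolding roots_connected_def by (elim allE[of _ "\<lambda>i. g i i = 0"]) blast
    then have "\<forall>i<r. \<forall>j<r. g i j = 0"
      using pos_semidef_zero_row gh by blast
    then show ?thesis
      using gh by auto
  next
    case False
    then have "\<forall>i<r. h i i = 0"
      using diag by blast
    then have "\<forall>i<r. \<forall>j<r. h i j = 0"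
      using pos_semidef_zero_row gh by blast
    then show ?thesis
      using gh by auto
  qed
qed

definition unit_form :: "nat \<Rightarrow> nat \<Rightarrow> int" where
  "unit_form i j = (if i = j then 1 else 0)"

lemma bilin_unit_form: "bilin n unit_form x y = (\<Sum>i<n. x i * y i)"
proof -
  have "(\<Sum>j<n. unit_form i j * x i * y j) = (\<Sum>j<n. if j = i then x i * y j else 0)" for i
    unfolding unit_form_def by (intro sum.cong refl) auto
  then show ?thesis
    unfolding bilin_def by (simp add: sum.delta)
qed

lemma pos_def_unit_form: "pos_def n unit_form"
  unfolding pos_def_def
proof (intro conjI allI impI)
  show "symmetric_form n unit_form"
    unfolding symmetric_form_def unit_form_def by simp
  fix x :: "nat \<Rightarrow> int" assume "\<exists>i<n. x i \<noteq> 0"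
  then obtain i where "i < n" "x i \<noteq> 0"
    by blast
  then show "0 < quad n unit_form x"
    unfolding bilin_unit_form by (intro sum_pos2[of _ i]) (auto simp: zero_less_mult_iff)
qed

text \<open>
  The orthogonal projection along an orthonormal system \<open>v\<close> has integer coefficients, so it splits \<open>a\<close>
  into a pullback of the unit form and a form \<open>b\<close>. A vector on which \<open>b\<close> is 1 would project to a
  further vector of an orthonormal system.
\<close>

lemma orthonormal_complement:
  assumes a: "pos_semidef n a" and j: "represents_form n a j unit_form" "\<not> represents_form n a (Suc j) unit_form" "j \<le> l"
  obtains p b where "pos_semidef n b" "\<not> represents_form n b 1 (\<lambda>i j. 1)"
    "\<And>i m. i < n \<Longrightarrow> m < n \<Longrightarrow> a i m = pullback l p unit_form i m + b i m"
proof -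
  obtain v where v: "\<And>s t. s < j \<Longrightarrow> t < j \<Longrightarrow> unit_form s t = pullback n v a s t"
    using j(1) unfolding represents_form_def by blast
  have sym: "symmetric_form n a"
    using a unfolding pos_semidef_def by blast
  let ?e = "\<lambda>i r. if r = i then 1 else 0 :: int"
  let ?v = "\<lambda>s r. v r s"
  have vv: "bilin n a (?v s) (?v t) = (if s = t then 1 else 0)" if "s < j" "t < j" for s t
    using v[OF that] unfolding pullback_def unit_form_def by simp
  define c where "c x s = bilin n a x (?v s)" for x s
  define proj where "proj x r = x r + (- 1) * (\<Sum>s<j. c x s * v r s)" for x r
  have proj_v: "bilin n a (proj x) (?v t) = 0" if "t < j" for x t
  proof -
    have "bilin n a (proj x) (?v t) = c x t - (\<Sum>s<j. c x s * bilin n a (?v s) (?v t))"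
      unfolding proj_def bilin_add_left bilin_scale_left bilin_sum_left c_def by simp
    also have "(\<Sum>s<j. c x s * bilin n a (?v s) (?v t)) = (\<Sum>s<j. if s = t then c x s else 0)"
      using vv that by (intro sum.cong refl) auto
    finally show ?thesis
      using that by (simp add: sum.delta)
  qed
  have proj_proj: "bilin n a (proj x) (proj y) = bilin n a x y - (\<Sum>s<j. c x s * c y s)" for x y
  proof -
    have "bilin n a (proj x) (proj y) = bilin n a (proj x) y"
      unfolding proj_def[of y] bilin_add_right bilin_scale_right bilin_sum_right using proj_v by simp
    also have "\<dots> = bilin n a x y - (\<Sum>s<j. c x s * bilin n a (?v s) y)"
      unfolding proj_def bilin_add_left bilin_scale_left bilin_sum_left by simp
    also have "\<dots> = bilin n a x y - (\<Sum>s<j. c x s * c y s)"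
      unfolding c_def using bilin_commute[OF sym, of _ y] by simp
    finally show ?thesis .
  qed
  define u where "u r i = proj (?e i) r" for r i
  define b where "b = pullback n u a"
  define p where "p s i = (if s < j then c (?e i) s else 0)" for s i
  have represents_form_b: "represents_form n a n b"
    unfolding represents_form_def b_def by blast
  show thesis
  proof (rule that)
    show "pos_semidef n b"
      using pos_semidef_represents_form[OF a represents_form_b] .
    show "\<not> represents_form n b 1 (\<lambda>i j. 1)"
    proof
      assume "represents_form n b 1 (\<lambda>i j. 1)"
      then obtain x where "1 = pullback n x b 0 0"
        unfolding represents_form_def by auto
      also have "\<dots> = quad n a (\<lambda>r. \<Sum>i<n. x i 0 * u r i)"
        unfolding b_def pullback_def[of n x] bilin_pullback ..
      finally have w1: "quad n a (\<lambda>r. \<Sum>i<n. x i 0 * u r i) = 1" ..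
      define w where "w r = (\<Sum>i<n. x i 0 * u r i)" for r
      have w_v: "bilin n a w (?v t) = 0" if "t < j" for t
        unfolding w_def bilin_sum_left u_def using proj_v[OF that] by simp
      define v' where "v' r s = (if s = j then w r else v r s)" for r s
      have "unit_form s t = pullback n v' a s t" if "s < Suc j" "t < Suc j" for s t
        using that w_v bilin_commute[OF sym] w1 vv unfolding pullback_def v'_def unit_form_def w_def[symmetric]
        by (cases "s = j"; cases "t = j") auto
      then show False
        using j(2) unfolding represents_form_def by blast
    qed
    fix i m assume im: "i < n" "m < n"
    have "pullback l p unit_form i m = (\<Sum>s<l. p s i * p s m)"
      unfolding pullback_def bilin_unit_form ..
    also have "\<dots> = (\<Sum>s<j. c (?e i) s * c (?e m) s)"
      unfolding p_def using j(3) by (intro sum.mono_neutral_cong_right) auto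
    finally have "pullback l p unit_form i m = (\<Sum>s<j. c (?e i) s * c (?e m) s)" .
    moreover have "b i m = bilin n a (proj (?e i)) (proj (?e m))"
      unfolding b_def pullback_def u_def ..
    ultimately show "a i m = pullback l p unit_form i m + b i m"
      unfolding proj_proj bilin_unit[OF im] by simp
  qed
qed

section \<open>Gram matrices and criterion sets\<close>

definition mat_form :: "int mat \<Rightarrow> nat \<Rightarrow> nat \<Rightarrow> int" where
  "mat_form A i j = A $$ (i, j)"

lemma bform_eq_bilin:
  assumes "A \<in> carrier_mat n n" "v \<in> carrier_vec n" "w \<in> carrier_vec n"
  shows "bform A v w = bilin n (mat_form A) (($) v) (($) w)"
proof -
  have "bform A v w = (\<Sum>i<n. v $ i * (\<Sum>j<n. A $$ (i, j) * w $ j))"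
    using assms by (simp add: bform_def scalar_prod_def atLeast0LessThan)
  then show ?thesis
    unfolding bilin_def mat_form_def by (simp add: sum_distrib_left mult_ac)
qed

lemma lattice_of_rank_iff_pos_def:
  "lattice_of_rank n A \<longleftrightarrow> A \<in> carrier_mat n n \<and> pos_def n (mat_form A)"
proof (cases "A \<in> carrier_mat n n")
  case A: True
  have "A\<^sup>T = A \<longleftrightarrow> symmetric_form n (mat_form A)"
  proof
    assume "A\<^sup>T = A"
    then show "symmetric_form n (mat_form A)"
      using A unfolding symmetric_form_def mat_form_def by (metis carrier_matD index_transpose_mat(1))
  next
    assume "symmetric_form n (mat_form A)"
    then show "A\<^sup>T = A"
      using A unfolding symmetric_form_def mat_form_def by (intro eq_matI) auto
  qed
  moreover have "(\<forall>v \<in> carrier_vec n. v \<noteq> 0\<^sub>v n \<longrightarrow> bform A v v > 0)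
     \<longleftrightarrow> (\<forall>x. (\<exists>i<n. x i \<noteq> 0) \<longrightarrow> 0 < quad n (mat_form A) x)" (is "?l \<longleftrightarrow> ?r")
  proof
    assume l: ?l
    show ?r
    proof (intro allI impI)
      fix x :: "nat \<Rightarrow> int" assume "\<exists>i<n. x i \<noteq> 0"
      then obtain i where "i < n" "vec n x $ i \<noteq> 0\<^sub>v n $ i"
        by auto
      then have "vec n x \<noteq> 0\<^sub>v n"
        by metis
      then have "0 < bform A (vec n x) (vec n x)"
        using l by simp
      also have "\<dots> = quad n (mat_form A) (($) (vec n x))"
        using A by (intro bform_eq_bilin) auto
      also have "\<dots> = quad n (mat_form A) x"
        by (rule bilin_cong) auto
      finally show "0 < quad n (mat_form A) x" .
    qed
  next
    assume r: ?r
    show ?l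
    proof (intro ballI impI)
      fix v :: "int vec" assume v: "v \<in> carrier_vec n" "v \<noteq> 0\<^sub>v n"
      then have "\<exists>i<n. v $ i \<noteq> 0"
        by (metis eq_vecI carrier_vecD index_zero_vec)
      then show "0 < bform A v v"
        using r unfolding bform_eq_bilin[OF A v(1) v(1)] by blast
    qed
  qed
  ultimately show ?thesis
    unfolding lattice_of_rank_def pos_def_def using A by blast
qed (simp add: lattice_of_rank_def)

lemma bform_mat_of_represents_form:
  assumes A: "A \<in> carrier_mat n n" and B: "B \<in> carrier_mat m m"
    and u: "\<And>i j. i < m \<Longrightarrow> j < m \<Longrightarrow> mat_form B i j = pullback n u (mat_form A) i j"
    and v: "v \<in> carrier_vec m" "w \<in> carrier_vec m"
  shows "bform A (mat n m (case_prod u) *\<^sub>v v) (mat n m (case_prod u) *\<^sub>v w) = bform B v w"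
proof -
  let ?T = "mat n m (case_prod u)"
  have T: "?T \<in> carrier_mat n m"
    by simp
  have Tv: "(?T *\<^sub>v x) $ r = (\<Sum>j<m. x $ j * u r j)" if "x \<in> carrier_vec m" "r < n" for x r
    using that by (simp add: scalar_prod_def atLeast0LessThan mult.commute)
  have "bform A (?T *\<^sub>v v) (?T *\<^sub>v w) = bilin n (mat_form A) (($) (?T *\<^sub>v v)) (($) (?T *\<^sub>v w))"
    by (rule bform_eq_bilin[OF A mult_mat_vec_carrier[OF T v(1)] mult_mat_vec_carrier[OF T v(2)]])
  also have "\<dots> = bilin n (mat_form A) (\<lambda>r. \<Sum>j<m. v $ j * u r j) (\<lambda>r. \<Sum>j<m. w $ j * u r j)"
    by (rule bilin_cong) (use Tv v in auto)
  also have "\<dots> = bilin m (pullback n u (mat_form A)) (($) v) (($) w)"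
    unfolding bilin_pullback ..
  also have "\<dots> = bilin m (mat_form B) (($) v) (($) w)"
    by (rule bilin_cong) (use u in auto)
  also have "\<dots> = bform B v w"
    using bform_eq_bilin[OF B v] ..
  finally show ?thesis .
qed

lemma represents_iff_represents_form:
  assumes "lattice_of_rank n A" "lattice_of_rank m B"
  shows "represents A B \<longleftrightarrow> represents_form n (mat_form A) m (mat_form B)"
proof
  have A: "A \<in> carrier_mat n n" and B: "B \<in> carrier_mat m m"
    using assms unfolding lattice_of_rank_def by blast+
  then have dims: "dim_row A = n" "dim_row B = m"
    by auto
  {
    assume "represents A B"
    then obtain T where T: "T \<in> carrier_mat n m"
      "\<And>v w. v \<in> carrier_vec m \<Longrightarrow> w \<in> carrier_vec m \<Longrightarrow> bform A (T *\<^sub>v v) (T *\<^sub>v w) = bform B v w"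
      unfolding represents_def form_preserving_def dims by blast
    have "mat_form B i j = pullback n (\<lambda>r i. T $$ (r, i)) (mat_form A) i j" if "i < m" "j < m" for i j
    proof -
      have col: "(T *\<^sub>v unit_vec m l) $ r = T $$ (r, l)" if "l < m" "r < n" for l r
        using T(1) that by simp
      have "mat_form B i j = bilin m (mat_form B) (\<lambda>r. if r = i then 1 else 0) (\<lambda>r. if r = j then 1 else 0)"
        using that by (simp add: bilin_unit)
      also have "\<dots> = bilin m (mat_form B) (($) (unit_vec m i)) (($) (unit_vec m j))"
        by (rule bilin_cong) (use that in \<open>auto simp: unit_vec_def\<close>)
      also have "\<dots> = bform B (unit_vec m i) (unit_vec m j)"
        by (rule bform_eq_bilin[symmetric, OF B]) auto
      also have "\<dots> = bform A (T *\<^sub>v unit_vec m i) (T *\<^sub>v unit_vec m j)"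
        by (rule T(2)[symmetric]) auto
      also have "\<dots> = bilin n (mat_form A) (($) (T *\<^sub>v unit_vec m i)) (($) (T *\<^sub>v unit_vec m j))"
        by (rule bform_eq_bilin[OF A]) (rule mult_mat_vec_carrier[OF T(1)], simp)+
      also have "\<dots> = pullback n (\<lambda>r i. T $$ (r, i)) (mat_form A) i j"
        unfolding pullback_def by (rule bilin_cong) (use col that in auto)
      finally show ?thesis .
    qed
    then show "represents_form n (mat_form A) m (mat_form B)"
      unfolding represents_form_def by blast
  next
    assume "represents_form n (mat_form A) m (mat_form B)"
    then obtain u where u: "\<And>i j. i < m \<Longrightarrow> j < m \<Longrightarrow> mat_form B i j = pullback n u (mat_form A) i j"
      unfolding represents_form_def by blast
    let ?T = "mat n m (case_prod u)"
    have T: "?T \<in> carrier_mat n m"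
      by simp
    have pres: "bform A (?T *\<^sub>v v) (?T *\<^sub>v w) = bform B v w"
      if "v \<in> carrier_vec m" "w \<in> carrier_vec m" for v w
      by (rule bform_mat_of_represents_form[OF A B u that])
    have "inj_on ((*\<^sub>v) ?T) (carrier_vec m)"
    proof (rule inj_onI, rule ccontr)
      fix v w assume vw: "v \<in> carrier_vec m" "w \<in> carrier_vec m" "?T *\<^sub>v v = ?T *\<^sub>v w" "v \<noteq> w"
      have d: "v - w \<in> carrier_vec m"
        using vw by simp
      have "v - w \<noteq> 0\<^sub>v m"
      proof
        assume "v - w = 0\<^sub>v m"
        then have "v $ i - w $ i = 0" if "i < m" for i
          using that vw(1,2) by (metis carrier_vecD index_minus_vec(1) index_zero_vec(1))
        then have "v = w"
          using vw(1,2) by (intro eq_vecI) auto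
        then show False
          using vw(4) by blast
      qed
      then have "0 < bform B (v - w) (v - w)"
        using assms(2) d unfolding lattice_of_rank_def by blast
      also have "\<dots> = bform A (?T *\<^sub>v (v - w)) (?T *\<^sub>v (v - w))"
        using pres[OF d d] ..
      also have "?T *\<^sub>v (v - w) = 0\<^sub>v n"
        using mult_minus_distrib_mat_vec[OF T vw(1,2)] vw(3) mult_mat_vec_carrier[OF T vw(2)] by simp
      also have "bform A (0\<^sub>v n) (0\<^sub>v n) = 0"
        using A unfolding bform_def by simp
      finally show False
        by simp
    qed
    then show "represents A B"
      unfolding represents_def form_preserving_def dims using T pres by blast
  }
qed

text \<open>
  From \<open>K = T\<^sup>T K' T\<close> and \<open>det K = 1\<close> it follows that \<open>det T = \<plusminus>1\<close>, so the inverse of \<open>T\<close> is integral.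
\<close>

lemma unimodular_represented_imp_isometric:
  assumes K: "lattice_of_rank n K" "unimodular K" and K': "lattice_of_rank n K'" "represents K' K"
  shows "isometric K K'"
proof -
  have cK: "K \<in> carrier_mat n n" and cK': "K' \<in> carrier_mat n n"
    using K K' unfolding lattice_of_rank_def by blast+
  obtain u where u: "\<And>i j. i < n \<Longrightarrow> j < n \<Longrightarrow> mat_form K i j = pullback n u (mat_form K') i j"
    using K'(2) represents_iff_represents_form[OF K'(1) K(1)] unfolding represents_form_def by blast
  define T where "T = mat n n (case_prod u)"
  have T: "T \<in> carrier_mat n n"
    unfolding T_def by simp
  have pres: "bform K' (T *\<^sub>v v) (T *\<^sub>v w) = bform K v w"
    if "v \<in> carrier_vec n" "w \<in> carrier_vec n" for v w
    unfolding T_def by (rule bform_mat_of_represents_form[OF cK' cK u that])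
  have "T\<^sup>T * (K' * T) = K"
  proof (rule eq_matI)
    fix i j assume "i < dim_row K" "j < dim_col K"
    then have ij: "i < n" "j < n"
      using cK by auto
    have "(T\<^sup>T * (K' * T)) $$ (i, j) = (\<Sum>r<n. u r i * (\<Sum>s<n. K' $$ (r, s) * u s j))"
      using ij cK' by (simp add: T_def scalar_prod_def atLeast0LessThan)
    also have "\<dots> = pullback n u (mat_form K') i j"
      unfolding pullback_def bilin_def mat_form_def by (simp add: sum_distrib_left mult_ac)
    also have "\<dots> = K $$ (i, j)"
      unfolding u[OF ij, symmetric] mat_form_def ..
    finally show "(T\<^sup>T * (K' * T)) $$ (i, j) = K $$ (i, j)" .
  qed (use cK cK' T in auto)
  then have "det (T\<^sup>T * (K' * T)) = 1"
    using K(2) unfolding unimodular_def by simp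
  moreover have "det (T\<^sup>T * (K' * T)) = det T * (det K' * det T)"
    using det_mult[OF transpose_carrier_mat[THEN iffD2, OF T] mult_carrier_mat[OF cK' T]]
    unfolding det_mult[OF cK' T] det_transpose[OF T] .
  ultimately have "det T * (det K' * det T) = 1"
    by simp
  then have dd: "det T * det T = 1"
  proof -
    have "det T dvd 1"
      using \<open>det T * (det K' * det T) = 1\<close> by (metis dvd_triv_left)
    then have "\<bar>det T\<bar> = 1"
      by simp
    then have "det T = 1 \<or> det T = - 1"
      by linarith
    then show ?thesis
      by auto
  qed
  define S where "S = det T \<cdot>\<^sub>m adj_mat T"
  have S: "S \<in> carrier_mat n n"
    unfolding S_def using adj_mat(1)[OF T] by simp
  have unit: "det T \<cdot>\<^sub>m (det T \<cdot>\<^sub>m 1\<^sub>m n) = 1\<^sub>m n"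
    by (rule eq_matI) (use dd in \<open>auto simp flip: mult.assoc\<close>)
  have TS: "T * S = 1\<^sub>m n"
    unfolding S_def mult_smult_distrib[OF T adj_mat(1)[OF T]] adj_mat(2)[OF T] by (rule unit)
  have ST: "S * T = 1\<^sub>m n"
    unfolding S_def mult_smult_assoc_mat[OF adj_mat(1)[OF T] T] adj_mat(3)[OF T] by (rule unit)
  have TS_vec: "T *\<^sub>v (S *\<^sub>v v) = v" and ST_vec: "S *\<^sub>v (T *\<^sub>v v) = v" if "v \<in> carrier_vec n" for v
    using assoc_mult_mat_vec[OF T S that] assoc_mult_mat_vec[OF S T that] that unfolding TS ST by simp_all
  have "form_preserving S K' K"
    unfolding form_preserving_def
  proof (intro conjI ballI)
    show "S \<in> carrier_mat (dim_row K) (dim_row K')"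
      using S cK cK' by auto
    fix v w :: "int vec" assume "v \<in> carrier_vec (dim_row K')" "w \<in> carrier_vec (dim_row K')"
    then have vw: "v \<in> carrier_vec n" "w \<in> carrier_vec n"
      using cK' by auto
    show "bform K (S *\<^sub>v v) (S *\<^sub>v w) = bform K' v w"
      using pres[OF mult_mat_vec_carrier[OF S vw(1)] mult_mat_vec_carrier[OF S vw(2)]]
      unfolding TS_vec[OF vw(1)] TS_vec[OF vw(2)] ..
  qed
  moreover have "bij_betw ((*\<^sub>v) S) (carrier_vec n) (carrier_vec n)"
    by (rule bij_betw_byWitness[where f' = "(*\<^sub>v) T"])
      (use TS_vec ST_vec mult_mat_vec_carrier[OF S] mult_mat_vec_carrier[OF T] in auto)
  ultimately show ?thesis
    unfolding isometric_def using cK cK' by auto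
qed

text \<open>
  If no member of \<open>S\<close> is isometric to \<open>K\<close>, the lattice with Gram matrix \<open>a\<close> represents all of \<open>S\<close>, so it is
  \<open>n\<close>-universal and represents \<open>K\<close>.
\<close>

lemma criterion_set_contains:
  assumes S: "criterion_set n S" and K: "lattice_of_rank n K" "unimodular K"
    and L: "pos_def N a" "\<not> represents_form N a n (mat_form K)"
    and represents_form_others: "\<And>K'. lattice_of_rank n K' \<Longrightarrow> \<not> represents_form n (mat_form K') n (mat_form K) \<Longrightarrow>
      represents_form N a n (mat_form K')"
  shows "\<exists>K' \<in> S. isometric K K'"
proof (rule ccontr)
  assume none: "\<not> (\<exists>K' \<in> S. isometric K K')"
  define A where "A = mat N N (case_prod a)"
  have A_form: "mat_form A i j = a i j" if "i < N" "j < N" for i j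
    using that unfolding A_def mat_form_def by simp
  have "represents_form N (mat_form A) m b \<longleftrightarrow> represents_form N a m b" for m b
  proof -
    have "pullback N u (mat_form A) i j = pullback N u a i j" for u i j
      by (rule pullback_cong) (use A_form in auto)
    then show ?thesis
      unfolding represents_form_def by simp
  qed
  note represents_form_A = this
  have "pos_def N (mat_form A)"
  proof -
    have "quad N (mat_form A) x = quad N a x" for x
      by (rule bilin_cong) (use A_form in auto)
    then show ?thesis
      using L(1) A_form unfolding pos_def_def symmetric_form_def by simp
  qed
  then have A: "lattice_of_rank N A"
    unfolding lattice_of_rank_iff_pos_def by (simp add: A_def)
  have "represents A K'" if "K' \<in> S" for K'
  proof -
    have K': "lattice_of_rank n K'"
      using S that unfolding criterion_set_def by blast
    have "\<not> represents K' K"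
      using unimodular_represented_imp_isometric[OF K K'] none that by blast
    then have "\<not> represents_form n (mat_form K') n (mat_form K)"
      using represents_iff_represents_form[OF K' K(1)] by blast
    then show ?thesis
      using represents_form_others[OF K'] represents_iff_represents_form[OF A K'] represents_form_A by blast
  qed
  then have "n_universal n A"
    using S A unfolding criterion_set_def is_lattice_def by blast
  then have "represents A K"
    using K(1) unfolding n_universal_def by blast
  then show False
    using L(2) represents_iff_represents_form[OF A K(1)] represents_form_A by blast
qed

section \<open>The lattice E8\<close>

lemma mat_form_E8_entries:
  "mat_form E8 0 1 \<noteq> 0" "mat_form E8 1 2 \<noteq> 0" "mat_form E8 2 3 \<noteq> 0" "mat_form E8 3 4 \<noteq> 0"
  "mat_form E8 4 5 \<noteq> 0" "mat_form E8 5 6 \<noteq> 0" "mat_form E8 2 7 \<noteq> 0"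
  by (simp_all add: mat_form_def E8_def)

lemma indecomposable_E8: "indecomposable 8 (mat_form E8)"
proof -
  have E8: "E8 \<in> carrier_mat 8 8" "pos_def 8 (mat_form E8)"
    using E8_lattice unfolding lattice_of_rank_iff_pos_def by auto
  have "even (quad 8 (mat_form E8) x)" for x
  proof -
    have "even (bform E8 (vec 8 x) (vec 8 x))"
      using E8_even E8(1) unfolding even_lattice_def by simp
    also have "bform E8 (vec 8 x) (vec 8 x) = quad 8 (mat_form E8) (($) (vec 8 x))"
      by (rule bform_eq_bilin[OF E8(1)]) auto
    also have "\<dots> = quad 8 (mat_form E8) x"
      by (rule bilin_cong) auto
    finally show ?thesis .
  qed
  moreover have "inverse_mats 8 (mat_form E8) (mat_form (adj_mat E8))"
    unfolding inverse_mats_def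
  proof (intro allI impI)
    fix i j :: nat assume ij: "i < 8" "j < 8"
    have "E8 * adj_mat E8 = 1\<^sub>m 8"
      using adj_mat(2)[OF E8(1)] E8_unimodular unfolding unimodular_def by (auto intro!: eq_matI)
    then have "(E8 * adj_mat E8) $$ (i, j) = (if i = j then 1 else 0)"
      using ij by simp
    moreover have "(E8 * adj_mat E8) $$ (i, j) = mat_prod 8 (mat_form E8) (mat_form (adj_mat E8)) i j"
      using ij E8(1) adj_mat(1)[OF E8(1)]
      by (simp add: mat_prod_def mat_form_def scalar_prod_def atLeast0LessThan)
    ultimately show "mat_prod 8 (mat_form E8) (mat_form (adj_mat E8)) i j = (if i = j then 1 else 0)"
      by simp
  qed
  moreover have "mat_form E8 i i = 2" if "i < 8" for i
    using that unfolding less_8_cases by (elim disjE) (simp_all add: mat_form_def E8_def)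
  moreover have "roots_connected 8 (mat_form E8)"
    unfolding roots_connected_def
  proof (intro allI impI)
    fix P :: "nat \<Rightarrow> bool" and i :: nat
    assume step: "\<forall>i<8. \<forall>j<8. mat_form E8 i j \<noteq> 0 \<longrightarrow> P i \<longrightarrow> P j" and "\<exists>i<8. P i" and "i < 8"
    have sym: "mat_form E8 i j = mat_form E8 j i" if "i < 8" "j < 8" for i j
      using E8(2) that unfolding pos_def_def symmetric_form_def by blast
    have iff: "P i \<longleftrightarrow> P j" if "i < 8" "j < 8" "mat_form E8 i j \<noteq> 0" for i j
      using step that sym[OF that(1,2)] by metis
    have "P 0 \<longleftrightarrow> P 1" "P 1 \<longleftrightarrow> P 2" "P 2 \<longleftrightarrow> P 3" "P 3 \<longleftrightarrow> P 4" "P 4 \<longleftrightarrow> P 5" "P 5 \<longleftrightarrow> P 6" "P 2 \<longleftrightarrow> P 7"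
      by (rule iff, simp, simp, rule mat_form_E8_entries)+
    then have "P j \<longleftrightarrow> P 0" if "j < 8" for j
      using that unfolding less_8_cases by (elim disjE) simp_all
    then show "P i"
      using \<open>\<exists>i<8. P i\<close> \<open>i < 8\<close> by blast
  qed
  ultimately show ?thesis
    using even_unimodular_indecomposable[OF E8(2)] by blast
qed

lemma criterion_set_contains_E8:
  assumes "criterion_set 8 S"
  shows "\<exists>K' \<in> S. isometric E8 K'"
proof -
  have diag: "mat_form E8 i i = 2" if "i < 8" for i
    using that unfolding less_8_cases by (elim disjE) (simp_all add: mat_form_def E8_def)
  interpret short_target 8 "mat_form E8"
    by unfold_locales (simp_all add: diag)
  obtain Gs where Gs: "\<forall>(d, g) \<in> set Gs. pos_def d g \<and> \<not> represents_form d g 8 (mat_form E8)"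
    "\<And>a. pos_semidef 8 a \<Longrightarrow> \<not> represents_form 8 a 8 (mat_form E8) \<Longrightarrow> sum_represents Gs 8 a"
    using finite_cover[of 8] by blast
  obtain N a where Na: "orth_sum Gs = (N, a)"
    by fastforce
  show ?thesis
  proof (rule criterion_set_contains[OF assms E8_lattice E8_unimodular])
    show "pos_def N a"
      by (rule pos_def_orth_sum[OF _ Na]) (use Gs(1) in auto)
    show "\<not> represents_form N a 8 (mat_form E8)"
      by (rule indecomposable_not_represents_form_orth_sum[OF indecomposable_E8 _ _ Gs(1) Na]) (simp_all add: diag)
    fix K' assume "lattice_of_rank 8 K'" "\<not> represents_form 8 (mat_form K') 8 (mat_form E8)"
    then show "represents_form N a 8 (mat_form K')"
      using Gs(2) pos_def_imp_pos_semidef represents_form_orth_sum[OF _ Na] unfolding lattice_of_rank_iff_pos_def by blast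
  qed
qed

section \<open>The lattice I8\<close>

text \<open>
  Otherwise, padding the \<open>n \<times> (n + 1)\<close> matrix of the representation with a zero row gives a square
  matrix \<open>U\<close> with \<open>U\<^sup>T U = 1\<close>.
\<close>

lemma unit_form_not_represents_form_Suc: "\<not> represents_form n unit_form (Suc n) unit_form"
proof
  assume "represents_form n unit_form (Suc n) unit_form"
  then obtain u where u: "\<And>i j. i < Suc n \<Longrightarrow> j < Suc n \<Longrightarrow> unit_form i j = (\<Sum>r<n. u r i * u r j)"
    unfolding represents_form_def pullback_def bilin_unit_form by blast
  define U where "U = mat (Suc n) (Suc n) (\<lambda>(r, i). if r < n then u r i else 0)"
  have U: "U \<in> carrier_mat (Suc n) (Suc n)"
    unfolding U_def by simp
  have "U\<^sup>T * U = 1\<^sub>m (Suc n)"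
  proof (rule eq_matI)
    fix i j assume "i < dim_row (1\<^sub>m (Suc n) :: int mat)" "j < dim_col (1\<^sub>m (Suc n) :: int mat)"
    then have ij: "i < Suc n" "j < Suc n"
      by auto
    have "(U\<^sup>T * U) $$ (i, j) = (\<Sum>r<Suc n. (if r < n then u r i else 0) * (if r < n then u r j else 0))"
      using ij unfolding U_def by (simp add: scalar_prod_def atLeast0LessThan)
    also have "\<dots> = (\<Sum>r<n. u r i * u r j)"
      by simp
    finally show "(U\<^sup>T * U) $$ (i, j) = 1\<^sub>m (Suc n) $$ (i, j)"
      using u[OF ij] ij unfolding unit_form_def by simp
  qed (use U in auto)
  then have "det U * det U = 1"
    using det_mult[of "U\<^sup>T" "Suc n" U] det_transpose[OF U] U by simp
  moreover have "multrow n 0 U = U"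
    unfolding U_def by (rule eq_matI) auto
  then have "det U = 0"
    using det_multrow[of n "Suc n" U 0] U by simp
  ultimately show False
    by simp
qed

lemma criterion_set_contains_I8:
  assumes "criterion_set 8 S"
  shows "\<exists>K' \<in> S. isometric I8 K'"
proof -
  interpret short_target 1 "\<lambda>i j. 1"
    by unfold_locales simp_all
  obtain Gs where Gs: "\<forall>(d, g) \<in> set Gs. pos_def d g \<and> \<not> represents_form d g 1 (\<lambda>i j. 1)"
    "\<And>a. pos_semidef 8 a \<Longrightarrow> \<not> represents_form 8 a 1 (\<lambda>i j. 1) \<Longrightarrow> sum_represents Gs 8 a"
    using finite_cover[of 8] by blast
  obtain m h where mh: "orth_sum Gs = (m, h)"
    by fastforce
  have pos_def_h: "pos_def m h"
    by (rule pos_def_orth_sum[OF _ mh]) (use Gs(1) in auto)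
  have h_min: "\<not> represents_form m h 1 (\<lambda>i j. 1)"
    by (rule indecomposable_not_represents_form_orth_sum[OF indecomposable_one _ _ Gs(1) mh]) simp_all
  have represents_form_I8: "represents_form n a 8 (mat_form I8) \<longleftrightarrow> represents_form n a 8 unit_form" for n a
    unfolding represents_form_def mat_form_def I8_def unit_form_def by simp
  show ?thesis
  proof (rule criterion_set_contains[OF assms I8_lattice])
    show "unimodular I8"
      unfolding unimodular_def I8_def by simp
    show "pos_def (7 + m) (block_form 7 unit_form h)"
      using pos_def_block_form[OF pos_def_unit_form pos_def_h] .
    show "\<not> represents_form (7 + m) (block_form 7 unit_form h) 8 (mat_form I8)"
    proof
      assume "represents_form (7 + m) (block_form 7 unit_form h) 8 (mat_form I8)"
      then obtain g' h' where *: "represents_form 7 unit_form 8 g'" "represents_form m h 8 h'" "pos_semidef 8 g'" "pos_semidef 8 h'"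
        "\<And>i j. i < 8 \<Longrightarrow> j < 8 \<Longrightarrow> mat_form I8 i j = g' i j + h' i j"
        by (rule represents_form_block_form_cases[OF _ pos_def_imp_pos_semidef[OF pos_def_unit_form] pos_def_imp_pos_semidef[OF pos_def_h]]) blast
      have "h' i i = 0" if i: "i < 8" for i
      proof -
        have "h' i i \<noteq> 1"
        proof
          assume "h' i i = 1"
          obtain u where "\<And>i j. i < 8 \<Longrightarrow> j < 8 \<Longrightarrow> h' i j = pullback m u h i j"
            using *(2) unfolding represents_form_def by blast
          then have "1 = pullback m (\<lambda>r s. u r i) h 0 0"
            using i \<open>h' i i = 1\<close> unfolding pullback_def by simp
          then have "represents_form m h 1 (\<lambda>i j. 1)"
            unfolding represents_form_def by (intro exI[of _ "\<lambda>r s. u r i"]) simp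
          then show False
            using h_min by blast
        qed
        moreover have "0 \<le> g' i i" "0 \<le> h' i i" "g' i i + h' i i = 1"
          using pos_semidef_unit[OF *(3) i] pos_semidef_unit[OF *(4) i] *(5)[OF i i] i
          unfolding mat_form_def I8_def by simp_all
        ultimately show ?thesis
          by linarith
      qed
      then have "h' i j = 0" if "i < 8" "j < 8" for i j
        using pos_semidef_zero_row[OF *(4) that] that by blast
      then have "represents_form 7 unit_form 8 (mat_form I8)"
        using *(1,5) unfolding represents_form_def by simp
      then show False
        using unit_form_not_represents_form_Suc[of 7] represents_form_I8 by simp
    qed
    fix K' assume K': "lattice_of_rank 8 K'" "\<not> represents_form 8 (mat_form K') 8 (mat_form I8)"
    let ?a = "mat_form K'"
    have "pos_semidef 8 ?a"
      using K'(1) pos_def_imp_pos_semidef unfolding lattice_of_rank_iff_pos_def by blast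
    have "represents_form 8 ?a 0 unit_form"
      unfolding represents_form_def by simp
    moreover have "\<not> represents_form 8 ?a 8 unit_form"
      using K'(2) represents_form_I8 by blast
    ultimately obtain j where j: "j < 8" "represents_form 8 ?a j unit_form" "\<not> represents_form 8 ?a (Suc j) unit_form"
      using inc_induct[of 0 8 "\<lambda>j. \<not> represents_form 8 ?a j unit_form"] by auto
    obtain p b where b: "pos_semidef 8 b" "\<not> represents_form 8 b 1 (\<lambda>i j. 1)"
      "\<And>i m. i < 8 \<Longrightarrow> m < 8 \<Longrightarrow> ?a i m = pullback 7 p unit_form i m + b i m"
      by (rule orthonormal_complement[OF \<open>pos_semidef 8 ?a\<close> j(2,3), of 7]) (use j(1) in auto)
    then have "sum_represents ((7, unit_form) # Gs) 8 ?a"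
      using sum_represents_Cons[OF Gs(2)[OF b(1,2)], of ?a 7 p unit_form] by blast
    then show "represents_form (7 + m) (block_form 7 unit_form h) 8 ?a"
      by (rule represents_form_orth_sum) (simp add: mh)
  qed
qed

section \<open>Isometry classes in every 8-criterion set\<close>

theorem corollary4:
  fixes S :: "int mat set"
  assumes "criterion_set 8 S"
  shows "subset_upto_isometry S8 S"
  using criterion_set_contains_E8[OF assms] criterion_set_contains_I8[OF assms]
  unfolding subset_upto_isometry_def S8_def by blast

end
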